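(* Let $\mathbb{A}$ be a semi-abelian category that satisfies the Smith is Huq condition. Consider an internal weak crossed square in $\mathbb{A}$, given by a commutative square $$p_M\colon P\to M,\quad p_N\colon P\to N,\quad \mu\colon M\to L,\quad \nu\colon N\to L,\qquad \mu\circ p_M=\nu\circ p_N,$$ internal actions $\xi^L_M,\xi^L_N,\xi^L_P$ of $L$ on $M$, $N$, $P$ and a morphism $h\colon M\otimes N\to P$. If $h$ is a regular epimorphism and the kernel of $h$ is normal in $Q_{M\otimes N}$ (that is, $\gamma\circ k_h\colon K_h\to Q_{M\otimes N}$ is a normal monomorphism, where $k_h\colon K_h\to M\otimes N$ is the kernel of $h$ and $\gamma\colon M\otimes N\to Q_{M\otimes N}$ is the canonical inclusion), then this weak crossed square is an internal crossed square, i.e. it is the weak crossed square induced by normalisation of an internal double groupoid in $\mathbb{A}$.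
   Context: Semi-abelian: pointed, Barr exact, Bourn protomodular, with binary coproducts. Smith is Huq: the Smith-Pedicchio commutator of two internal equivalence relations vanishes iff the Huq commutator of the associated normal subobjects vanishes. $k_f\colon K_f\to A$ is the kernel of $f\colon A\to B$; $\binom fg$ is the arrow induced on a coproduct. The Higgins commutator $[A,B]\leq X$ of subobjects of $X$ is the image in $X$ of the kernel of the canonical morphism $A+B\to A\times B$; the Huq commutator $[A,B]^{\mathcal Q}_X$ is its normal closure in $X$. Actions and crossed modules. $k_{A,X}\colon A\flat X\to A+X$ is the kernel of $\binom{1_A}{0}\colon A+X\to A$; $f\flat g$ is the restriction of $f+g$. $A\flat(-)$ is a monad (unit induced by $i_X\colon X\to A+X$, multiplication induced by $\binom{i_A}{k_{A,X}}$) and an internal action of $A$ on $X$ is an algebra $\xi\colon A\flat X\to X$ for it. Conjugation is $\chi_A=\binom{1_A}{1_A}\circ k_{A,A}\colon A\flat A\to A$. The semidirect product $X\rtimes_\xi A$ is the coequaliser $\sigma_\xi\colon A+X\to X\rtimes_\xi A$ of $i_X\circ\xi$ and $k_{A,X}$; it is a split extension of $A$ by $X$, with projection $\pi_\xi$ ($\pi_\xi\sigma_\xi=\binom{1_A}{0}$), section $\sigma_\xi i_A$ and kernel $\sigma_\xi i_X$. An internal crossed module $(\partial\colon X\to A,\xi)$ is an action $\xi$ of $A$ on $X$ with $\partial\xi=\chi_A(1_A\flat\partial)$ and $\xi(\partial\flat 1_X)=\chi_X$. It corresponds to the internal groupoid $X\rtimes A\rightrightarrows A$ with $d=\pi_\xi$,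 $e=\sigma_\xi i_A$ and $c$ determined by $c\sigma_\xi=\binom{1_A}{\partial}$; this gives an equivalence $\mathbf{XMod}(\mathbb{A})\simeq\mathbf{Grpd}(\mathbb{A})$. Tensor product. For $L$-crossed modules $(\mu\colon M\to L,\xi_M)$, $(\nu\colon N\to L,\xi_N)$ with groupoids $(M\rtimes L,L,d_M,c_M,e_M)$, $(N\rtimes L,L,d_N,c_N,e_N)$, let $Q$ be the pushout of $e_M$ and $e_N$, with canonical morphisms $e_U\colon M\rtimes L\to Q$, $e_L\colon N\rtimes L\to Q$; let $d_U,c_U\colon Q\to M\rtimes L$ be determined by $d_Ue_U=1=c_Ue_U$, $d_Ue_L=e_Md_N$, $c_Ue_L=e_Mc_N$, and $d_L,c_L\colon Q\to N\rtimes L$ by $d_Le_L=1=c_Le_L$, $d_Le_U=e_Nd_M$, $c_Le_U=e_Nc_M$. Put $Q_{M\otimes N}=Q/([K_{d_L},K_{c_L}]^{\mathcal Q}_Q\vee[K_{d_U},K_{c_U}]^{\mathcal Q}_Q)$ with induced morphisms $\overline{d_U},\overline{c_U},\overline{e_U},\overline{d_L},\overline{c_L},\overline{e_L}$; it is the upper left corner of an internal double groupoid over the two given groupoids. $\gamma\colon M\otimes N\to Q_{M\otimes N}$ is the kernel of $\langle\overline{d_U},\overline{d_L}\rangle$; $\pi^{M\otimes N}_M\colon M\otimes N\to M$, $\pi^{M\otimes N}_N\colon M\otimes N\to N$ are the restrictions of $\overline{c_U}$, $\overline{c_L}$ (i.e. their composites with the kernels $M\to M\rtimes L$, $N\to N\rtimes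 L$ are $\overline{c_U}\gamma$, $\overline{c_L}\gamma$). $M\otimes N$ is an $L$-crossed module via $\mu\pi_M^{M\otimes N}=\nu\pi_N^{M\otimes N}$ and the action $\xi^L_{M\otimes N}$ determined by $\gamma\xi^L_{M\otimes N}=\chi_{Q_{M\otimes N}}(e\flat\gamma)$ with $e=\overline{e_U}e_M=\overline{e_L}e_N$. The tensor product is functorial in $L$-crossed module morphisms: $f\otimes g$ is induced by the morphism on the $Q$'s. Weak crossed square. A commutative square as in the claim, with $\lambda=\mu p_M=\nu p_N$, actions $\xi^L_M,\xi^L_N,\xi^L_P$ and a morphism $h\colon M\otimes N\to P$ such that: (W.1) $p_M\xi^L_P=\xi^L_M(1_L\flat p_M)$, $p_N\xi^L_P=\xi^L_N(1_L\flat p_N)$, and $(\mu,\xi^L_M)$, $(\nu,\xi^L_N)$, $(\lambda,\xi^L_P)$ are $L$-crossed modules; (W.2) $p_Mh=\pi_M^{M\otimes N}$ and $p_Nh=\pi_N^{M\otimes N}$; (W.3) $h(p_M\otimes 1_N)=\pi_P^{P\otimes N}$ and $h(1_M\otimes p_N)=\pi_P^{M\otimes P}$ (tensor products of $L$-crossed modules); (W.4) $h\,\xi^L_{M\otimes N}=\xi^L_P(1_L\flat h)$. Internal crossed squares. These are by definition the objects of $\mathbf{XMod}(\mathbf{XMod}(\mathbb{A}))\simeq\mathbf{Grpd}(\mathbf{Grpd}(\mathbb{A}))$ (double groupoids). A double groupoid has objects $A,B,C,D$ and groupoids $A\rightrightarrows B$ $(d_U,c_U,e_U)$, $A\rightrightarrows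 C$ $(d_L,c_L,e_L)$, $B\rightrightarrows D$ $(d_R,c_R,e_R)$, $C\rightrightarrows D$ $(d_D,c_D,e_D)$, compatible with each other. Its normalisation has $L=D$, $M=K_{d_R}$, $N=K_{d_D}$, $P=K_{d_U}\wedge K_{d_L}$ with inclusion $j\colon P\to A$, $\mu=c_Rk_{d_R}$, $\nu=c_Dk_{d_D}$, $k_{d_R}p_M=c_Uj$, $k_{d_D}p_N=c_Lj$; $L$ acts on $M$, $N$ through the groupoids on the right and at the bottom, and on $P$ through the unique $\xi$ with $j\xi=\chi_A(e_Le_D\flat j)$. The map $h\colon M\otimes N\to P$ is the unique morphism such that $h$, $1_M$, $1_N$, $1_L$ form the morphism of normalisations induced by a morphism of double groupoids (the tensor product crossed square being initial over the fixed $\mu$, $\nu$). These data form the weak crossed square induced by the double groupoid. *)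

theory Defs
  imports Main
begin

text \<open>
  Objects and arrows of a category are elements of two carrier sets. Composition is a total
  function on the type of arrows, but it is meaningful only for composable arrows;
  \<open>g \<cdot> f\<close> means ``first \<open>f\<close>, then \<open>g\<close>''.

  Universal constructions are first described by predicates (\<open>is_...\<close>). A representative is then
  chosen by \<open>SOME\<close>; morphisms determined by a universal property are picked out by \<open>THE\<close>.
  A subobject is represented by a monomorphism, its domain being implicit.
\<close>

record ('o, 'a) cat =
  Obj :: "'o set"
  Arr :: "'a set"
  Dom :: "'a \<Rightarrow> 'o"
  Cod :: "'a \<Rightarrow> 'o"
  Ident :: "'o \<Rightarrow> 'a"
  Comp :: "'a \<Rightarrow> 'a \<Rightarrow> 'a" (infixr "\<cdot>\<index>" 70)

text \<open>A crossed module \<open>(\<partial> : X \<rightarrow> L, \<xi>)\<close> is given by the pair \<open>(\<partial>, \<xi>)\<close>.\<close>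

type_synonym 'a xmod = "'a \<times> 'a"

abbreviation bdry :: "'a xmod \<Rightarrow> 'a" where "bdry \<equiv> fst"
abbreviation act :: "'a xmod \<Rightarrow> 'a" where "act \<equiv> snd"

text \<open>Internal groupoids: domain, codomain, unit and multiplication.\<close>

record 'a grpd =
  gd :: 'a
  gc :: 'a
  ge :: 'a
  gm :: 'a

text \<open>
  The four groupoids of a double groupoid with objects \<open>A, B, C, D\<close>:
  up \<open>A \<rightrightarrows> B\<close>, left \<open>A \<rightrightarrows> C\<close>, right \<open>B \<rightrightarrows> D\<close>, down \<open>C \<rightrightarrows> D\<close>.
\<close>

record 'a dgrpd =
  gU :: "'a grpd"
  gL :: "'a grpd"
  gR :: "'a grpd"
  gD :: "'a grpd"

context
  fixes C :: "('o, 'a) cat" (structure)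
begin

section \<open>Categories and universal constructions\<close>

definition hom :: "'o \<Rightarrow> 'o \<Rightarrow> 'a set" where
  "hom A B = {f \<in> Arr C. Dom C f = A \<and> Cod C f = B}"

definition category :: bool where
  "category \<longleftrightarrow>
     (\<forall>f\<in>Arr C. Dom C f \<in> Obj C \<and> Cod C f \<in> Obj C) \<and>
     (\<forall>A\<in>Obj C. Ident C A \<in> hom A A) \<and>
     (\<forall>f\<in>Arr C. \<forall>g\<in>Arr C. Cod C f = Dom C g \<longrightarrow> g \<cdot> f \<in> hom (Dom C f) (Cod C g)) \<and>
     (\<forall>f\<in>Arr C. f \<cdot> Ident C (Dom C f) = f \<and> Ident C (Cod C f) \<cdot> f = f) \<and>
     (\<forall>f\<in>Arr C. \<forall>g\<in>Arr C. \<forall>h\<in>Arr C. Cod C f = Dom C g \<and> Cod C g = Dom C h \<longrightarrow>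
        h \<cdot> (g \<cdot> f) = (h \<cdot> g) \<cdot> f)"

definition monic :: "'a \<Rightarrow> bool" where
  "monic m \<longleftrightarrow> m \<in> Arr C \<and>
     (\<forall>u\<in>Arr C. \<forall>v\<in>Arr C. Dom C u = Dom C v \<and> Cod C u = Dom C m \<and> Cod C v = Dom C m \<and>
        m \<cdot> u = m \<cdot> v \<longrightarrow> u = v)"

definition iso :: "'a \<Rightarrow> bool" where
  "iso f \<longleftrightarrow> f \<in> Arr C \<and>
     (\<exists>g\<in>hom (Cod C f) (Dom C f). g \<cdot> f = Ident C (Dom C f) \<and> f \<cdot> g = Ident C (Cod C f))"

definition is_terminal :: "'o \<Rightarrow> bool" where
  "is_terminal Z \<longleftrightarrow> Z \<in> Obj C \<and> (\<forall>A\<in>Obj C. \<exists>!f. f \<in> hom A Z)"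

definition is_initial :: "'o \<Rightarrow> bool" where
  "is_initial Z \<longleftrightarrow> Z \<in> Obj C \<and> (\<forall>A\<in>Obj C. \<exists>!f. f \<in> hom Z A)"

definition is_zero :: "'o \<Rightarrow> bool" where
  "is_zero Z \<longleftrightarrow> is_initial Z \<and> is_terminal Z"

definition zero :: "'o \<Rightarrow> 'o \<Rightarrow> 'a" where
  "zero A B = (THE f. \<exists>Z g k. is_zero Z \<and> g \<in> hom A Z \<and> k \<in> hom Z B \<and> f = k \<cdot> g)"

definition is_pullback :: "'a \<Rightarrow> 'a \<Rightarrow> 'a \<Rightarrow> 'a \<Rightarrow> bool" where
  "is_pullback f g p q \<longleftrightarrow>
     f \<in> Arr C \<and> g \<in> Arr C \<and> Cod C f = Cod C g \<and>
     p \<in> hom (Dom C p) (Dom C f) \<and> q \<in> hom (Dom C p) (Dom C g) \<and> f \<cdot> p = g \<cdot> q \<and>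
     (\<forall>T u v. u \<in> hom T (Dom C f) \<and> v \<in> hom T (Dom C g) \<and> f \<cdot> u = g \<cdot> v \<longrightarrow>
        (\<exists>!w. w \<in> hom T (Dom C p) \<and> p \<cdot> w = u \<and> q \<cdot> w = v))"

definition is_pushout :: "'a \<Rightarrow> 'a \<Rightarrow> 'a \<Rightarrow> 'a \<Rightarrow> bool" where
  "is_pushout f g i j \<longleftrightarrow>
     f \<in> Arr C \<and> g \<in> Arr C \<and> Dom C f = Dom C g \<and>
     i \<in> hom (Cod C f) (Cod C i) \<and> j \<in> hom (Cod C g) (Cod C i) \<and> i \<cdot> f = j \<cdot> g \<and>
     (\<forall>T u v. u \<in> hom (Cod C f) T \<and> v \<in> hom (Cod C g) T \<and> u \<cdot> f = v \<cdot> g \<longrightarrow>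
        (\<exists>!w. w \<in> hom (Cod C i) T \<and> w \<cdot> i = u \<and> w \<cdot> j = v))"

definition is_product :: "'o \<Rightarrow> 'o \<Rightarrow> 'a \<Rightarrow> 'a \<Rightarrow> bool" where
  "is_product A B p q \<longleftrightarrow>
     p \<in> hom (Dom C p) A \<and> q \<in> hom (Dom C p) B \<and>
     (\<forall>T u v. u \<in> hom T A \<and> v \<in> hom T B \<longrightarrow>
        (\<exists>!w. w \<in> hom T (Dom C p) \<and> p \<cdot> w = u \<and> q \<cdot> w = v))"

definition is_coproduct :: "'o \<Rightarrow> 'o \<Rightarrow> 'a \<Rightarrow> 'a \<Rightarrow> bool" where
  "is_coproduct A B i j \<longleftrightarrow>
     i \<in> hom A (Cod C i) \<and> j \<in> hom B (Cod C i) \<and>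
     (\<forall>T u v. u \<in> hom A T \<and> v \<in> hom B T \<longrightarrow>
        (\<exists>!w. w \<in> hom (Cod C i) T \<and> w \<cdot> i = u \<and> w \<cdot> j = v))"

definition is_coequaliser :: "'a \<Rightarrow> 'a \<Rightarrow> 'a \<Rightarrow> bool" where
  "is_coequaliser f g q \<longleftrightarrow>
     f \<in> Arr C \<and> g \<in> hom (Dom C f) (Cod C f) \<and> q \<in> hom (Cod C f) (Cod C q) \<and> q \<cdot> f = q \<cdot> g \<and>
     (\<forall>T u. u \<in> hom (Cod C f) T \<and> u \<cdot> f = u \<cdot> g \<longrightarrow> (\<exists>!w. w \<in> hom (Cod C q) T \<and> w \<cdot> q = u))"

definition is_kernel :: "'a \<Rightarrow> 'a \<Rightarrow> bool" where
  "is_kernel f k \<longleftrightarrow>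
     f \<in> Arr C \<and> k \<in> hom (Dom C k) (Dom C f) \<and> f \<cdot> k = zero (Dom C k) (Cod C f) \<and>
     (\<forall>T u. u \<in> hom T (Dom C f) \<and> f \<cdot> u = zero T (Cod C f) \<longrightarrow>
        (\<exists>!w. w \<in> hom T (Dom C k) \<and> k \<cdot> w = u))"

definition is_cokernel :: "'a \<Rightarrow> 'a \<Rightarrow> bool" where
  "is_cokernel f q \<longleftrightarrow>
     f \<in> Arr C \<and> q \<in> hom (Cod C f) (Cod C q) \<and> q \<cdot> f = zero (Dom C f) (Cod C q) \<and>
     (\<forall>T u. u \<in> hom (Cod C f) T \<and> u \<cdot> f = zero (Dom C f) T \<longrightarrow>
        (\<exists>!w. w \<in> hom (Cod C q) T \<and> w \<cdot> q = u))"

definition regular_epi :: "'a \<Rightarrow> bool" where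
  "regular_epi q \<longleftrightarrow> (\<exists>f g. is_coequaliser f g q)"

definition normal_mono :: "'a \<Rightarrow> bool" where
  "normal_mono k \<longleftrightarrow> (\<exists>f. is_kernel f k)"

section \<open>Semi-abelian categories\<close>

definition pointed :: bool where
  "pointed \<longleftrightarrow> (\<exists>Z. is_zero Z)"

definition finitely_complete :: bool where
  "finitely_complete \<longleftrightarrow>
     (\<exists>Z. is_terminal Z) \<and>
     (\<forall>f\<in>Arr C. \<forall>g\<in>Arr C. Cod C f = Cod C g \<longrightarrow> (\<exists>p q. is_pullback f g p q))"

definition regular_category :: bool where
  "regular_category \<longleftrightarrow>
     finitely_complete \<and>
     (\<forall>f p q. is_pullback f f p q \<longrightarrow> (\<exists>c. is_coequaliser p q c)) \<and>
     (\<forall>f g p q. is_pullback f g p q \<and> regular_epi f \<longrightarrow> regular_epi q)"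

definition equivalence_relation :: "'o \<Rightarrow> 'a \<Rightarrow> 'a \<Rightarrow> bool" where
  "equivalence_relation X r1 r2 \<longleftrightarrow>
     r1 \<in> hom (Dom C r1) X \<and> r2 \<in> hom (Dom C r1) X \<and>
     (\<forall>T u v. u \<in> hom T (Dom C r1) \<and> v \<in> hom T (Dom C r1) \<and> r1 \<cdot> u = r1 \<cdot> v \<and> r2 \<cdot> u = r2 \<cdot> v
        \<longrightarrow> u = v) \<and>
     (\<exists>\<delta>\<in>hom X (Dom C r1). r1 \<cdot> \<delta> = Ident C X \<and> r2 \<cdot> \<delta> = Ident C X) \<and>
     (\<exists>s\<in>hom (Dom C r1) (Dom C r1). r1 \<cdot> s = r2 \<and> r2 \<cdot> s = r1) \<and>
     (\<exists>p q t. is_pullback r2 r1 p q \<and> t \<in> hom (Dom C p) (Dom C r1) \<and>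
        r1 \<cdot> t = r1 \<cdot> p \<and> r2 \<cdot> t = r2 \<cdot> q)"

definition barr_exact :: bool where
  "barr_exact \<longleftrightarrow>
     regular_category \<and>
     (\<forall>X r1 r2. equivalence_relation X r1 r2 \<longrightarrow> (\<exists>f. is_pullback f f r1 r2))"

text \<open>\<open>(p, s)\<close> is a point over \<open>B\<close>, i.e. a split epimorphism with a chosen splitting.\<close>

definition is_point :: "'a \<Rightarrow> 'a \<Rightarrow> bool" where
  "is_point p s \<longleftrightarrow>
     p \<in> Arr C \<and> s \<in> hom (Cod C p) (Dom C p) \<and> p \<cdot> s = Ident C (Cod C p)"

text \<open>
  For every \<open>e : E \<rightarrow> B\<close>, pulling back points along \<open>e\<close> reflects isomorphisms. Here \<open>g\<close> is a
  morphism of points over \<open>B\<close>, and \<open>w\<close> is its image under pulling back along \<open>e\<close>.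
\<close>

definition bourn_protomodular :: bool where
  "bourn_protomodular \<longleftrightarrow>
     (\<forall>p s p' s' g e q u q' u' w.
        is_point p s \<and> is_point p' s' \<and> Cod C p = Cod C p' \<and>
        g \<in> hom (Dom C p) (Dom C p') \<and> p' \<cdot> g = p \<and> g \<cdot> s = s' \<and>
        is_pullback e p q u \<and> is_pullback e p' q' u' \<and>
        w \<in> hom (Dom C q) (Dom C q') \<and> q' \<cdot> w = q \<and> u' \<cdot> w = g \<cdot> u \<and> iso w
        \<longrightarrow> iso g)"

definition has_binary_coproducts :: bool where
  "has_binary_coproducts \<longleftrightarrow> (\<forall>A\<in>Obj C. \<forall>B\<in>Obj C. \<exists>i j. is_coproduct A B i j)"

definition semi_abelian :: bool where
  "semi_abelian \<longleftrightarrow>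
     category \<and> pointed \<and> barr_exact \<and> bourn_protomodular \<and> has_binary_coproducts"

section \<open>Chosen universal constructions\<close>

definition ker :: "'a \<Rightarrow> 'a" where
  "ker f = (SOME k. is_kernel f k)"

definition coker :: "'a \<Rightarrow> 'a" where
  "coker f = (SOME q. is_cokernel f q)"

definition inl :: "'o \<Rightarrow> 'o \<Rightarrow> 'a" where
  "inl A B = fst (SOME (i, j). is_coproduct A B i j)"

definition inr :: "'o \<Rightarrow> 'o \<Rightarrow> 'a" where
  "inr A B = snd (SOME (i, j). is_coproduct A B i j)"

definition coprod :: "'o \<Rightarrow> 'o \<Rightarrow> 'o" where
  "coprod A B = Cod C (inl A B)"

definition copair :: "'a \<Rightarrow> 'a \<Rightarrow> 'a" where
  "copair f g = (THE w. w \<in> hom (coprod (Dom C f) (Dom C g)) (Cod C f) \<and>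
     w \<cdot> inl (Dom C f) (Dom C g) = f \<and> w \<cdot> inr (Dom C f) (Dom C g) = g)"

definition cosum :: "'a \<Rightarrow> 'a \<Rightarrow> 'a" where
  "cosum f g = copair (inl (Cod C f) (Cod C g) \<cdot> f) (inr (Cod C f) (Cod C g) \<cdot> g)"

definition proj1 :: "'o \<Rightarrow> 'o \<Rightarrow> 'a" where
  "proj1 A B = fst (SOME (p, q). is_product A B p q)"

definition proj2 :: "'o \<Rightarrow> 'o \<Rightarrow> 'a" where
  "proj2 A B = snd (SOME (p, q). is_product A B p q)"

definition pair :: "'a \<Rightarrow> 'a \<Rightarrow> 'a" where
  "pair f g = (THE w. w \<in> hom (Dom C f) (Dom C (proj1 (Cod C f) (Cod C g))) \<and>
     proj1 (Cod C f) (Cod C g) \<cdot> w = f \<and> proj2 (Cod C f) (Cod C g) \<cdot> w = g)"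

definition pb1 :: "'a \<Rightarrow> 'a \<Rightarrow> 'a" where
  "pb1 f g = fst (SOME (p, q). is_pullback f g p q)"

definition pb2 :: "'a \<Rightarrow> 'a \<Rightarrow> 'a" where
  "pb2 f g = snd (SOME (p, q). is_pullback f g p q)"

definition pb_pair :: "'a \<Rightarrow> 'a \<Rightarrow> 'a \<Rightarrow> 'a \<Rightarrow> 'a" where
  "pb_pair f g u v = (THE w. w \<in> hom (Dom C u) (Dom C (pb1 f g)) \<and>
     pb1 f g \<cdot> w = u \<and> pb2 f g \<cdot> w = v)"

definition po1 :: "'a \<Rightarrow> 'a \<Rightarrow> 'a" where
  "po1 f g = fst (SOME (i, j). is_pushout f g i j)"

definition po2 :: "'a \<Rightarrow> 'a \<Rightarrow> 'a" where
  "po2 f g = snd (SOME (i, j). is_pushout f g i j)"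

definition po_copair :: "'a \<Rightarrow> 'a \<Rightarrow> 'a \<Rightarrow> 'a \<Rightarrow> 'a" where
  "po_copair f g u v = (THE w. w \<in> hom (Cod C (po1 f g)) (Cod C u) \<and>
     w \<cdot> po1 f g = u \<and> w \<cdot> po2 f g = v)"

section \<open>Subobjects and commutators\<close>

definition sub_le :: "'a \<Rightarrow> 'a \<Rightarrow> bool" where
  "sub_le m n \<longleftrightarrow> (\<exists>w\<in>hom (Dom C m) (Dom C n). n \<cdot> w = m)"

definition is_meet :: "'a \<Rightarrow> 'a \<Rightarrow> 'a \<Rightarrow> bool" where
  "is_meet m n j \<longleftrightarrow> monic j \<and> Cod C j = Cod C m \<and> sub_le j m \<and> sub_le j n \<and>
     (\<forall>k. monic k \<and> Cod C k = Cod C m \<and> sub_le k m \<and> sub_le k n \<longrightarrow> sub_le k j)"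

definition is_join :: "'a \<Rightarrow> 'a \<Rightarrow> 'a \<Rightarrow> bool" where
  "is_join m n j \<longleftrightarrow> monic j \<and> Cod C j = Cod C m \<and> sub_le m j \<and> sub_le n j \<and>
     (\<forall>k. monic k \<and> Cod C k = Cod C m \<and> sub_le m k \<and> sub_le n k \<longrightarrow> sub_le j k)"

definition join :: "'a \<Rightarrow> 'a \<Rightarrow> 'a" where
  "join m n = (SOME j. is_join m n j)"

text \<open>Images are taken with respect to the (regular epi, mono) factorisation.\<close>

definition is_image :: "'a \<Rightarrow> 'a \<Rightarrow> bool" where
  "is_image f m \<longleftrightarrow>
     monic m \<and> (\<exists>e. regular_epi e \<and> e \<in> hom (Dom C f) (Dom C m) \<and> m \<cdot> e = f)"

definition image_of :: "'a \<Rightarrow> 'a" where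
  "image_of f = (SOME m. is_image f m)"

definition is_normal_closure :: "'a \<Rightarrow> 'a \<Rightarrow> bool" where
  "is_normal_closure m n \<longleftrightarrow> normal_mono n \<and> Cod C n = Cod C m \<and> sub_le m n \<and>
     (\<forall>k. normal_mono k \<and> Cod C k = Cod C m \<and> sub_le m k \<longrightarrow> sub_le n k)"

definition normal_closure :: "'a \<Rightarrow> 'a" where
  "normal_closure m = (SOME n. is_normal_closure m n)"

text \<open>The canonical morphism from \<open>A + B\<close> to the product of \<open>A\<close> and \<open>B\<close>.\<close>

definition sum_to_prod :: "'o \<Rightarrow> 'o \<Rightarrow> 'a" where
  "sum_to_prod A B = pair (copair (Ident C A) (zero B A)) (copair (zero A B) (Ident C B))"

definition higgins :: "'a \<Rightarrow> 'a \<Rightarrow> 'a" where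
  "higgins a b = image_of (copair a b \<cdot> ker (sum_to_prod (Dom C a) (Dom C b)))"

definition huq :: "'a \<Rightarrow> 'a \<Rightarrow> 'a" where
  "huq a b = normal_closure (higgins a b)"

definition huq_vanishes :: "'a \<Rightarrow> 'a \<Rightarrow> bool" where
  "huq_vanishes a b \<longleftrightarrow> is_zero (Dom C (huq a b))"

text \<open>The normal subobject associated with an equivalence relation, i.e. the class of zero.\<close>

definition normalisation :: "'a \<Rightarrow> 'a \<Rightarrow> 'a" where
  "normalisation r1 r2 = r2 \<cdot> ker r1"

text \<open>
  Cocones for the Smith-Pedicchio commutator of \<open>(r1, r2)\<close> and \<open>(s1, s2)\<close> on \<open>X\<close>. In terms of
  elements, the pullback consists of the triples \<open>(x, y, z)\<close> with \<open>(x, y)\<close> in the first and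
  \<open>(y, z)\<close> in the second relation, \<open>lR (x, y) = (x, y, y)\<close> and \<open>lS (y, z) = (y, y, z)\<close>. Thus
  \<open>\<phi>\<close> satisfies \<open>\<phi> (x, y, y) = t x\<close> and \<open>\<phi> (y, y, z) = t z\<close>.
\<close>

definition smith_cocone :: "'a \<Rightarrow> 'a \<Rightarrow> 'a \<Rightarrow> 'a \<Rightarrow> 'o \<Rightarrow> 'a \<Rightarrow> 'a \<Rightarrow> bool" where
  "smith_cocone r1 r2 s1 s2 T t \<phi> \<longleftrightarrow>
     t \<in> hom (Cod C r1) T \<and> \<phi> \<in> hom (Dom C (pb1 r2 s1)) T \<and>
     (\<forall>\<delta>R \<delta>S.
        \<delta>R \<in> hom (Cod C r1) (Dom C r1) \<and>
        r1 \<cdot> \<delta>R = Ident C (Cod C r1) \<and> r2 \<cdot> \<delta>R = Ident C (Cod C r1) \<and>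
        \<delta>S \<in> hom (Cod C r1) (Dom C s1) \<and>
        s1 \<cdot> \<delta>S = Ident C (Cod C r1) \<and> s2 \<cdot> \<delta>S = Ident C (Cod C r1) \<longrightarrow>
        \<phi> \<cdot> pb_pair r2 s1 (Ident C (Dom C r1)) (\<delta>S \<cdot> r2) = t \<cdot> r1 \<and>
        \<phi> \<cdot> pb_pair r2 s1 (\<delta>R \<cdot> s1) (Ident C (Dom C s1)) = t \<cdot> s2)"

definition is_smith_quotient :: "'a \<Rightarrow> 'a \<Rightarrow> 'a \<Rightarrow> 'a \<Rightarrow> 'a \<Rightarrow> bool" where
  "is_smith_quotient r1 r2 s1 s2 t \<longleftrightarrow>
     (\<exists>\<phi>. smith_cocone r1 r2 s1 s2 (Cod C t) t \<phi> \<and>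
        (\<forall>T' t' \<phi>'. smith_cocone r1 r2 s1 s2 T' t' \<phi>' \<longrightarrow>
           (\<exists>!w. w \<in> hom (Cod C t) T' \<and> w \<cdot> t = t' \<and> w \<cdot> \<phi> = \<phi>')))"

definition smith_quotient :: "'a \<Rightarrow> 'a \<Rightarrow> 'a \<Rightarrow> 'a \<Rightarrow> 'a" where
  "smith_quotient r1 r2 s1 s2 = (SOME t. is_smith_quotient r1 r2 s1 s2 t)"

text \<open>The Smith-Pedicchio commutator is the kernel pair of the quotient \<open>t\<close>.\<close>

definition smith_commutator :: "'a \<Rightarrow> 'a \<Rightarrow> 'a \<Rightarrow> 'a \<Rightarrow> 'a \<times> 'a" where
  "smith_commutator r1 r2 s1 s2 =
     (let t = smith_quotient r1 r2 s1 s2 in (pb1 t t, pb2 t t))"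

text \<open>It vanishes when it is the discrete relation, up to isomorphism of relations.\<close>

definition smith_vanishes :: "'a \<Rightarrow> 'a \<Rightarrow> 'a \<Rightarrow> 'a \<Rightarrow> bool" where
  "smith_vanishes r1 r2 s1 s2 \<longleftrightarrow>
     (case smith_commutator r1 r2 s1 s2 of (p, q) \<Rightarrow> iso p \<and> p = q)"

definition smith_is_huq :: bool where
  "smith_is_huq \<longleftrightarrow>
     (\<forall>X r1 r2 s1 s2. equivalence_relation X r1 r2 \<and> equivalence_relation X s1 s2 \<longrightarrow>
        (smith_vanishes r1 r2 s1 s2 \<longleftrightarrow>
         huq_vanishes (normalisation r1 r2) (normalisation s1 s2)))"

section \<open>Internal actions and crossed modules\<close>

definition kflat :: "'o \<Rightarrow> 'o \<Rightarrow> 'a" where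
  "kflat A X = ker (copair (Ident C A) (zero X A))"

definition flat :: "'o \<Rightarrow> 'o \<Rightarrow> 'o" where
  "flat A X = Dom C (kflat A X)"

definition flat_map :: "'a \<Rightarrow> 'a \<Rightarrow> 'a" where
  "flat_map f g = (THE w. w \<in> hom (flat (Dom C f) (Dom C g)) (flat (Cod C f) (Cod C g)) \<and>
     kflat (Cod C f) (Cod C g) \<cdot> w = cosum f g \<cdot> kflat (Dom C f) (Dom C g))"

definition flat_unit :: "'o \<Rightarrow> 'o \<Rightarrow> 'a" where
  "flat_unit A X = (THE w. w \<in> hom X (flat A X) \<and> kflat A X \<cdot> w = inr A X)"

definition flat_mult :: "'o \<Rightarrow> 'o \<Rightarrow> 'a" where
  "flat_mult A X = (THE w. w \<in> hom (flat A (flat A X)) (flat A X) \<and>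
     kflat A X \<cdot> w = copair (inl A X) (kflat A X) \<cdot> kflat A (flat A X))"

definition is_action :: "'o \<Rightarrow> 'o \<Rightarrow> 'a \<Rightarrow> bool" where
  "is_action A X \<xi> \<longleftrightarrow>
     \<xi> \<in> hom (flat A X) X \<and>
     \<xi> \<cdot> flat_unit A X = Ident C X \<and>
     \<xi> \<cdot> flat_mult A X = \<xi> \<cdot> flat_map (Ident C A) \<xi>"

definition conjugation :: "'o \<Rightarrow> 'a" where
  "conjugation A = copair (Ident C A) (Ident C A) \<cdot> kflat A A"

definition crossed_module :: "'o \<Rightarrow> 'o \<Rightarrow> 'a xmod \<Rightarrow> bool" where
  "crossed_module X A x \<longleftrightarrow>
     bdry x \<in> hom X A \<and> is_action A X (act x) \<and>
     bdry x \<cdot> act x = conjugation A \<cdot> flat_map (Ident C A) (bdry x) \<and>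
     act x \<cdot> flat_map (bdry x) (Ident C X) = conjugation X"

text \<open>
  For \<open>x = (\<partial> : X \<rightarrow> A, \<xi>)\<close>, the morphisms \<open>sd_quot\<close>, \<open>sd_d\<close>, \<open>sd_c\<close>, \<open>sd_e\<close> and \<open>sd_k\<close> are, respectively,
  the quotient defining the semidirect product, the domain, codomain and unit of the associated
  groupoid, and the kernel of the domain.
\<close>

definition sd_quot :: "'a xmod \<Rightarrow> 'a" where
  "sd_quot x = (let X = Dom C (bdry x); A = Cod C (bdry x) in
     SOME q. is_coequaliser (inr A X \<cdot> act x) (kflat A X) q)"

definition sd_d :: "'a xmod \<Rightarrow> 'a" where
  "sd_d x = (let X = Dom C (bdry x); A = Cod C (bdry x) in
     THE w. w \<in> hom (Cod C (sd_quot x)) A \<and> w \<cdot> sd_quot x = copair (Ident C A) (zero X A))"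

definition sd_c :: "'a xmod \<Rightarrow> 'a" where
  "sd_c x = (let A = Cod C (bdry x) in
     THE w. w \<in> hom (Cod C (sd_quot x)) A \<and> w \<cdot> sd_quot x = copair (Ident C A) (bdry x))"

definition sd_e :: "'a xmod \<Rightarrow> 'a" where
  "sd_e x = sd_quot x \<cdot> inl (Cod C (bdry x)) (Dom C (bdry x))"

definition sd_k :: "'a xmod \<Rightarrow> 'a" where
  "sd_k x = sd_quot x \<cdot> inr (Cod C (bdry x)) (Dom C (bdry x))"

section \<open>The tensor product\<close>

text \<open>
  Below \<open>x = (\<mu> : M \<rightarrow> L, \<xi>\<^sub>M)\<close> and \<open>y = (\<nu> : N \<rightarrow> L, \<xi>\<^sub>N)\<close>. The prefix \<open>q_\<close> marks the structure on the
  pushout \<open>Q\<close>, and \<open>t_\<close> the induced structure on its quotient \<open>Q\<^bsub>M\<otimes>N\<^esub>\<close>.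
\<close>

definition q_eU :: "'a xmod \<Rightarrow> 'a xmod \<Rightarrow> 'a" where
  "q_eU x y = po1 (sd_e x) (sd_e y)"

definition q_eL :: "'a xmod \<Rightarrow> 'a xmod \<Rightarrow> 'a" where
  "q_eL x y = po2 (sd_e x) (sd_e y)"

definition q_dU :: "'a xmod \<Rightarrow> 'a xmod \<Rightarrow> 'a" where
  "q_dU x y = po_copair (sd_e x) (sd_e y) (Ident C (Cod C (sd_e x))) (sd_e x \<cdot> sd_d y)"

definition q_cU :: "'a xmod \<Rightarrow> 'a xmod \<Rightarrow> 'a" where
  "q_cU x y = po_copair (sd_e x) (sd_e y) (Ident C (Cod C (sd_e x))) (sd_e x \<cdot> sd_c y)"

definition q_dL :: "'a xmod \<Rightarrow> 'a xmod \<Rightarrow> 'a" where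
  "q_dL x y = po_copair (sd_e x) (sd_e y) (sd_e y \<cdot> sd_d x) (Ident C (Cod C (sd_e y)))"

definition q_cL :: "'a xmod \<Rightarrow> 'a xmod \<Rightarrow> 'a" where
  "q_cL x y = po_copair (sd_e x) (sd_e y) (sd_e y \<cdot> sd_c x) (Ident C (Cod C (sd_e y)))"

definition t_quot :: "'a xmod \<Rightarrow> 'a xmod \<Rightarrow> 'a" where
  "t_quot x y = coker (join (huq (ker (q_dL x y)) (ker (q_cL x y)))
                            (huq (ker (q_dU x y)) (ker (q_cU x y))))"

definition t_Q :: "'a xmod \<Rightarrow> 'a xmod \<Rightarrow> 'o" where
  "t_Q x y = Cod C (t_quot x y)"

definition t_desc :: "'a xmod \<Rightarrow> 'a xmod \<Rightarrow> 'a \<Rightarrow> 'a" where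
  "t_desc x y f = (THE w. w \<in> hom (t_Q x y) (Cod C f) \<and> w \<cdot> t_quot x y = f)"

definition t_dU :: "'a xmod \<Rightarrow> 'a xmod \<Rightarrow> 'a" where "t_dU x y = t_desc x y (q_dU x y)"
definition t_cU :: "'a xmod \<Rightarrow> 'a xmod \<Rightarrow> 'a" where "t_cU x y = t_desc x y (q_cU x y)"
definition t_eU :: "'a xmod \<Rightarrow> 'a xmod \<Rightarrow> 'a" where "t_eU x y = t_quot x y \<cdot> q_eU x y"
definition t_dL :: "'a xmod \<Rightarrow> 'a xmod \<Rightarrow> 'a" where "t_dL x y = t_desc x y (q_dL x y)"
definition t_cL :: "'a xmod \<Rightarrow> 'a xmod \<Rightarrow> 'a" where "t_cL x y = t_desc x y (q_cL x y)"
definition t_eL :: "'a xmod \<Rightarrow> 'a xmod \<Rightarrow> 'a" where "t_eL x y = t_quot x y \<cdot> q_eL x y"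

definition t_gamma :: "'a xmod \<Rightarrow> 'a xmod \<Rightarrow> 'a" where
  "t_gamma x y = ker (pair (t_dU x y) (t_dL x y))"

definition tensor :: "'a xmod \<Rightarrow> 'a xmod \<Rightarrow> 'o" where
  "tensor x y = Dom C (t_gamma x y)"

definition tensor_pi1 :: "'a xmod \<Rightarrow> 'a xmod \<Rightarrow> 'a" where
  "tensor_pi1 x y = (THE w. w \<in> hom (tensor x y) (Dom C (bdry x)) \<and>
     sd_k x \<cdot> w = t_cU x y \<cdot> t_gamma x y)"

definition tensor_pi2 :: "'a xmod \<Rightarrow> 'a xmod \<Rightarrow> 'a" where
  "tensor_pi2 x y = (THE w. w \<in> hom (tensor x y) (Dom C (bdry y)) \<and>
     sd_k y \<cdot> w = t_cL x y \<cdot> t_gamma x y)"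

definition tensor_act :: "'a xmod \<Rightarrow> 'a xmod \<Rightarrow> 'a" where
  "tensor_act x y = (THE w. w \<in> hom (flat (Cod C (bdry x)) (tensor x y)) (tensor x y) \<and>
     t_gamma x y \<cdot> w = conjugation (t_Q x y) \<cdot> flat_map (t_eU x y \<cdot> sd_e x) (t_gamma x y))"

text \<open>
  Functoriality, for morphisms \<open>f : x \<rightarrow> x'\<close> and \<open>g : y \<rightarrow> y'\<close> of crossed modules over the same
  base: successively on semidirect products, on \<open>Q\<close>, on \<open>Q\<^bsub>M\<otimes>N\<^esub>\<close> and on the tensor product.
\<close>

definition sd_map :: "'a xmod \<Rightarrow> 'a xmod \<Rightarrow> 'a \<Rightarrow> 'a" where
  "sd_map x x' f = (THE w. w \<in> hom (Cod C (sd_quot x)) (Cod C (sd_quot x')) \<and>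
     w \<cdot> sd_quot x = sd_quot x' \<cdot> cosum (Ident C (Cod C (bdry x))) f)"

definition q_map :: "'a xmod \<Rightarrow> 'a xmod \<Rightarrow> 'a xmod \<Rightarrow> 'a xmod \<Rightarrow> 'a \<Rightarrow> 'a \<Rightarrow> 'a" where
  "q_map x x' y y' f g = po_copair (sd_e x) (sd_e y)
     (q_eU x' y' \<cdot> sd_map x x' f) (q_eL x' y' \<cdot> sd_map y y' g)"

definition t_map :: "'a xmod \<Rightarrow> 'a xmod \<Rightarrow> 'a xmod \<Rightarrow> 'a xmod \<Rightarrow> 'a \<Rightarrow> 'a \<Rightarrow> 'a" where
  "t_map x x' y y' f g = t_desc x y (t_quot x' y' \<cdot> q_map x x' y y' f g)"

definition tensor_map :: "'a xmod \<Rightarrow> 'a xmod \<Rightarrow> 'a xmod \<Rightarrow> 'a xmod \<Rightarrow> 'a \<Rightarrow> 'a \<Rightarrow> 'a" where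
  "tensor_map x x' y y' f g = (THE w. w \<in> hom (tensor x y) (tensor x' y') \<and>
     t_gamma x' y' \<cdot> w = t_map x x' y y' f g \<cdot> t_gamma x y)"

section \<open>Weak crossed squares\<close>

definition weak_crossed_square ::
  "'o \<Rightarrow> 'o \<Rightarrow> 'o \<Rightarrow> 'o \<Rightarrow> 'a \<Rightarrow> 'a \<Rightarrow> 'a \<Rightarrow> 'a \<Rightarrow> 'a \<Rightarrow> 'a \<Rightarrow> 'a \<Rightarrow> 'a \<Rightarrow> bool" where
  "weak_crossed_square P M N L pM pN \<mu> \<nu> \<xi>M \<xi>N \<xi>P h \<longleftrightarrow>
     (let m = (\<mu>, \<xi>M); n = (\<nu>, \<xi>N); p = (\<mu> \<cdot> pM, \<xi>P) in
      pM \<in> hom P M \<and> pN \<in> hom P N \<and> \<mu> \<in> hom M L \<and> \<nu> \<in> hom N L \<and>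
      \<mu> \<cdot> pM = \<nu> \<cdot> pN \<and>
      is_action L M \<xi>M \<and> is_action L N \<xi>N \<and> is_action L P \<xi>P \<and>
      h \<in> hom (tensor m n) P \<and>
      pM \<cdot> \<xi>P = \<xi>M \<cdot> flat_map (Ident C L) pM \<and>
      pN \<cdot> \<xi>P = \<xi>N \<cdot> flat_map (Ident C L) pN \<and>
      crossed_module M L m \<and> crossed_module N L n \<and> crossed_module P L p \<and>
      pM \<cdot> h = tensor_pi1 m n \<and> pN \<cdot> h = tensor_pi2 m n \<and>
      h \<cdot> tensor_map p m n n pM (Ident C N) = tensor_pi1 p n \<and>
      h \<cdot> tensor_map m m p n (Ident C M) pN = tensor_pi2 m p \<and>
      h \<cdot> tensor_act m n = \<xi>P \<cdot> flat_map (Ident C L) h)"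

section \<open>Internal groupoids and double groupoids\<close>

text \<open>
  Composition of generalised elements \<open>f, g : T \<rightarrow> A\<^sub>1\<close> of a groupoid, for \<open>c f = d g\<close>.
  The multiplication itself is defined on the chosen pullback of \<open>c\<close> and \<open>d\<close>.
\<close>

definition gcomp :: "'a grpd \<Rightarrow> 'a \<Rightarrow> 'a \<Rightarrow> 'a" where
  "gcomp G f g = gm G \<cdot> pb_pair (gc G) (gd G) f g"

definition internal_groupoid :: "'o \<Rightarrow> 'o \<Rightarrow> 'a grpd \<Rightarrow> bool" where
  "internal_groupoid A1 A0 G \<longleftrightarrow>
     gd G \<in> hom A1 A0 \<and> gc G \<in> hom A1 A0 \<and> ge G \<in> hom A0 A1 \<and>
     gd G \<cdot> ge G = Ident C A0 \<and> gc G \<cdot> ge G = Ident C A0 \<and>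
     gm G \<in> hom (Dom C (pb1 (gc G) (gd G))) A1 \<and>
     gd G \<cdot> gm G = gd G \<cdot> pb1 (gc G) (gd G) \<and>
     gc G \<cdot> gm G = gc G \<cdot> pb2 (gc G) (gd G) \<and>
     gcomp G (ge G \<cdot> gd G) (Ident C A1) = Ident C A1 \<and>
     gcomp G (Ident C A1) (ge G \<cdot> gc G) = Ident C A1 \<and>
     (\<forall>T f g k. f \<in> hom T A1 \<and> g \<in> hom T A1 \<and> k \<in> hom T A1 \<and>
        gc G \<cdot> f = gd G \<cdot> g \<and> gc G \<cdot> g = gd G \<cdot> k \<longrightarrow>
        gcomp G (gcomp G f g) k = gcomp G f (gcomp G g k)) \<and>
     (\<exists>i\<in>hom A1 A1. gd G \<cdot> i = gc G \<and> gc G \<cdot> i = gd G \<and>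
        gcomp G (Ident C A1) i = ge G \<cdot> gd G \<and> gcomp G i (Ident C A1) = ge G \<cdot> gc G)"

definition internal_functor :: "'a grpd \<Rightarrow> 'a grpd \<Rightarrow> 'a \<Rightarrow> 'a \<Rightarrow> bool" where
  "internal_functor G H F1 F0 \<longleftrightarrow>
     F1 \<in> hom (Dom C (gd G)) (Dom C (gd H)) \<and> F0 \<in> hom (Cod C (gd G)) (Cod C (gd H)) \<and>
     gd H \<cdot> F1 = F0 \<cdot> gd G \<and> gc H \<cdot> F1 = F0 \<cdot> gc G \<and> F1 \<cdot> ge G = ge H \<cdot> F0 \<and>
     F1 \<cdot> gm G = gcomp H (F1 \<cdot> pb1 (gc G) (gd G)) (F1 \<cdot> pb2 (gc G) (gd G))"

text \<open>
  A groupoid in the category of internal groupoids, written out: the structure maps of \<open>U\<close> and \<open>D\<close>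
  form functors between \<open>L\<close> and \<open>R\<close> and vice versa, and the two multiplications on \<open>A\<close> satisfy the
  interchange law (stated for generalised elements).
\<close>

definition double_groupoid :: "'o \<Rightarrow> 'o \<Rightarrow> 'o \<Rightarrow> 'o \<Rightarrow> 'a dgrpd \<Rightarrow> bool" where
  "double_groupoid A B E D G \<longleftrightarrow>
     internal_groupoid A B (gU G) \<and> internal_groupoid A E (gL G) \<and>
     internal_groupoid B D (gR G) \<and> internal_groupoid E D (gD G) \<and>
     internal_functor (gL G) (gR G) (gd (gU G)) (gd (gD G)) \<and>
     internal_functor (gL G) (gR G) (gc (gU G)) (gc (gD G)) \<and>
     internal_functor (gR G) (gL G) (ge (gU G)) (ge (gD G)) \<and>
     internal_functor (gU G) (gD G) (gd (gL G)) (gd (gR G)) \<and>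
     internal_functor (gU G) (gD G) (gc (gL G)) (gc (gR G)) \<and>
     internal_functor (gD G) (gU G) (ge (gL G)) (ge (gR G)) \<and>
     (\<forall>T a b a' b'. a \<in> hom T A \<and> b \<in> hom T A \<and> a' \<in> hom T A \<and> b' \<in> hom T A \<and>
        gc (gU G) \<cdot> a = gd (gU G) \<cdot> b \<and> gc (gU G) \<cdot> a' = gd (gU G) \<cdot> b' \<and>
        gc (gL G) \<cdot> a = gd (gL G) \<cdot> a' \<and> gc (gL G) \<cdot> b = gd (gL G) \<cdot> b' \<longrightarrow>
        gcomp (gL G) (gcomp (gU G) a b) (gcomp (gU G) a' b') =
        gcomp (gU G) (gcomp (gL G) a a') (gcomp (gL G) b b'))"

definition double_functor :: "'a dgrpd \<Rightarrow> 'a dgrpd \<Rightarrow> 'a \<Rightarrow> 'a \<Rightarrow> 'a \<Rightarrow> 'a \<Rightarrow> bool" where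
  "double_functor G H FA FB FE FD \<longleftrightarrow>
     internal_functor (gU G) (gU H) FA FB \<and> internal_functor (gL G) (gL H) FA FE \<and>
     internal_functor (gR G) (gR H) FB FD \<and> internal_functor (gD G) (gD H) FE FD"

text \<open>
  The double groupoid on \<open>Q\<^bsub>M\<otimes>N\<^esub>\<close> over the groupoids of \<open>x\<close> and \<open>y\<close>; only the multiplications are
  not prescribed explicitly (internal multiplications on a reflexive graph are unique here).
\<close>

definition tensor_double_groupoid :: "'a xmod \<Rightarrow> 'a xmod \<Rightarrow> 'a dgrpd \<Rightarrow> bool" where
  "tensor_double_groupoid x y T \<longleftrightarrow>
     double_groupoid (t_Q x y) (Dom C (sd_d x)) (Dom C (sd_d y)) (Cod C (sd_d x)) T \<and>
     gd (gU T) = t_dU x y \<and> gc (gU T) = t_cU x y \<and> ge (gU T) = t_eU x y \<and>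
     gd (gL T) = t_dL x y \<and> gc (gL T) = t_cL x y \<and> ge (gL T) = t_eL x y \<and>
     gd (gR T) = sd_d x \<and> gc (gR T) = sd_c x \<and> ge (gR T) = sd_e x \<and>
     gd (gD T) = sd_d y \<and> gc (gD T) = sd_c y \<and> ge (gD T) = sd_e y"

text \<open>
  The data \<open>pM, pN, \<mu>, \<nu>, \<xi>M, \<xi>N, \<xi>P, h\<close> form the weak crossed square induced by the double groupoid
  \<open>G\<close>. Kernels and intersections being determined up to isomorphism only, \<open>kM\<close>, \<open>kN\<close> and \<open>j\<close> are
  arbitrary representatives. The last clause says that \<open>(h, 1, 1, 1)\<close> is the restriction to the
  normalisations of a morphism from the double groupoid of the tensor product to \<open>G\<close>.
\<close>

definition induced_by_double_groupoid ::
  "'a dgrpd \<Rightarrow> 'o \<Rightarrow> 'o \<Rightarrow> 'o \<Rightarrow> 'o \<Rightarrow> 'a \<Rightarrow> 'a \<Rightarrow> 'a \<Rightarrow> 'a \<Rightarrow> 'a \<Rightarrow> 'a \<Rightarrow> 'a \<Rightarrow> 'a \<Rightarrow> bool" where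
  "induced_by_double_groupoid G P M N L pM pN \<mu> \<nu> \<xi>M \<xi>N \<xi>P h \<longleftrightarrow>
     (\<exists>A B E kM kN j.
        double_groupoid A B E L G \<and>
        kM \<in> hom M B \<and> is_kernel (gd (gR G)) kM \<and>
        kN \<in> hom N E \<and> is_kernel (gd (gD G)) kN \<and>
        j \<in> hom P A \<and> is_meet (ker (gd (gU G))) (ker (gd (gL G))) j \<and>
        \<mu> = gc (gR G) \<cdot> kM \<and> \<nu> = gc (gD G) \<cdot> kN \<and>
        pM \<in> hom P M \<and> kM \<cdot> pM = gc (gU G) \<cdot> j \<and>
        pN \<in> hom P N \<and> kN \<cdot> pN = gc (gL G) \<cdot> j \<and>
        \<xi>M \<in> hom (flat L M) M \<and> kM \<cdot> \<xi>M = conjugation B \<cdot> flat_map (ge (gR G)) kM \<and>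
        \<xi>N \<in> hom (flat L N) N \<and> kN \<cdot> \<xi>N = conjugation E \<cdot> flat_map (ge (gD G)) kN \<and>
        \<xi>P \<in> hom (flat L P) P \<and> j \<cdot> \<xi>P = conjugation A \<cdot> flat_map (ge (gL G) \<cdot> ge (gD G)) j \<and>
        h \<in> hom (tensor (\<mu>, \<xi>M) (\<nu>, \<xi>N)) P \<and>
        (\<exists>T FA FB FE FD.
           tensor_double_groupoid (\<mu>, \<xi>M) (\<nu>, \<xi>N) T \<and> double_functor T G FA FB FE FD \<and>
           FD = Ident C L \<and> FB \<cdot> sd_k (\<mu>, \<xi>M) = kM \<and> FE \<cdot> sd_k (\<nu>, \<xi>N) = kN \<and>
           FA \<cdot> t_gamma (\<mu>, \<xi>M) (\<nu>, \<xi>N) = j \<cdot> h))"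

end

end

theory Submission
  imports Defs
begin

text \<open>
  Let \<open>q\<close> be the cokernel of \<open>\<gamma> k\<^sub>h\<close>. All structure maps of \<open>Q\<^bsub>M\<otimes>N\<^esub>\<close> factor through \<open>q\<close>, the codomain maps
  because \<open>\<pi>\<^sub>M k\<^sub>h = p\<^sub>M h k\<^sub>h = 0\<close>. The commutators of the kernels of domain and codomain vanish in
  \<open>Q\<^bsub>M\<otimes>N\<^esub>\<close> by construction, and cooperators descend along regular epimorphisms, so they vanish in the
  quotient as well; as Smith is Huq, both reflexive graphs on the quotient are groupoids, and the
  interchange law is automatic in a protomodular category. Finally the normality of \<open>\<gamma> k\<^sub>h\<close> says that
  \<open>h\<close> and the corestriction of \<open>q \<gamma>\<close> to its image have the same kernel, whence \<open>P\<close> is the kernel of the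
  two domain maps of the quotient.

  That an internal crossed module yields a groupoid is part of what has to be shown: with the Peiffer
  condition in its short form, one first obtains a cooperator for the kernels of \<open>d\<close> and \<open>c\<close> on the
  semidirect product and then uses that Smith is Huq.\<close>

text \<open>One principle carries most of the arguments: in a protomodular category the two
  inclusions of \<open>X\<close> and \<open>Y\<close> into the pullback of two split epimorphisms
  are jointly strongly epic. An identity between natural expressions on such a pullback therefore
  only has to be checked where one of the two arguments is degenerate. Difunctionality of relations,
  associativity, preservation of multiplications and interchange are all instances.

  Multiplications come from Smith connectors, which are partial operations x y^-1 z; composition is
  the case where y is an identity arrow.

  The groupoids on the semidirect products are needed before the quotient of \<open>Q\<close>
  carries any structure. A map out of \<open>Q\<close> descends only if it kills both commutators; a
  structure map sends one member of one pair of kernels to zero, and the other pair into kernels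
  that commute in a semidirect product.

  Without normality the cokernel of the composite of \<open>\<gamma>\<close> with the kernel of
  \<open>h\<close> could kill more of the tensor product than that kernel, and \<open>P\<close>
  would not embed in the quotient.

  Lifts along regular epimorphisms exist only after passing to a cover, hence the recurring pattern:
  pull back, argue there, cancel the cover.\<close>

locale semi_abelian_category =
  fixes C :: "('o, 'a) cat" (structure)
  assumes semi_abelian: "semi_abelian C"
begin

abbreviation arr :: "'a \<Rightarrow> bool" where "arr f \<equiv> f \<in> Arr C"
abbreviation obj :: "'o \<Rightarrow> bool" where "obj A \<equiv> A \<in> Obj C"
abbreviation dom :: "'a \<Rightarrow> 'o" where "dom \<equiv> Dom C"
abbreviation cod :: "'a \<Rightarrow> 'o" where "cod \<equiv> Cod C"
abbreviation ide :: "'o \<Rightarrow> 'a" where "ide \<equiv> Ident C"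
section \<open>Limits\<close>

lemma is_category: "category C"
  and is_pointed: "pointed C"
  and exact: "barr_exact C"
  and protomodular: "bourn_protomodular C"
  and coproducts: "has_binary_coproducts C"
  using semi_abelian by (auto simp: semi_abelian_def)

lemma regular: "regular_category C"
  using exact by (simp add: barr_exact_def)

lemma hom_iff [simp]: "f \<in> hom C A B \<longleftrightarrow> arr f \<and> dom f = A \<and> cod f = B"
  by (auto simp: hom_def)

lemma obj_dom [simp]: "arr f \<Longrightarrow> obj (dom f)"
  and obj_cod [simp]: "arr f \<Longrightarrow> obj (cod f)"
  and arr_ide [simp]: "obj A \<Longrightarrow> arr (ide A)"
  and dom_ide [simp]: "obj A \<Longrightarrow> dom (ide A) = A"
  and cod_ide [simp]: "obj A \<Longrightarrow> cod (ide A) = A"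
  using is_category by (auto simp: category_def)

lemma arr_comp [simp]: "arr f \<Longrightarrow> arr g \<Longrightarrow> cod f = dom g \<Longrightarrow> arr (g \<cdot> f)"
  and dom_comp [simp]: "arr f \<Longrightarrow> arr g \<Longrightarrow> cod f = dom g \<Longrightarrow> dom (g \<cdot> f) = dom f"
  and cod_comp [simp]: "arr f \<Longrightarrow> arr g \<Longrightarrow> cod f = dom g \<Longrightarrow> cod (g \<cdot> f) = cod g"
  and comp_ide [simp]: "arr f \<Longrightarrow> dom f = A \<Longrightarrow> f \<cdot> ide A = f"
  and ide_comp [simp]: "arr f \<Longrightarrow> cod f = A \<Longrightarrow> ide A \<cdot> f = f"
  and comp_assoc [simp]: "arr f \<Longrightarrow> arr g \<Longrightarrow> arr h \<Longrightarrow> cod f = dom g \<Longrightarrow> cod g = dom h \<Longrightarrow>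
        (h \<cdot> g) \<cdot> f = h \<cdot> (g \<cdot> f)"
  using is_category by (auto simp: category_def)

lemma homD: "f \<in> hom C A B \<Longrightarrow> arr f \<and> dom f = A \<and> cod f = B \<and> obj A \<and> obj B"
  by auto

lemma reassoc:
  assumes "f \<cdot> g = h" "arr f" "arr g" "cod g = dom f" "arr t" "cod t = dom g"
  shows "f \<cdot> (g \<cdot> t) = h \<cdot> t"
  using assms comp_assoc[of t g f] by simp

lemma monicD:
  assumes "monic C m" "m \<cdot> u = m \<cdot> v" "u \<in> hom C T (dom m)" "v \<in> hom C T (dom m)"
  shows "u = v"
  using assms by (auto simp: monic_def)

lemma monicI:
  assumes "arr m"
    and "\<And>u v T. u \<in> hom C T (dom m) \<Longrightarrow> v \<in> hom C T (dom m) \<Longrightarrow> m \<cdot> u = m \<cdot> v \<Longrightarrow> u = v"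
  shows "monic C m"
  using assms by (auto simp: monic_def)

lemma monic_arr: "monic C m \<Longrightarrow> arr m"
  by (simp add: monic_def)

lemma isoE:
  assumes "iso C f"
  obtains g where "g \<in> hom C (cod f) (dom f)" "g \<cdot> f = ide (dom f)" "f \<cdot> g = ide (cod f)" "arr f"
  using assms by (auto simp: iso_def)

lemma isoI:
  assumes "f \<in> hom C A B" "g \<in> hom C B A" "g \<cdot> f = ide A" "f \<cdot> g = ide B"
  shows "iso C f"
  using assms by (auto simp: iso_def)

lemma iso_ide: "obj A \<Longrightarrow> iso C (ide A)"
  by (rule isoI[of _ A A "ide A"]) auto

lemma iso_epi:
  assumes "iso C f" "u \<cdot> f = v \<cdot> f" "u \<in> hom C (cod f) W" "v \<in> hom C (cod f) W"
  shows "u = v"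
proof -
  obtain g where g: "g \<in> hom C (cod f) (dom f)" "f \<cdot> g = ide (cod f)" and f: "arr f"
    using assms(1) by (rule isoE)
  have "(u \<cdot> f) \<cdot> g = (v \<cdot> f) \<cdot> g" using assms by simp
  thus ?thesis using assms(3,4) g f by simp
qed

lemma finite_limits: "finitely_complete C"
  using regular by (simp add: regular_category_def)

lemma is_pullbackD:
  assumes "is_pullback C f g p q"
  shows "arr f" "arr g" "cod f = cod g" "arr p" "arr q" "dom q = dom p" "cod p = dom f" "cod q = dom g"
    "f \<cdot> p = g \<cdot> q"
  using assms by (auto simp: is_pullback_def)

lemma is_pullback_lift:
  assumes "is_pullback C f g p q" "u \<in> hom C T (dom f)" "v \<in> hom C T (dom g)" "f \<cdot> u = g \<cdot> v"
  obtains w where "w \<in> hom C T (dom p)" "p \<cdot> w = u" "q \<cdot> w = v"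
proof -
  have "\<exists>!w. w \<in> hom C T (dom p) \<and> p \<cdot> w = u \<and> q \<cdot> w = v"
    using assms unfolding is_pullback_def by blast
  thus thesis using that by blast
qed

lemma is_pullback_ext:
  assumes "is_pullback C f g p q" "w \<in> hom C T (dom p)" "w' \<in> hom C T (dom p)" "p \<cdot> w = p \<cdot> w'" "q \<cdot> w = q \<cdot> w'"
  shows "w = w'"
proof -
  note [simp] = is_pullbackD[OF assms(1)]
  have e: "f \<cdot> (p \<cdot> w) = g \<cdot> (q \<cdot> w)"
    using reassoc[of f p "g \<cdot> q" w] assms(2) by simp
  have "\<exists>!z. z \<in> hom C T (dom p) \<and> p \<cdot> z = p \<cdot> w \<and> q \<cdot> z = q \<cdot> w"
  proof -
    have "p \<cdot> w \<in> hom C T (dom f)" "q \<cdot> w \<in> hom C T (dom g)" using assms(2) by auto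
    thus ?thesis using assms(1) e unfolding is_pullback_def by blast
  qed
  thus ?thesis using assms(2-5) by metis
qed

lemma is_pullbackI:
  assumes "arr f" "arr g" "cod f = cod g" "p \<in> hom C V (dom f)" "q \<in> hom C V (dom g)" "f \<cdot> p = g \<cdot> q"
    and "\<And>T u v. u \<in> hom C T (dom f) \<Longrightarrow> v \<in> hom C T (dom g) \<Longrightarrow> f \<cdot> u = g \<cdot> v \<Longrightarrow>
            \<exists>w. w \<in> hom C T V \<and> p \<cdot> w = u \<and> q \<cdot> w = v"
    and "\<And>T w w'. w \<in> hom C T V \<Longrightarrow> w' \<in> hom C T V \<Longrightarrow> p \<cdot> w = p \<cdot> w' \<Longrightarrow> q \<cdot> w = q \<cdot> w' \<Longrightarrow> w = w'"
  shows "is_pullback C f g p q"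
proof -
  have "\<exists>!w. w \<in> hom C T (dom p) \<and> p \<cdot> w = u \<and> q \<cdot> w = v"
    if "u \<in> hom C T (dom f)" "v \<in> hom C T (dom g)" "f \<cdot> u = g \<cdot> v" for T u v
  proof -
    have "\<exists>w. w \<in> hom C T V \<and> p \<cdot> w = u \<and> q \<cdot> w = v" using assms(7) that by blast
    then obtain w where "w \<in> hom C T V" "p \<cdot> w = u" "q \<cdot> w = v" by blast
    moreover have "dom p = V" using assms(4) by simp
    ultimately show ?thesis using assms(8) by (metis (no_types, lifting))
  qed
  moreover have "p \<in> hom C (dom p) (dom f)" "q \<in> hom C (dom p) (dom g)" using assms(4,5) by auto
  ultimately show ?thesis unfolding is_pullback_def using assms(1-3,6) by blast
qed

abbreviation pbo :: "'a \<Rightarrow> 'a \<Rightarrow> 'o" where "pbo f g \<equiv> dom (pb1 C f g)"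

lemma pullback:
  assumes "arr f" "arr g" "cod f = cod g"
  shows "is_pullback C f g (pb1 C f g) (pb2 C f g)"
proof -
  have "\<exists>z. case z of (p, q) \<Rightarrow> is_pullback C f g p q"
    using finite_limits assms by (auto simp: finitely_complete_def)
  hence "case (SOME (p, q). is_pullback C f g p q) of (p, q) \<Rightarrow> is_pullback C f g p q"
    by (rule someI_ex)
  thus ?thesis by (simp add: pb1_def pb2_def case_prod_beta)
qed

lemma pb_simps [simp]:
  assumes "arr f" "arr g" "cod f = cod g"
  shows "arr (pb1 C f g)" "cod (pb1 C f g) = dom f"
    "arr (pb2 C f g)" "dom (pb2 C f g) = pbo f g" "cod (pb2 C f g) = dom g" "obj (pbo f g)"
  using is_pullbackD[OF pullback[OF assms]] by auto

lemma pb_comm: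
  assumes "arr f" "arr g" "cod f = cod g"
  shows "f \<cdot> pb1 C f g = g \<cdot> pb2 C f g"
  using is_pullbackD[OF pullback[OF assms]] by simp

lemma pb_comm':
  assumes "arr f" "arr g" "cod f = cod g" "arr t" "cod t = pbo f g"
  shows "f \<cdot> (pb1 C f g \<cdot> t) = g \<cdot> (pb2 C f g \<cdot> t)"
  using reassoc[OF pb_comm[OF assms(1-3)]] assms by simp

lemma pb_ext:
  assumes "w \<in> hom C T (pbo f g)" "w' \<in> hom C T (pbo f g)" "arr f" "arr g" "cod f = cod g"
    "pb1 C f g \<cdot> w = pb1 C f g \<cdot> w'" "pb2 C f g \<cdot> w = pb2 C f g \<cdot> w'"
  shows "w = w'"
  using is_pullback_ext[OF pullback] assms by blast

lemma pb_pair: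
  assumes "u \<in> hom C T (dom f)" "v \<in> hom C T (dom g)" "arr f" "arr g" "cod f = cod g" "f \<cdot> u = g \<cdot> v"
  shows "pb_pair C f g u v \<in> hom C T (pbo f g) \<and> pb1 C f g \<cdot> pb_pair C f g u v = u \<and> pb2 C f g \<cdot> pb_pair C f g u v = v"
proof -
  have "\<exists>!w. w \<in> hom C T (pbo f g) \<and> pb1 C f g \<cdot> w = u \<and> pb2 C f g \<cdot> w = v"
    using pullback[OF assms(3-5)] assms(1,2,6) unfolding is_pullback_def by blast
  from theI'[OF this] show ?thesis using assms(1) by (simp add: pb_pair_def)
qed

lemma pb_pair_simps [simp]:
  assumes "arr u" "arr v" "dom u = dom v" "cod u = dom f" "cod v = dom g" "arr f" "arr g" "cod f = cod g" "f \<cdot> u = g \<cdot> v"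
  shows "arr (pb_pair C f g u v)" "dom (pb_pair C f g u v) = dom u" "cod (pb_pair C f g u v) = pbo f g"
    "pb1 C f g \<cdot> pb_pair C f g u v = u" "pb2 C f g \<cdot> pb_pair C f g u v = v"
proof -
  have "pb_pair C f g u v \<in> hom C (dom u) (pbo f g) \<and> pb1 C f g \<cdot> pb_pair C f g u v = u \<and> pb2 C f g \<cdot> pb_pair C f g u v = v"
    by (rule pb_pair) (simp_all only: assms hom_iff simp_thms)
  thus "arr (pb_pair C f g u v)" "dom (pb_pair C f g u v) = dom u" "cod (pb_pair C f g u v) = pbo f g"
    "pb1 C f g \<cdot> pb_pair C f g u v = u" "pb2 C f g \<cdot> pb_pair C f g u v = v"
    by (simp_all only: hom_iff)
qed

lemma pb_pair_simps' [simp]: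
  assumes "arr u" "arr v" "dom u = dom v" "cod u = dom f" "cod v = dom g" "arr f" "arr g" "cod f = cod g" "f \<cdot> u = g \<cdot> v"
    "arr t" "cod t = dom u"
  shows "pb1 C f g \<cdot> (pb_pair C f g u v \<cdot> t) = u \<cdot> t" "pb2 C f g \<cdot> (pb_pair C f g u v \<cdot> t) = v \<cdot> t"
  by (rule reassoc[OF pb_pair_simps(4)[OF assms(1-9)]], use pb_pair_simps(1-3)[OF assms(1-9)] assms(6-8,10,11) in simp_all)
    (rule reassoc[OF pb_pair_simps(5)[OF assms(1-9)]], use pb_pair_simps(1-3)[OF assms(1-9)] assms(6-8,10,11) in simp_all)

lemma pb_pair_comp [simp]:
  assumes "arr u" "arr v" "dom u = dom v" "cod u = dom f" "cod v = dom g" "arr f" "arr g" "cod f = cod g" "f \<cdot> u = g \<cdot> v"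
    "arr t" "cod t = dom u"
  shows "pb_pair C f g u v \<cdot> t = pb_pair C f g (u \<cdot> t) (v \<cdot> t)"
proof -
  have e: "f \<cdot> (u \<cdot> t) = g \<cdot> (v \<cdot> t)" using assms reassoc[OF assms(9)] by simp
  show ?thesis
    by (rule pb_ext[of _ "dom t" f g]) (use assms e in auto)
qed

lemma monic_pb1:
  assumes "monic C g" "arr f" "cod f = cod g"
  shows "monic C (pb1 C f g)"
proof (rule monicI)
  have [simp]: "arr g" using assms(1) by (rule monic_arr)
  show "arr (pb1 C f g)" using assms by simp
  fix u v T assume uv: "u \<in> hom C T (pbo f g)" "v \<in> hom C T (pbo f g)" "pb1 C f g \<cdot> u = pb1 C f g \<cdot> v"
  have "g \<cdot> (pb2 C f g \<cdot> u) = g \<cdot> (pb2 C f g \<cdot> v)"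
    using pb_comm'[of f g u] pb_comm'[of f g v] uv assms by auto
  hence "pb2 C f g \<cdot> u = pb2 C f g \<cdot> v"
    by (rule monicD[OF assms(1), of _ _ T]) (use uv assms in auto)
  thus "u = v" using pb_ext uv assms \<open>arr g\<close> by blast
qed

section \<open>Zero morphisms, products and kernels\<close>

lemma zero_object: obtains Z where "is_zero C Z"
  using is_pointed by (auto simp: pointed_def)

text \<open>The description of \<open>zero\<close> ranges over all zero objects at once, so
  uniqueness has to compare factorisations through two different ones; the arrow \<open>i\<close>
  between them does this.\<close>

lemma zero_props:
  assumes "obj A" "obj B"
  shows "zero C A B \<in> hom C A B \<and> (\<forall>Z g k. is_zero C Z \<and> g \<in> hom C A Z \<and> k \<in> hom C Z B \<longrightarrow> k \<cdot> g = zero C A B)"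
proof -
  obtain Z where Z: "is_zero C Z" by (rule zero_object)
  have un: "\<exists>!f. f \<in> hom C X W" "\<exists>!f. f \<in> hom C W X" if "is_zero C W" "obj X" for W X
    using that unfolding is_zero_def is_terminal_def is_initial_def by blast+
  obtain g where g: "g \<in> hom C A Z" using un(1)[OF Z assms(1)] by blast
  obtain k where k: "k \<in> hom C Z B" using un(2)[OF Z assms(2)] by blast
  have uniq: "k' \<cdot> g' = k \<cdot> g" if "is_zero C Z'" "g' \<in> hom C A Z'" "k' \<in> hom C Z' B" for Z' g' k'
  proof -
    have "obj Z'" using that by auto
    then obtain i where i: "i \<in> hom C Z Z'" using un(2)[OF Z] by blast
    have "i \<cdot> g = g'" using un(1)[OF that(1) assms(1)] that(2) i g by (metis arr_comp cod_comp dom_comp hom_iff)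
    moreover have "k' \<cdot> i = k" using un(2)[OF Z assms(2)] that(3) i k by (metis arr_comp cod_comp dom_comp hom_iff)
    ultimately show ?thesis using i g that(3) by auto
  qed
  have "zero C A B = k \<cdot> g"
    unfolding zero_def using Z g k uniq by (intro the_equality) blast+
  moreover have "k \<cdot> g \<in> hom C A B" using g k by auto
  ultimately show ?thesis using uniq by simp
qed

lemma zero_simps [simp]:
  assumes "obj A" "obj B"
  shows "arr (zero C A B)" "dom (zero C A B) = A" "cod (zero C A B) = B"
  using zero_props[OF assms] by auto

lemma zero_fact:
  assumes "obj A" "obj B" "is_zero C Z"
  obtains g k where "g \<in> hom C A Z" "k \<in> hom C Z B" "zero C A B = k \<cdot> g"
proof -
  obtain g k where "g \<in> hom C A Z" "k \<in> hom C Z B"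
    using assms unfolding is_zero_def is_terminal_def is_initial_def by blast
  with that zero_props[OF assms(1,2)] assms(3) show thesis by metis
qed

lemma comp_zero [simp]:
  assumes "arr f" "dom f = B" "obj A"
  shows "f \<cdot> zero C A B = zero C A (cod f)"
proof -
  obtain Z where Z: "is_zero C Z" by (rule zero_object)
  have B: "obj B" using assms by auto
  obtain g k where gk: "g \<in> hom C A Z" "k \<in> hom C Z B" "zero C A B = k \<cdot> g"
    using zero_fact[OF assms(3) B Z] by metis
  have "(f \<cdot> k) \<cdot> g = zero C A (cod f)"
    using zero_props[OF assms(3), of "cod f"] Z gk assms by (metis arr_comp cod_comp dom_comp hom_iff obj_cod)
  thus ?thesis using gk assms by simp
qed

lemma zero_comp [simp]:
  assumes "arr f" "cod f = A" "obj B"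
  shows "zero C A B \<cdot> f = zero C (dom f) B"
proof -
  obtain Z where Z: "is_zero C Z" by (rule zero_object)
  have A: "obj A" using assms by auto
  obtain g k where gk: "g \<in> hom C A Z" "k \<in> hom C Z B" "zero C A B = k \<cdot> g"
    using zero_fact[OF A assms(3) Z] by metis
  have "k \<cdot> (g \<cdot> f) = zero C (dom f) B"
    using zero_props[OF _ assms(3), of "dom f"] Z gk assms by (metis arr_comp cod_comp dom_comp hom_iff obj_dom)
  thus ?thesis using gk assms by simp
qed

lemma zero_unique:
  assumes "is_zero C Z" "f \<in> hom C A B" "A = Z \<or> B = Z"
  shows "f = zero C A B"
proof -
  have ob: "obj A" "obj B" using assms by auto
  hence "\<exists>!g. g \<in> hom C A B" using assms(1,3)
    unfolding is_zero_def is_initial_def is_terminal_def by auto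
  thus ?thesis using assms(2) zero_simps[OF ob] by auto
qed

abbreviation prd :: "'o \<Rightarrow> 'o \<Rightarrow> 'o" where "prd A B \<equiv> dom (proj1 C A B)"

lemma product:
  assumes "obj A" "obj B"
  shows "is_product C A B (proj1 C A B) (proj2 C A B)"
proof -
  obtain Z where Z: "is_zero C Z" by (rule zero_object)
  have [simp]: "obj Z" using Z by (simp add: is_zero_def is_initial_def)
  let ?p = "pb1 C (zero C A Z) (zero C B Z)" and ?q = "pb2 C (zero C A Z) (zero C B Z)"
  \<comment> \<open>Over a zero object the compatibility condition of a pullback is void, so the
    pullback is a product.\<close>
  have "is_product C A B ?p ?q"
    unfolding is_product_def
  proof (intro conjI allI impI)
    fix T u v assume uv: "u \<in> hom C T A \<and> v \<in> hom C T B"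
    hence "zero C A Z \<cdot> u = zero C B Z \<cdot> v" using assms by auto
    moreover have "u \<in> hom C T (dom (zero C A Z))" "v \<in> hom C T (dom (zero C B Z))" using uv assms by auto
    ultimately show "\<exists>!w. w \<in> hom C T (dom ?p) \<and> ?p \<cdot> w = u \<and> ?q \<cdot> w = v"
      using pullback[of "zero C A Z" "zero C B Z"] \<open>zero C A Z \<cdot> u = zero C B Z \<cdot> v\<close> assms
      unfolding is_pullback_def by (metis zero_simps(1,3) \<open>obj Z\<close>)
  qed (use assms in auto)
  hence "\<exists>z. case z of (p, q) \<Rightarrow> is_product C A B p q" by auto
  hence "case (SOME (p, q). is_product C A B p q) of (p, q) \<Rightarrow> is_product C A B p q"
    by (rule someI_ex)
  thus ?thesis by (simp add: proj1_def proj2_def case_prod_beta)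
qed

lemma proj_simps [simp]:
  assumes "obj A" "obj B"
  shows "arr (proj1 C A B)" "cod (proj1 C A B) = A"
    "arr (proj2 C A B)" "dom (proj2 C A B) = prd A B" "cod (proj2 C A B) = B" "obj (prd A B)"
  using product[OF assms] by (auto simp: is_product_def)

lemma pair:
  assumes "u \<in> hom C T A" "v \<in> hom C T B"
  shows "pair C u v \<in> hom C T (prd A B) \<and> proj1 C A B \<cdot> pair C u v = u \<and> proj2 C A B \<cdot> pair C u v = v"
proof -
  have "\<exists>!w. w \<in> hom C T (prd A B) \<and> proj1 C A B \<cdot> w = u \<and> proj2 C A B \<cdot> w = v"
    using product[of A B] assms unfolding is_product_def by (metis homD)
  from theI'[OF this] show ?thesis using assms by (simp add: pair_def)
qed

lemma pair_simps [simp]: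
  assumes "arr u" "arr v" "dom u = dom v"
  shows "arr (pair C u v)" "dom (pair C u v) = dom u" "cod (pair C u v) = prd (cod u) (cod v)"
  using pair[of u "dom u" "cod u" v "cod v"] assms by auto

lemma proj_pair [simp]:
  assumes "arr u" "arr v" "dom u = dom v" "A = cod u" "B = cod v"
  shows "proj1 C A B \<cdot> pair C u v = u" "proj2 C A B \<cdot> pair C u v = v"
  using pair[of u "dom u" "cod u" v "cod v"] assms by auto

lemma proj_pair' [simp]:
  assumes "arr u" "arr v" "dom u = dom v" "A = cod u" "B = cod v" "arr t" "cod t = dom u"
  shows "proj1 C A B \<cdot> (pair C u v \<cdot> t) = u \<cdot> t" "proj2 C A B \<cdot> (pair C u v \<cdot> t) = v \<cdot> t"
  using reassoc[OF proj_pair(1)[OF assms(1-5)]] reassoc[OF proj_pair(2)[OF assms(1-5)]] assms by auto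

lemma prod_ext:
  assumes "w \<in> hom C T (prd A B)" "w' \<in> hom C T (prd A B)" "obj A" "obj B"
    "proj1 C A B \<cdot> w = proj1 C A B \<cdot> w'" "proj2 C A B \<cdot> w = proj2 C A B \<cdot> w'"
  shows "w = w'"
proof -
  have "proj1 C A B \<cdot> w \<in> hom C T A" "proj2 C A B \<cdot> w \<in> hom C T B" using assms by auto
  hence "\<exists>!z. z \<in> hom C T (prd A B) \<and> proj1 C A B \<cdot> z = proj1 C A B \<cdot> w \<and> proj2 C A B \<cdot> z = proj2 C A B \<cdot> w"
    using product[OF assms(3,4)] unfolding is_product_def by blast
  thus ?thesis using assms by metis
qed

lemma pair_comp [simp]:
  assumes "arr u" "arr v" "dom u = dom v" "arr t" "cod t = dom u"
  shows "pair C u v \<cdot> t = pair C (u \<cdot> t) (v \<cdot> t)"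
  by (rule prod_ext[of _ "dom t" "cod u" "cod v"]) (use assms in auto)

lemma pair_eqD:
  assumes "pair C u v = pair C u' v'" "u \<in> hom C T A" "v \<in> hom C T B" "u' \<in> hom C T A" "v' \<in> hom C T B"
  shows "u = u'" "v = v'"
proof -
  show "u = u'" using arg_cong[OF assms(1), of "\<lambda>x. proj1 C A B \<cdot> x"] assms(2-) by auto
  show "v = v'" using arg_cong[OF assms(1), of "\<lambda>x. proj2 C A B \<cdot> x"] assms(2-) by auto
qed

lemma is_kernelD:
  assumes "is_kernel C f k"
  shows "arr f" "arr k" "cod k = dom f" "f \<cdot> k = zero C (dom k) (cod f)"
  using assms by (auto simp: is_kernel_def)

lemma is_kernel_lift:
  assumes "is_kernel C f k" "u \<in> hom C T (dom f)" "f \<cdot> u = zero C T (cod f)"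
  obtains w where "w \<in> hom C T (dom k)" "k \<cdot> w = u"
proof -
  have "\<exists>!w. w \<in> hom C T (dom k) \<and> k \<cdot> w = u" using assms unfolding is_kernel_def by blast
  thus thesis using that by blast
qed

lemma is_kernel_monic:
  assumes "is_kernel C f k" shows "monic C k"
proof (rule monicI)
  note [simp] = is_kernelD[OF assms]
  show "arr k" by simp
  fix u v T assume uv: "u \<in> hom C T (dom k)" "v \<in> hom C T (dom k)" "k \<cdot> u = k \<cdot> v"
  have "k \<cdot> u \<in> hom C T (dom f)" using uv by auto
  moreover have "f \<cdot> (k \<cdot> u) = zero C T (cod f)" using uv reassoc[OF is_kernelD(4)[OF assms]] by auto
  ultimately have "\<exists>!w. w \<in> hom C T (dom k) \<and> k \<cdot> w = k \<cdot> u"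
    using assms unfolding is_kernel_def by blast
  thus "u = v" using uv by metis
qed

lemma is_kernelI:
  assumes "arr f" "monic C k" "cod k = dom f" "f \<cdot> k = zero C (dom k) (cod f)"
    and "\<And>T u. u \<in> hom C T (dom f) \<Longrightarrow> f \<cdot> u = zero C T (cod f) \<Longrightarrow> \<exists>w. w \<in> hom C T (dom k) \<and> k \<cdot> w = u"
  shows "is_kernel C f k"
  unfolding is_kernel_def
proof (intro conjI allI impI)
  fix T u assume u: "u \<in> hom C T (dom f) \<and> f \<cdot> u = zero C T (cod f)"
  then obtain w where "w \<in> hom C T (dom k) \<and> k \<cdot> w = u" using assms(5) by blast
  thus "\<exists>!w. w \<in> hom C T (dom k) \<and> k \<cdot> w = u" using monicD[OF assms(2)] by metis
qed (use assms monic_arr[OF assms(2)] in auto)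

lemma kernel:
  assumes "arr f" shows "is_kernel C f (ker C f)"
proof -
  obtain Z where Z: "is_zero C Z" by (rule zero_object)
  have [simp]: "obj Z" using Z by (simp add: is_zero_def is_initial_def)
  note [simp] = assms
  have c: "f \<cdot> pb1 C f (zero C Z (cod f)) = zero C (pbo f (zero C Z (cod f))) (cod f)"
    using pb_comm[of f "zero C Z (cod f)"] by simp
  \<comment> \<open>The kernel is constructed as the pullback of \<open>f\<close> along the arrow
    from a zero object.\<close>
  have "is_kernel C f (pb1 C f (zero C Z (cod f)))"
  proof (rule is_kernelI)
    have "monic C (zero C Z (cod f))"
    proof (rule monicI)
      fix u v T assume "u \<in> hom C T (dom (zero C Z (cod f)))" "v \<in> hom C T (dom (zero C Z (cod f)))"
      thus "u = v" using zero_unique[OF Z, of u T Z] zero_unique[OF Z, of v T Z] by simp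
    qed auto
    thus "monic C (pb1 C f (zero C Z (cod f)))" using monic_pb1 by simp
    fix T u assume "u \<in> hom C T (dom f)" "f \<cdot> u = zero C T (cod f)"
    thus "\<exists>w. w \<in> hom C T (dom (pb1 C f (zero C Z (cod f)))) \<and> pb1 C f (zero C Z (cod f)) \<cdot> w = u"
      by (intro exI[of _ "pb_pair C f (zero C Z (cod f)) u (zero C T Z)"]) auto
  qed (use c in auto)
  thus ?thesis unfolding ker_def by (rule someI)
qed

lemma ker_simps [simp]:
  assumes "arr f"
  shows "arr (ker C f)" "cod (ker C f) = dom f" "f \<cdot> ker C f = zero C (dom (ker C f)) (cod f)"
    "obj (dom (ker C f))"
  using is_kernelD[OF kernel[OF assms]] by auto

lemma ker_simps' [simp]:
  assumes "arr f" "arr t" "cod t = dom (ker C f)"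
  shows "f \<cdot> (ker C f \<cdot> t) = zero C (dom t) (cod f)"
  using reassoc[OF ker_simps(3)[OF assms(1)]] assms by auto

lemma ker_monic: "arr f \<Longrightarrow> monic C (ker C f)"
  by (rule is_kernel_monic[OF kernel])

lemma ker_lift:
  assumes "arr f" "u \<in> hom C T (dom f)" "f \<cdot> u = zero C T (cod f)"
  obtains w where "w \<in> hom C T (dom (ker C f))" "ker C f \<cdot> w = u"
  using is_kernel_lift[OF kernel[OF assms(1)] assms(2,3)] .

section \<open>Protomodularity\<close>

text \<open>Presents the kernel as change of base along the arrow from a zero object, which is the
  shape that the protomodularity axiom expects.\<close>

lemma is_kernel_pullback:
  assumes k: "is_kernel C f k" and Z: "is_zero C Z"
  shows "is_pullback C (zero C Z (cod f)) f (zero C (dom k) Z) k"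
proof -
  note [simp] = is_kernelD[OF k]
  have [simp]: "obj Z" using Z by (simp add: is_zero_def is_initial_def)
  show ?thesis
  proof (rule is_pullbackI[where V = "dom k"])
    fix T u v assume uv: "u \<in> hom C T (dom (zero C Z (cod f)))" "v \<in> hom C T (dom f)" "zero C Z (cod f) \<cdot> u = f \<cdot> v"
    hence "f \<cdot> v = zero C T (cod f)" by auto
    then obtain w where w: "w \<in> hom C T (dom k)" "k \<cdot> w = v" using is_kernel_lift[OF k uv(2)] by metis
    moreover have "u = zero C T Z" using zero_unique[OF Z, of u T Z] uv by simp
    ultimately show "\<exists>w. w \<in> hom C T (dom k) \<and> zero C (dom k) Z \<cdot> w = u \<and> k \<cdot> w = v"
      by (intro exI[of _ w]) auto
  next
    fix T w w' assume "w \<in> hom C T (dom k)" "w' \<in> hom C T (dom k)" "k \<cdot> w = k \<cdot> w'"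
    thus "w = w'" using monicD[OF is_kernel_monic[OF k]] by blast
  qed auto
qed

text \<open>This is protomodularity for change of base along the arrow from zero to
  \<open>B\<close>: \<open>k\<close> and \<open>g \<cdot> k\<close> share their domain, so the
  induced morphism between the fibres is an identity.\<close>

lemma split_short_five:
  assumes "p \<in> hom C X B" "s \<in> hom C B X" "p \<cdot> s = ide B" "p' \<in> hom C X' B"
    "g \<in> hom C X X'" "p' \<cdot> g = p" and k: "is_kernel C p k" "is_kernel C p' (g \<cdot> k)"
  shows "iso C g"
proof -
  obtain Z where Z: "is_zero C Z" by (rule zero_object)
  note [simp] = assms(1)[THEN homD] assms(2)[THEN homD] assms(4)[THEN homD] assms(5)[THEN homD] assms(3,6)
  note [simp] = is_kernelD[OF k(1)]
  have [simp]: "dom (g \<cdot> k) = dom k" by simp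
  have [simp]: "obj (dom k)" by (rule obj_dom) simp
  have eq: "p' \<cdot> (g \<cdot> s) = ide B"
    using reassoc[OF assms(6), of s] by simp
  have "is_point C p s" "is_point C p' (g \<cdot> s)"
    using eq by (auto simp: is_point_def)
  moreover have "is_pullback C (zero C Z B) p (zero C (dom k) Z) k" "is_pullback C (zero C Z B) p' (zero C (dom k) Z) (g \<cdot> k)"
    using is_kernel_pullback[OF k(1) Z] is_kernel_pullback[OF k(2) Z] by auto
  moreover have "zero C (dom k) Z \<cdot> ide (dom k) = zero C (dom k) Z"
    using Z by (simp add: is_zero_def is_initial_def)
  moreover have "ide (dom k) \<in> hom C (dom (zero C (dom k) Z)) (dom (zero C (dom k) Z))"
    using Z by (simp add: is_zero_def is_initial_def)
  moreover have "(g \<cdot> k) \<cdot> ide (dom k) = g \<cdot> k" by simp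
  moreover have "iso C (ide (dom k))" by (rule iso_ide) simp
  moreover have "cod p = cod p'" "g \<in> hom C (dom p) (dom p')" "p' \<cdot> g = p" "g \<cdot> s = g \<cdot> s" by auto
  ultimately show ?thesis
    by (intro protomodular[unfolded bourn_protomodular_def, rule_format, of p s p' "g \<cdot> s" g "zero C Z B"
       "zero C (dom k) Z" k "zero C (dom k) Z" "g \<cdot> k" "ide (dom k)"] conjI)
qed

text \<open>Section and kernel of a split epimorphism are jointly strongly epic: the subobject
  \<open>m\<close> is itself split over \<open>B\<close> by \<open>s'\<close>, with the same kernel
  object, so \<open>split_short_five\<close> applies to \<open>m\<close>.\<close>

lemma split_ext_strong:
  assumes "p \<in> hom C X B" "s \<in> hom C B X" "p \<cdot> s = ide B" and k: "is_kernel C p k"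
    and m: "monic C m" "cod m = X" and "s' \<in> hom C B (dom m)" "m \<cdot> s' = s"
      "k' \<in> hom C (dom k) (dom m)" "m \<cdot> k' = k"
  shows "iso C m"
proof (rule split_short_five)
  note [simp] = assms(1)[THEN homD] assms(2)[THEN homD] assms(7)[THEN homD] assms(9)[THEN homD] assms(3) m(2) monic_arr[OF m(1)]
  note [simp] = is_kernelD[OF k]
  show "p \<cdot> m \<in> hom C (dom m) B" "s' \<in> hom C B (dom m)" "(p \<cdot> m) \<cdot> s' = ide B" "m \<in> hom C (dom m) X" "p \<in> hom C X B" "p \<cdot> m = p \<cdot> m"
    by (auto simp: assms)
  show "is_kernel C p (m \<cdot> k')" using k assms(10) by simp
  show "is_kernel C (p \<cdot> m) k'"
  proof (rule is_kernelI)
    show "monic C k'"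
    proof (rule monicI)
      fix u v T assume uv: "u \<in> hom C T (dom k')" "v \<in> hom C T (dom k')" "k' \<cdot> u = k' \<cdot> v"
      hence "k \<cdot> u = k \<cdot> v" using reassoc[OF assms(10), of u] reassoc[OF assms(10), of v] by simp
      thus "u = v" by (rule monicD[OF is_kernel_monic[OF k], of _ _ T]) (use uv in auto)
    qed simp
    show "(p \<cdot> m) \<cdot> k' = zero C (dom k') (cod (p \<cdot> m))" using assms(10) by simp
    fix T u assume u: "u \<in> hom C T (dom (p \<cdot> m))" "(p \<cdot> m) \<cdot> u = zero C T (cod (p \<cdot> m))"
    then obtain w where w: "w \<in> hom C T (dom k)" "k \<cdot> w = m \<cdot> u"
      using is_kernel_lift[OF k, of "m \<cdot> u" T] by auto
    have "m \<cdot> (k' \<cdot> w) = m \<cdot> u" using w reassoc[OF assms(10), of w] by simp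
    hence "k' \<cdot> w = u" by (rule monicD[OF m(1), of _ _ T]) (use u w in auto)
    thus "\<exists>w. w \<in> hom C T (dom k') \<and> k' \<cdot> w = u" using w by auto
  qed auto
qed

text \<open>The equaliser is the pullback of the pairing of \<open>u\<close> and \<open>v\<close>
  along the diagonal of \<open>W\<close>.\<close>

lemma equaliser_monic:
  assumes "u \<in> hom C X W" "v \<in> hom C X W"
  obtains m where "monic C m" "cod m = X" "u \<cdot> m = v \<cdot> m"
    "\<And>T t. t \<in> hom C T X \<Longrightarrow> u \<cdot> t = v \<cdot> t \<Longrightarrow> \<exists>w. w \<in> hom C T (dom m) \<and> m \<cdot> w = t"
proof -
  note [simp] = assms[THEN homD]
  let ?a = "pair C u v" and ?b = "pair C (ide W) (ide W)"
  have b: "monic C ?b"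
  proof (rule monicI)
    fix x y T assume "x \<in> hom C T (dom ?b)" "y \<in> hom C T (dom ?b)" "?b \<cdot> x = ?b \<cdot> y"
    thus "x = y" using pair_eqD(1)[of x x y y T W W] by auto
  qed auto
  let ?m = "pb1 C ?a ?b"
  have "?a \<cdot> ?m = ?b \<cdot> pb2 C ?a ?b" by (rule pb_comm) auto
  hence e: "pair C (u \<cdot> ?m) (v \<cdot> ?m) = pair C (pb2 C ?a ?b) (pb2 C ?a ?b)" by simp
  have 1: "u \<cdot> ?m = pb2 C ?a ?b" by (rule pair_eqD(1)[OF e, of "pbo ?a ?b" W W]) auto
  have 2: "v \<cdot> ?m = pb2 C ?a ?b" by (rule pair_eqD(2)[OF e, of "pbo ?a ?b" W W]) auto
  show thesis
  proof (rule that[of ?m])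
    show "monic C ?m" using b by (rule monic_pb1) auto
    show "u \<cdot> ?m = v \<cdot> ?m" using 1 2 by simp
    fix T t assume "t \<in> hom C T X" "u \<cdot> t = v \<cdot> t"
    thus "\<exists>w. w \<in> hom C T (pbo ?a ?b) \<and> ?m \<cdot> w = t"
      by (intro exI[of _ "pb_pair C ?a ?b t (u \<cdot> t)"]) auto
  qed auto
qed

text \<open>The equaliser of \<open>u\<close> and \<open>v\<close> contains both the section and the
  kernel, hence is an isomorphism by \<open>split_ext_strong\<close>.\<close>

lemma split_ext_epi:
  assumes "p \<in> hom C X B" "s \<in> hom C B X" "p \<cdot> s = ide B" and k: "is_kernel C p k"
    and uv: "u \<in> hom C X W" "v \<in> hom C X W" "u \<cdot> s = v \<cdot> s" "u \<cdot> k = v \<cdot> k"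
  shows "u = v"
proof -
  note [simp] = is_kernelD[OF k]
  obtain m where m: "monic C m" "cod m = X" "u \<cdot> m = v \<cdot> m"
    "\<And>T t. t \<in> hom C T X \<Longrightarrow> u \<cdot> t = v \<cdot> t \<Longrightarrow> \<exists>w. w \<in> hom C T (dom m) \<and> m \<cdot> w = t"
    using equaliser_monic[OF uv(1,2)] by metis
  obtain s' where s': "s' \<in> hom C B (dom m)" "m \<cdot> s' = s" using m(4)[OF assms(2) uv(3)] by blast
  have "k \<in> hom C (dom k) X" using assms(1) by auto
  from m(4)[OF this uv(4)] obtain k' where k': "k' \<in> hom C (dom k) (dom m)" "m \<cdot> k' = k" by blast
  have "iso C m" by (rule split_ext_strong[OF assms(1-3) k m(1,2) s' k'])
  thus ?thesis using m(2,3) uv(1,2) iso_epi by metis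
qed

section \<open>Pullbacks of split epimorphisms\<close>

lemma pb1_is_kernel:
  assumes "f \<in> hom C X Z" "g \<in> hom C Y Z" and k: "is_kernel C g k"
  shows "is_kernel C (pb1 C f g) (pb_pair C f g (zero C (dom k) X) k)"
proof -
  note [simp] = assms(1,2)[THEN homD]
  have kD [simp]: "arr k" "cod k = Y" "g \<cdot> k = zero C (dom k) Z" using is_kernelD[OF k] by auto
  have [simp]: "obj (dom k)" by (rule obj_dom) simp
  let ?k = "pb_pair C f g (zero C (dom k) X) k"
  show ?thesis
  proof (rule is_kernelI)
    show "monic C ?k"
    proof (rule monicI)
      fix u v T assume uv: "u \<in> hom C T (dom ?k)" "v \<in> hom C T (dom ?k)" "?k \<cdot> u = ?k \<cdot> v"
      have "k \<cdot> u = k \<cdot> v"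
        using arg_cong[OF uv(3), of "\<lambda>x. pb2 C f g \<cdot> x"] uv(1,2)[THEN homD] kD(3)[THEN reassoc] by simp
      thus "u = v" by (rule monicD[OF is_kernel_monic[OF k], of u v T]) (use uv in auto)
    qed simp
    fix T u assume u: "u \<in> hom C T (dom (pb1 C f g))" "pb1 C f g \<cdot> u = zero C T (cod (pb1 C f g))"
    have g0: "g \<cdot> (pb2 C f g \<cdot> u) = zero C T Z" using pb_comm'[of f g u] u by auto
    then obtain w where w: "w \<in> hom C T (dom k)" "k \<cdot> w = pb2 C f g \<cdot> u"
      using is_kernel_lift[OF k, of "pb2 C f g \<cdot> u" T] u by auto
    have "?k \<cdot> w = u" by (rule pb_ext[of _ T f g]) (use u w g0 in auto)
    thus "\<exists>w. w \<in> hom C T (dom ?k) \<and> ?k \<cdot> w = u" using w by (intro exI[of _ w]) auto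
  qed auto
qed

lemma pb1_kernel:
  assumes "f \<in> hom C X Z" "g \<in> hom C Y Z"
  shows "is_kernel C (pb1 C f g) (pb_pair C f g (zero C (dom (ker C g)) X) (ker C g))"
  using pb1_is_kernel[OF assms kernel] assms(2) by simp

text \<open>Writes the kernel of the first projection as a restriction of the inclusion of
  \<open>Y\<close>, so that statements about section and kernel turn into statements about the
  inclusions of \<open>X\<close> and \<open>Y\<close>.\<close>

lemma split_pb:
  assumes "f \<in> hom C X Z" "g \<in> hom C Y Z" "r \<in> hom C Z X" "f \<cdot> r = ide Z"
  shows "is_kernel C (pb1 C f g) (pb_pair C f g (r \<cdot> g) (ide Y) \<cdot> ker C g)"
proof -
  note [simp] = assms(1-3)[THEN homD] assms(4) assms(4)[THEN reassoc]
  have "pb_pair C f g (r \<cdot> g) (ide Y) \<cdot> ker C g = pb_pair C f g (zero C (dom (ker C g)) X) (ker C g)" by simp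
  thus ?thesis using pb1_kernel[OF assms(1,2)] by simp
qed

text \<open>The inclusion of \<open>X\<close> is a section of the first projection and the inclusion
  of \<open>Y\<close> contains its kernel, so a subobject containing both inclusions contains a
  section and a kernel.\<close>

lemma split_pb_strong:
  assumes "f \<in> hom C X Z" "g \<in> hom C Y Z" "r \<in> hom C Z X" "s \<in> hom C Z Y" "f \<cdot> r = ide Z" "g \<cdot> s = ide Z"
    and m: "monic C m" "cod m = pbo f g"
    and a: "a \<in> hom C X (dom m)" "m \<cdot> a = pb_pair C f g (ide X) (s \<cdot> f)"
    and b: "b \<in> hom C Y (dom m)" "m \<cdot> b = pb_pair C f g (r \<cdot> g) (ide Y)"
  shows "iso C m"
proof -
  note [simp] = assms(1-4)[THEN homD] assms(5,6) assms(5,6)[THEN reassoc] monic_arr[OF m(1)]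
  have *: "dom (pb_pair C f g (r \<cdot> g) (ide Y) \<cdot> ker C g) = dom (ker C g)" by simp
  show ?thesis
  proof (rule split_ext_strong[OF _ _ _ split_pb[OF assms(1-3,5)] m a])
    show "m \<cdot> (b \<cdot> ker C g) = pb_pair C f g (r \<cdot> g) (ide Y) \<cdot> ker C g"
      using reassoc[OF b(2)] b(1) m(2) by simp
  qed (use b * in auto)
qed

lemma split_pb_epi:
  assumes "f \<in> hom C X Z" "g \<in> hom C Y Z" "r \<in> hom C Z X" "s \<in> hom C Z Y" "f \<cdot> r = ide Z" "g \<cdot> s = ide Z"
    and uv: "u \<in> hom C (pbo f g) W" "v \<in> hom C (pbo f g) W"
      "u \<cdot> pb_pair C f g (ide X) (s \<cdot> f) = v \<cdot> pb_pair C f g (ide X) (s \<cdot> f)"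
      "u \<cdot> pb_pair C f g (r \<cdot> g) (ide Y) = v \<cdot> pb_pair C f g (r \<cdot> g) (ide Y)"
  shows "u = v"
proof -
  note [simp] = assms(1-4)[THEN homD] assms(5,6) assms(5,6)[THEN reassoc]
  have "(u \<cdot> pb_pair C f g (r \<cdot> g) (ide Y)) \<cdot> ker C g = (v \<cdot> pb_pair C f g (r \<cdot> g) (ide Y)) \<cdot> ker C g"
    using uv(4) by simp
  hence "u \<cdot> (pb_pair C f g (r \<cdot> g) (ide Y) \<cdot> ker C g) = v \<cdot> (pb_pair C f g (r \<cdot> g) (ide Y) \<cdot> ker C g)"
    using uv(1,2) by simp
  thus ?thesis
    using split_ext_epi[OF _ _ _ split_pb[OF assms(1-3,5)] uv(1-3)] by simp
qed

text \<open>\<open>\<Phi>\<close> and \<open>\<Psi>\<close> are natural expressions in generalised elements, that is, arrows out of the pullback.\<close>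

lemma split_pb_induct:
  assumes "f \<in> hom C X Z" "g \<in> hom C Y Z" "r \<in> hom C Z X" "s \<in> hom C Z Y" "f \<cdot> r = ide Z" "g \<cdot> s = ide Z"
    and nat: "\<And>T x y. x \<in> hom C T X \<Longrightarrow> y \<in> hom C T Y \<Longrightarrow> f \<cdot> x = g \<cdot> y \<Longrightarrow>
        \<Phi> x y \<in> hom C T W \<and> \<Psi> x y \<in> hom C T W \<and>
        (\<forall>S t. t \<in> hom C S T \<longrightarrow> \<Phi> (x \<cdot> t) (y \<cdot> t) = \<Phi> x y \<cdot> t \<and> \<Psi> (x \<cdot> t) (y \<cdot> t) = \<Psi> x y \<cdot> t)"
    and l: "\<Phi> (ide X) (s \<cdot> f) = \<Psi> (ide X) (s \<cdot> f)" and r: "\<Phi> (r \<cdot> g) (ide Y) = \<Psi> (r \<cdot> g) (ide Y)"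
    and xy: "x \<in> hom C T X" "y \<in> hom C T Y" "f \<cdot> x = g \<cdot> y"
  shows "\<Phi> x y = \<Psi> x y"
proof -
  note [simp] = assms(1-4)[THEN homD] assms(5,6) assms(5,6)[THEN reassoc]
  let ?p = "pb1 C f g" and ?q = "pb2 C f g"
  have n: "\<Phi> ?p ?q \<in> hom C (pbo f g) W \<and> \<Psi> ?p ?q \<in> hom C (pbo f g) W \<and>
    (\<forall>S t. t \<in> hom C S (pbo f g) \<longrightarrow> \<Phi> (?p \<cdot> t) (?q \<cdot> t) = \<Phi> ?p ?q \<cdot> t \<and> \<Psi> (?p \<cdot> t) (?q \<cdot> t) = \<Psi> ?p ?q \<cdot> t)"
    by (rule nat) (use pb_comm[of f g] in auto)
  have pq: "\<Phi> u v = \<Phi> ?p ?q \<cdot> pb_pair C f g u v \<and> \<Psi> u v = \<Psi> ?p ?q \<cdot> pb_pair C f g u v"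
    if "u \<in> hom C S X" "v \<in> hom C S Y" "f \<cdot> u = g \<cdot> v" for S u v
  proof -
    have "pb_pair C f g u v \<in> hom C S (pbo f g)" using that by auto
    moreover have "?p \<cdot> pb_pair C f g u v = u" "?q \<cdot> pb_pair C f g u v = v" using that by auto
    ultimately show ?thesis using n by metis
  qed
  have "\<Phi> ?p ?q = \<Psi> ?p ?q"
  proof (rule split_pb_epi[OF assms(1-6)])
    show "\<Phi> ?p ?q \<cdot> pb_pair C f g (ide X) (s \<cdot> f) = \<Psi> ?p ?q \<cdot> pb_pair C f g (ide X) (s \<cdot> f)"
      using pq[of "ide X" X "s \<cdot> f"] l by auto
    show "\<Phi> ?p ?q \<cdot> pb_pair C f g (r \<cdot> g) (ide Y) = \<Psi> ?p ?q \<cdot> pb_pair C f g (r \<cdot> g) (ide Y)"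
      using pq[of "r \<cdot> g" Y "ide Y"] r by auto
  qed (use n in auto)
  thus ?thesis using pq[OF xy] by simp
qed

section \<open>Coproducts, images and colimits\<close>

lemma coproduct:
  assumes "obj A" "obj B"
  shows "is_coproduct C A B (inl C A B) (inr C A B)"
proof -
  have "\<exists>z. case z of (i, j) \<Rightarrow> is_coproduct C A B i j"
    using coproducts assms by (auto simp: has_binary_coproducts_def)
  hence "case (SOME (i, j). is_coproduct C A B i j) of (i, j) \<Rightarrow> is_coproduct C A B i j"
    by (rule someI_ex)
  thus ?thesis by (simp add: inl_def inr_def case_prod_beta)
qed

lemma in_simps [simp]:
  assumes "obj A" "obj B"
  shows "arr (inl C A B)" "dom (inl C A B) = A" "cod (inl C A B) = coprod C A B"
    "arr (inr C A B)" "dom (inr C A B) = B" "cod (inr C A B) = coprod C A B" "obj (coprod C A B)"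
  using coproduct[OF assms] by (auto simp: is_coproduct_def coprod_def)

lemma copair:
  assumes "u \<in> hom C A T" "v \<in> hom C B T"
  shows "copair C u v \<in> hom C (coprod C A B) T \<and> copair C u v \<cdot> inl C A B = u \<and> copair C u v \<cdot> inr C A B = v"
proof -
  have "\<exists>!w. w \<in> hom C (coprod C A B) T \<and> w \<cdot> inl C A B = u \<and> w \<cdot> inr C A B = v"
    using coproduct[of A B] assms unfolding is_coproduct_def coprod_def by (metis homD)
  from theI'[OF this] show ?thesis using assms by (simp add: copair_def)
qed

lemma copair_simps [simp]:
  assumes "arr u" "arr v" "cod u = cod v"
  shows "arr (copair C u v)" "dom (copair C u v) = coprod C (dom u) (dom v)" "cod (copair C u v) = cod v"
  using copair[of u "dom u" "cod u" v "dom v"] assms by auto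

lemma copair_in [simp]:
  assumes "arr u" "arr v" "cod u = cod v" "A = dom u" "B = dom v"
  shows "copair C u v \<cdot> inl C A B = u" "copair C u v \<cdot> inr C A B = v"
  using copair[of u "dom u" "cod u" v "dom v"] assms by auto

lemma copair_in' [simp]:
  assumes "arr u" "arr v" "cod u = cod v" "A = dom u" "B = dom v" "arr t"
  shows "cod t = dom u \<Longrightarrow> copair C u v \<cdot> (inl C A B \<cdot> t) = u \<cdot> t"
    "cod t = dom v \<Longrightarrow> copair C u v \<cdot> (inr C A B \<cdot> t) = v \<cdot> t"
  using reassoc[OF copair_in(1)[OF assms(1-5)]] reassoc[OF copair_in(2)[OF assms(1-5)]] assms by auto

lemma coprod_ext:
  assumes "w \<in> hom C (coprod C A B) T" "w' \<in> hom C (coprod C A B) T" "obj A" "obj B"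
    "w \<cdot> inl C A B = w' \<cdot> inl C A B" "w \<cdot> inr C A B = w' \<cdot> inr C A B"
  shows "w = w'"
proof -
  have "w \<cdot> inl C A B \<in> hom C A T" "w \<cdot> inr C A B \<in> hom C B T" using assms by auto
  hence "\<exists>!z. z \<in> hom C (coprod C A B) T \<and> z \<cdot> inl C A B = w \<cdot> inl C A B \<and> z \<cdot> inr C A B = w \<cdot> inr C A B"
    using coproduct[OF assms(3,4)] unfolding is_coproduct_def coprod_def by blast
  thus ?thesis using assms by metis
qed

abbreviation retr :: "'o \<Rightarrow> 'o \<Rightarrow> 'a" where "retr A X \<equiv> copair C (ide A) (zero C X A)"

lemma comp_copair [simp]:
  assumes "arr u" "arr v" "cod u = cod v" "arr f" "dom f = cod v"
  shows "f \<cdot> copair C u v = copair C (f \<cdot> u) (f \<cdot> v)"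
  by (rule coprod_ext[of _ "dom u" "dom v" "cod f"]) (use assms in auto)

lemma comp_copair' [simp]:
  assumes "arr u" "arr v" "cod u = cod v" "arr f" "dom f = cod v" "arr t" "cod t = coprod C (dom u) (dom v)"
  shows "f \<cdot> (copair C u v \<cdot> t) = copair C (f \<cdot> u) (f \<cdot> v) \<cdot> t"
  using reassoc[OF comp_copair[OF assms(1-5)]] assms by auto

lemma copair_inl_inr [simp]:
  assumes "obj A" "obj B"
  shows "copair C (inl C A B) (inr C A B) = ide (coprod C A B)"
  by (rule coprod_ext[of _ A B "coprod C A B"]) (use assms in auto)

section \<open>Regular epimorphisms and image factorisations\<close>

lemma regular_epi_arr: "regular_epi C q \<Longrightarrow> arr q"
  by (auto simp: regular_epi_def is_coequaliser_def)

lemma is_coequaliserD: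
  assumes "is_coequaliser C f g q"
  shows "arr f" "arr g" "dom g = dom f" "cod g = cod f" "arr q" "dom q = cod f" "q \<cdot> f = q \<cdot> g" "regular_epi C q"
  using assms by (auto simp: is_coequaliser_def regular_epi_def)

lemma is_coequaliser_desc:
  assumes "is_coequaliser C f g q" "u \<in> hom C (cod f) T" "u \<cdot> f = u \<cdot> g"
  obtains w where "w \<in> hom C (cod q) T" "w \<cdot> q = u"
proof -
  have "\<exists>!w. w \<in> hom C (cod q) T \<and> w \<cdot> q = u"
    using assms unfolding is_coequaliser_def by blast
  thus thesis using that by blast
qed

lemma regular_epi_epi:
  assumes q: "regular_epi C q" and "u \<cdot> q = v \<cdot> q" "u \<in> hom C (cod q) W" "v \<in> hom C (cod q) W"
  shows "u = v"
proof -
  obtain f g where fg: "is_coequaliser C f g q" using q by (auto simp: regular_epi_def)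
  note [simp] = is_coequaliserD[OF fg]
  have "(u \<cdot> q) \<cdot> f = (u \<cdot> q) \<cdot> g" using assms(3) by simp
  moreover have "u \<cdot> q \<in> hom C (cod f) W" using assms(3) by simp
  ultimately have "\<exists>!w. w \<in> hom C (cod q) W \<and> w \<cdot> q = u \<cdot> q"
    using fg unfolding is_coequaliser_def by blast
  thus ?thesis using assms by metis
qed

lemma is_coequaliserI:
  assumes "f \<in> hom C X Y" "g \<in> hom C X Y" "q \<in> hom C Y (cod q)" "q \<cdot> f = q \<cdot> g"
    and "\<And>T u. u \<in> hom C Y T \<Longrightarrow> u \<cdot> f = u \<cdot> g \<Longrightarrow> \<exists>w. w \<in> hom C (cod q) T \<and> w \<cdot> q = u"
    and "\<And>T w w'. w \<in> hom C (cod q) T \<Longrightarrow> w' \<in> hom C (cod q) T \<Longrightarrow> w \<cdot> q = w' \<cdot> q \<Longrightarrow> w = w'"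
  shows "is_coequaliser C f g q"
  unfolding is_coequaliser_def
proof (intro conjI allI impI)
  fix T u assume "u \<in> hom C (cod f) T \<and> u \<cdot> f = u \<cdot> g"
  then obtain w where "w \<in> hom C (cod q) T \<and> w \<cdot> q = u" using assms(1,5) by auto
  thus "\<exists>!w. w \<in> hom C (cod q) T \<and> w \<cdot> q = u" using assms(6) by metis
qed (use assms in auto)

lemma regular_epi_desc:
  assumes q: "regular_epi C q" and u: "u \<in> hom C (dom q) W" "u \<cdot> pb1 C q q = u \<cdot> pb2 C q q"
  obtains w where "w \<in> hom C (cod q) W" "w \<cdot> q = u"
proof -
  obtain f g where fg: "is_coequaliser C f g q" using q by (auto simp: regular_epi_def)
  note [simp] = is_coequaliserD[OF fg]
  have "(u \<cdot> pb1 C q q) \<cdot> pb_pair C q q f g = (u \<cdot> pb2 C q q) \<cdot> pb_pair C q q f g" using u by simp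
  hence "u \<cdot> f = u \<cdot> g" using u(1) by simp
  thus thesis using is_coequaliser_desc[OF fg] u(1) that by auto
qed

lemma regular_epi_pb:
  assumes "regular_epi C f" "is_pullback C f g p q"
  shows "regular_epi C q"
  using regular assms unfolding regular_category_def by blast

lemma regular_epi_pb2:
  assumes "regular_epi C f" "arr g" "cod f = cod g"
  shows "regular_epi C (pb2 C f g)"
  using regular_epi_pb[OF assms(1) pullback] regular_epi_arr assms by blast

lemma image_factor:
  assumes "f \<in> hom C X Y"
  obtains e m where "regular_epi C e" "e \<in> hom C X (dom m)" "monic C m" "cod m = Y" "m \<cdot> e = f"
proof -
  note [simp] = assms[THEN homD]
  have "is_pullback C f f (pb1 C f f) (pb2 C f f)" by (rule pullback) auto
  then obtain e where e: "is_coequaliser C (pb1 C f f) (pb2 C f f) e"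
    using regular unfolding regular_category_def by blast
  note re = is_coequaliserD(8)[OF e]
  note [simp] = is_coequaliserD[OF e]
  have "f \<cdot> pb1 C f f = f \<cdot> pb2 C f f" by (rule pb_comm) auto
  then obtain m where m: "m \<in> hom C (cod e) Y" "m \<cdot> e = f" using is_coequaliser_desc[OF e, of f Y] by auto
  note [simp] = m(1)[THEN homD]
  note m2 [simp] = m(2) m(2)[THEN reassoc]
  have "monic C m"
  proof (rule monicI)
    fix u v T assume uv: "u \<in> hom C T (dom m)" "v \<in> hom C T (dom m)" "m \<cdot> u = m \<cdot> v"
    note [simp] = uv(1,2)[THEN homD]
    \<comment> \<open>After the regular epimorphic covers \<open>?t\<close> and \<open>?s\<close>,
      both \<open>u\<close> and \<open>v\<close> lift along \<open>e\<close>. The lifts agree under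
      \<open>f\<close>, so they factor through its kernel pair, which \<open>e\<close>
      coequalises.\<close>
    let ?t = "pb2 C e u" and ?x = "pb1 C e u"
    have t: "regular_epi C ?t" by (rule regular_epi_pb2[OF re]) auto
    let ?s = "pb2 C e (v \<cdot> ?t)" and ?y = "pb1 C e (v \<cdot> ?t)"
    have s: "regular_epi C ?s" by (rule regular_epi_pb2[OF re]) auto
    have ex: "e \<cdot> ?x = u \<cdot> ?t" and ey: "e \<cdot> ?y = (v \<cdot> ?t) \<cdot> ?s" by (rule pb_comm; simp)+
    have ey': "e \<cdot> ?y = v \<cdot> (?t \<cdot> ?s)" using ey by simp
    have ex': "e \<cdot> (?x \<cdot> ?s) = u \<cdot> (?t \<cdot> ?s)" using ex[THEN reassoc, of ?s] by simp
    have "f \<cdot> (?x \<cdot> ?s) = m \<cdot> (u \<cdot> (?t \<cdot> ?s))" using m(2)[THEN reassoc, of "?x \<cdot> ?s"] ex' by simp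
    also have "\<dots> = m \<cdot> (v \<cdot> (?t \<cdot> ?s))" using uv(3)[THEN reassoc, of "?t \<cdot> ?s"] by simp
    also have "\<dots> = f \<cdot> ?y" using m(2)[THEN reassoc, of "?y"] ey' by simp
    finally have fe: "f \<cdot> (?x \<cdot> ?s) = f \<cdot> ?y" .
    have "e \<cdot> (pb1 C f f \<cdot> pb_pair C f f (?x \<cdot> ?s) ?y) = e \<cdot> (pb2 C f f \<cdot> pb_pair C f f (?x \<cdot> ?s) ?y)"
      using is_coequaliserD(7)[OF e, THEN reassoc, of "pb_pair C f f (?x \<cdot> ?s) ?y"] fe by simp
    hence "(u \<cdot> ?t) \<cdot> ?s = (v \<cdot> ?t) \<cdot> ?s" using fe ex' ey' by simp
    hence "u \<cdot> ?t = v \<cdot> ?t" by (rule regular_epi_epi[OF s, of _ _ "dom m"]) auto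
    thus "u = v" by (rule regular_epi_epi[OF t, of _ _ "dom m"]) auto
  qed simp
  thus thesis using that[of e m] re m by simp
qed

text \<open>Regular epimorphisms are cokernels of their kernels: on the kernel pair, the diagonal
  and the kernel of the first projection are jointly epic, and \<open>u\<close> equalises the
  projections on both.\<close>

lemma regular_epi_desc0:
  assumes f: "regular_epi C f" and u: "u \<in> hom C (dom f) W" "u \<cdot> ker C f = zero C (dom (ker C f)) W"
  obtains w where "w \<in> hom C (cod f) W" "w \<cdot> f = u"
proof -
  note [simp] = regular_epi_arr[OF f] u(1)[THEN homD]
  have "u \<cdot> pb1 C f f = u \<cdot> pb2 C f f"
  proof (rule split_ext_epi[OF _ _ _ pb1_kernel])
    show "pb1 C f f \<in> hom C (pbo f f) (dom f)" "pb_pair C f f (ide (dom f)) (ide (dom f)) \<in> hom C (dom f) (pbo f f)"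
      "pb1 C f f \<cdot> pb_pair C f f (ide (dom f)) (ide (dom f)) = ide (dom f)" by auto
  qed (use u in auto)
  thus thesis using regular_epi_desc[OF f u(1)] that by blast
qed

text \<open>The mono part of the image factorisation is invertible by assumption, so
  \<open>f\<close> inherits the coequaliser property of the regular epi part.\<close>

lemma extremal_regular:
  assumes "arr f" and "\<And>m e. monic C m \<Longrightarrow> cod m = cod f \<Longrightarrow> e \<in> hom C (dom f) (dom m) \<Longrightarrow> m \<cdot> e = f \<Longrightarrow> iso C m"
  shows "regular_epi C f"
proof -
  obtain e m where em: "regular_epi C e" "e \<in> hom C (dom f) (dom m)" "monic C m" "cod m = cod f" "m \<cdot> e = f"
    using image_factor[of f "dom f" "cod f"] assms(1) by auto
  have "iso C m" using assms(2) em by blast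
  then obtain n where n: "n \<in> hom C (cod m) (dom m)" "n \<cdot> m = ide (dom m)" "m \<cdot> n = ide (cod m)" "arr m"
    by (rule isoE)
  obtain x y where xy: "is_coequaliser C x y e" using em(1) by (auto simp: regular_epi_def)
  have [simp]: "cod x = dom f" using is_coequaliserD(6)[OF xy] em(2)[THEN homD] by metis
  note [simp] = is_coequaliserD(1-5)[OF xy] assms(1) n(1)[THEN homD] n(2-4) n(2,3)[THEN reassoc] em(2)[THEN homD] em(4)
  have nf [simp]: "n \<cdot> f = e" using em(5) n(2)[THEN reassoc, of e] by simp
  have "is_coequaliser C x y f"
  proof (rule is_coequaliserI[of x "dom x" "dom f" y])
    show "f \<cdot> x = f \<cdot> y"
      using em(5)[THEN reassoc, of x] em(5)[THEN reassoc, of y] is_coequaliserD(7)[OF xy] by simp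
    fix T u assume u: "u \<in> hom C (dom f) T" "u \<cdot> x = u \<cdot> y"
    then obtain w where w: "w \<in> hom C (cod e) T" "w \<cdot> e = u" using is_coequaliser_desc[OF xy, of u T] by auto
    thus "\<exists>w. w \<in> hom C (cod f) T \<and> w \<cdot> f = u" by (intro exI[of _ "w \<cdot> n"]) auto
  next
    fix T w w' assume w: "w \<in> hom C (cod f) T" "w' \<in> hom C (cod f) T" "w \<cdot> f = w' \<cdot> f"
    hence "(w \<cdot> m) \<cdot> e = (w' \<cdot> m) \<cdot> e" using em(5) by simp
    hence "w \<cdot> m = w' \<cdot> m" by (rule regular_epi_epi[OF em(1), of _ _ T]) (use w in auto)
    thus "w = w'" by (rule iso_epi[OF \<open>iso C m\<close>, of _ _ T]) (use w in auto)
  qed auto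
  thus ?thesis by (auto simp: regular_epi_def)
qed

text \<open>A subobject through which the copairing factors contains section and kernel;
  \<open>split_ext_strong\<close> makes it invertible, so the copairing is extremal.\<close>

lemma split_ext_regular:
  assumes "p \<in> hom C X B" "s \<in> hom C B X" "p \<cdot> s = ide B" and k: "is_kernel C p k"
  shows "regular_epi C (copair C s k)"
proof -
  note [simp] = assms(1,2)[THEN homD] is_kernelD[OF k]
  have [simp]: "obj (dom k)" by (rule obj_dom) simp
  show ?thesis
  proof (rule extremal_regular)
    fix m e assume m: "monic C m" "cod m = cod (copair C s k)" "e \<in> hom C (dom (copair C s k)) (dom m)" "m \<cdot> e = copair C s k"
    note [simp] = monic_arr[OF m(1)] m(3)[THEN homD] m(4)[THEN reassoc]
    show "iso C m"
      by (rule split_ext_strong[OF assms m(1), of "e \<cdot> inl C B (dom k)" "e \<cdot> inr C B (dom k)"]) (use m(2) in auto)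
  qed auto
qed

text \<open>This is the Mal'tsev property. Triples (a, b, c) as in the assumptions form a pullback
  of split epimorphisms, and by \<open>split_pb_strong\<close> it suffices to treat b = c, where a
  itself is the answer, and a = b, where c is.\<close>

lemma difunctional:
  assumes r: "r1 \<in> hom C R X" "r2 \<in> hom C R X" "monic C (pair C r1 r2)"
    and abc: "a \<in> hom C T R" "b \<in> hom C T R" "c \<in> hom C T R" "r2 \<cdot> a = r2 \<cdot> b" "r1 \<cdot> b = r1 \<cdot> c"
  obtains w where "w \<in> hom C T R" "r1 \<cdot> w = r1 \<cdot> a" "r2 \<cdot> w = r2 \<cdot> c"
proof -
  note [simp] = r(1,2)[THEN homD] abc(1-3)[THEN homD]
  let ?f = "pb2 C r2 r2" and ?g = "pb1 C r1 r1"
  let ?d2 = "pb_pair C r2 r2 (ide R) (ide R)" and ?d1 = "pb_pair C r1 r1 (ide R) (ide R)"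
  let ?p = "pair C (r1 \<cdot> (pb1 C r2 r2 \<cdot> pb1 C ?f ?g)) (r2 \<cdot> (pb2 C r1 r1 \<cdot> pb2 C ?f ?g))"
  \<comment> \<open>The subobject of those triples (a, b, c) for which the pair (r1 a, r2 c) belongs
    to the relation.\<close>
  let ?m = "pb1 C ?p (pair C r1 r2)"
  have c2: "r2 \<cdot> (pb1 C r2 r2 \<cdot> t) = r2 \<cdot> (pb2 C r2 r2 \<cdot> t)" if "arr t" "cod t = pbo r2 r2" for t
    using pb_comm'[of r2 r2 t] that by simp
  have c1: "r1 \<cdot> (pb1 C r1 r1 \<cdot> t) = r1 \<cdot> (pb2 C r1 r1 \<cdot> t)" if "arr t" "cod t = pbo r1 r1" for t
    using pb_comm'[of r1 r1 t] that by simp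
  have cc: "r2 \<cdot> pb1 C r2 r2 = r2 \<cdot> pb2 C r2 r2" "r1 \<cdot> pb1 C r1 r1 = r1 \<cdot> pb2 C r1 r1" by (rule pb_comm; simp)+
  have m: "monic C ?m" by (rule monic_pb1[OF r(3)]) auto
  have "iso C ?m"
  proof (rule split_pb_strong[of ?f "pbo r2 r2" R ?g "pbo r1 r1" ?d2 ?d1 ?m
          "pb_pair C ?p (pair C r1 r2) (pb_pair C ?f ?g (ide (pbo r2 r2)) (?d1 \<cdot> ?f)) (pb1 C r2 r2)"
          "pb_pair C ?p (pair C r1 r2) (pb_pair C ?f ?g (?d2 \<cdot> ?g) (ide (pbo r1 r1))) (pb2 C r1 r1)"])
    show "monic C ?m" by (rule m)
  qed (auto simp: c1 c2 cc)
  then obtain n where n: "n \<in> hom C (cod ?m) (dom ?m)" "?m \<cdot> n = ide (cod ?m)" by (rule isoE)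
  define m q p where "m = ?m" and "q = pb2 C ?p (pair C r1 r2)" and "p = ?p"
  have mp: "arr m" "arr q" "arr p" "cod m = pbo ?f ?g" "dom q = dom m" "cod q = R" "dom p = pbo ?f ?g" "cod p = prd X X"
    "p \<cdot> m = pair C r1 r2 \<cdot> q"
    unfolding m_def q_def p_def using pb_comm[of ?p "pair C r1 r2"] by simp_all
  have n': "n \<in> hom C (pbo ?f ?g) (dom m)" "m \<cdot> n = ide (pbo ?f ?g)"
    using n mp(4) unfolding m_def by simp_all
  note [simp] = mp(1-8) n'(1)[THEN homD]
  have "p \<cdot> (m \<cdot> n) = pair C r1 r2 \<cdot> (q \<cdot> n)" using mp(9)[THEN reassoc, of n] by simp
  hence e: "pair C (r1 \<cdot> (q \<cdot> n)) (r2 \<cdot> (q \<cdot> n)) = ?p" using n'(2) by (simp add: p_def)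
  have e1: "r1 \<cdot> (q \<cdot> n) = r1 \<cdot> (pb1 C r2 r2 \<cdot> pb1 C ?f ?g)" by (rule pair_eqD(1)[OF e, of "pbo ?f ?g" X X]) auto
  have e2: "r2 \<cdot> (q \<cdot> n) = r2 \<cdot> (pb2 C r1 r1 \<cdot> pb2 C ?f ?g)" by (rule pair_eqD(2)[OF e, of "pbo ?f ?g" X X]) auto
  define t where "t = pb_pair C ?f ?g (pb_pair C r2 r2 a b) (pb_pair C r1 r1 b c)"
  have t: "arr t" "dom t = T" "cod t = pbo ?f ?g"
    "pb1 C r2 r2 \<cdot> (pb1 C ?f ?g \<cdot> t) = a" "pb2 C r1 r1 \<cdot> (pb2 C ?f ?g \<cdot> t) = c"
    unfolding t_def using abc by simp_all
  have "r1 \<cdot> (q \<cdot> (n \<cdot> t)) = r1 \<cdot> a" using e1[THEN reassoc, of t] t by simp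
  moreover have "r2 \<cdot> (q \<cdot> (n \<cdot> t)) = r2 \<cdot> c" using e2[THEN reassoc, of t] t by simp
  ultimately show thesis using that[of "q \<cdot> (n \<cdot> t)"] t by simp
qed

text \<open>Writing 1 for the diagonal \<open>d\<close>, symmetry is difunctionality for the triple
  (1, r, 1) and transitivity is difunctionality for (p, 1, q).\<close>

lemma reflexive_equivalence:
  assumes r: "r1 \<in> hom C R X" "r2 \<in> hom C R X" "monic C (pair C r1 r2)"
    and d: "d \<in> hom C X R" "r1 \<cdot> d = ide X" "r2 \<cdot> d = ide X"
  shows "equivalence_relation C X r1 r2"
proof -
  note [simp] = r(1,2)[THEN homD] d(1)[THEN homD] d(2,3) d(2,3)[THEN reassoc]
  obtain s where s: "s \<in> hom C R R" "r1 \<cdot> s = r2" "r2 \<cdot> s = r1"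
    using difunctional[OF r, of "d \<cdot> r2" R "ide R" "d \<cdot> r1"] by auto
  let ?p = "pb1 C r2 r1" and ?q = "pb2 C r2 r1"
  have pq: "r2 \<cdot> ?p = r1 \<cdot> ?q" by (rule pb_comm) auto
  obtain t where t: "t \<in> hom C (dom ?p) R" "r1 \<cdot> t = r1 \<cdot> ?p" "r2 \<cdot> t = r2 \<cdot> ?q"
    using difunctional[OF r, of ?p "dom ?p" "d \<cdot> (r2 \<cdot> ?p)" ?q] pq by auto
  have 1: "\<exists>s\<in>hom C (dom r1) (dom r1). r1 \<cdot> s = r2 \<and> r2 \<cdot> s = r1" using s by auto
  have 2: "\<exists>p q t. is_pullback C r2 r1 p q \<and> t \<in> hom C (dom p) (dom r1) \<and> r1 \<cdot> t = r1 \<cdot> p \<and> r2 \<cdot> t = r2 \<cdot> q"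
    using t pullback[of r2 r1] by (intro exI[of _ ?p] exI[of _ ?q] exI[of _ t]) auto
  have 3: "u = v" if "u \<in> hom C T (dom r1)" "v \<in> hom C T (dom r1)" "r1 \<cdot> u = r1 \<cdot> v" "r2 \<cdot> u = r2 \<cdot> v" for T u v
    by (rule monicD[OF r(3), of u v T]) (use that in auto)
  have 4: "\<exists>d\<in>hom C X (dom r1). r1 \<cdot> d = ide X \<and> r2 \<cdot> d = ide X"
    by (rule bexI[of _ d]) simp_all
  have 5: "r1 \<in> hom C (dom r1) X" "r2 \<in> hom C (dom r1) X" by simp_all
  show ?thesis
    unfolding equivalence_relation_def using 1 2 3 4 5 by blast
qed

text \<open>
  In a protomodular category reflexive relations are equivalence relations, so the image of a
  reflexive pair is already the kernel pair of its coequaliser.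
\<close>

lemma reflexive_pair:
  assumes fg: "f \<in> hom C X Y" "g \<in> hom C X Y" and s: "s \<in> hom C Y X" "f \<cdot> s = ide Y" "g \<cdot> s = ide Y"
  obtains e r1 r2 R c where "regular_epi C e" "e \<in> hom C X R" "r1 \<in> hom C R Y" "r2 \<in> hom C R Y"
    "r1 \<cdot> e = f" "r2 \<cdot> e = g" "is_coequaliser C f g c" "is_pullback C c c r1 r2"
proof -
  note [simp] = fg[THEN homD] s(1)[THEN homD] s(2,3) s(2,3)[THEN reassoc]
  obtain e m where em: "regular_epi C e" "e \<in> hom C X (dom m)" "monic C m" "cod m = prd Y Y" "m \<cdot> e = pair C f g"
    using image_factor[of "pair C f g" X "prd Y Y"] by auto
  note [simp] = monic_arr[OF em(3)] em(2)[THEN homD] em(4) em(5)[THEN reassoc]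
  define r1 r2 where "r1 = proj1 C Y Y \<cdot> m" and "r2 = proj2 C Y Y \<cdot> m"
  have r [simp]: "arr r1" "dom r1 = dom m" "cod r1 = Y" "arr r2" "dom r2 = dom m" "cod r2 = Y"
    unfolding r1_def r2_def by simp_all
  have re: "r1 \<cdot> e = f" "r2 \<cdot> e = g" unfolding r1_def r2_def using em(5) by auto
  have "pair C r1 r2 = m" unfolding r1_def r2_def by (rule prod_ext[of _ "dom m" Y Y]) auto
  hence "equivalence_relation C Y r1 r2"
    using em(3) by (intro reflexive_equivalence[of r1 "dom m" Y r2 "e \<cdot> s"]) (auto simp: re[THEN reassoc])
  then obtain h where h: "is_pullback C h h r1 r2" using exact unfolding barr_exact_def by blast
  then obtain c where c: "is_coequaliser C r1 r2 c" using regular unfolding regular_category_def by blast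
  note [simp] = is_coequaliserD(5,8)[OF c]
  have [simp]: "dom c = Y" using is_coequaliserD(6)[OF c] by simp
  have r12: "c \<cdot> r1 = c \<cdot> r2" by (rule is_coequaliserD(7)[OF c])
  note hD = is_pullbackD[OF h]
  have [simp]: "arr h" "dom h = Y" using hD(1,7) by auto
  have "h \<cdot> r1 = h \<cdot> r2" using hD by simp
  \<comment> \<open>As \<open>h\<close> factors through \<open>c\<close>, whatever \<open>c\<close>
    identifies is identified by \<open>h\<close>; the kernel pair of \<open>h\<close> is therefore
    also that of \<open>c\<close>.\<close>
  then obtain w where w: "w \<in> hom C (cod c) (cod h)" "w \<cdot> c = h" using is_coequaliser_desc[OF c, of h "cod h"] by auto
  note [simp] = w(1)[THEN homD]
  have cf: "is_coequaliser C f g c"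
  proof (rule is_coequaliserI[OF fg])
    show "c \<cdot> f = c \<cdot> g" using r12[THEN reassoc, of e] re by simp
    fix T u assume u: "u \<in> hom C Y T" "u \<cdot> f = u \<cdot> g"
    note [simp] = u(1)[THEN homD]
    have "(u \<cdot> r1) \<cdot> e = (u \<cdot> r2) \<cdot> e" using u re by simp
    hence "u \<cdot> r1 = u \<cdot> r2" by (rule regular_epi_epi[OF em(1), of _ _ T]) auto
    thus "\<exists>w. w \<in> hom C (cod c) T \<and> w \<cdot> c = u" using is_coequaliser_desc[OF c, of u T] by auto
  next
    fix T w w' assume "w \<in> hom C (cod c) T" "w' \<in> hom C (cod c) T" "w \<cdot> c = w' \<cdot> c"
    thus "w = w'" using regular_epi_epi[OF is_coequaliserD(8)[OF c]] by blast
  qed auto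
  have "is_pullback C c c r1 r2"
  proof (rule is_pullbackI[where V = "dom m"])
    fix T u v assume uv: "u \<in> hom C T (dom c)" "v \<in> hom C T (dom c)" "c \<cdot> u = c \<cdot> v"
    note [simp] = uv(1,2)[THEN homD]
    have "h \<cdot> u = h \<cdot> v" using w(2)[THEN reassoc, of u] w(2)[THEN reassoc, of v] uv(3) by simp
    thus "\<exists>w. w \<in> hom C T (dom m) \<and> r1 \<cdot> w = u \<and> r2 \<cdot> w = v"
      using is_pullback_lift[OF h, of u T v] by auto
  next
    fix T w w' assume "w \<in> hom C T (dom m)" "w' \<in> hom C T (dom m)" "r1 \<cdot> w = r1 \<cdot> w'" "r2 \<cdot> w = r2 \<cdot> w'"
    thus "w = w'" using is_pullback_ext[OF h, of w T w'] by simp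
  qed (use r12 in auto)
  thus thesis using that[OF em(1,2) _ _ re cf] by simp
qed

section \<open>Coequalisers, cokernels and pushouts\<close>

lemma coequaliser_exists:
  assumes "f \<in> hom C X Y" "g \<in> hom C X Y"
  obtains c where "is_coequaliser C f g c"
proof -
  note [simp] = assms[THEN homD]
  \<comment> \<open>Adjoining the identity of \<open>Y\<close> makes the pair reflexive, with common
    section \<open>inr\<close>, and does not change which arrows coequalise it.\<close>
  let ?f = "copair C f (ide Y)" and ?g = "copair C g (ide Y)"
  obtain c where c: "is_coequaliser C ?f ?g c"
    using reflexive_pair[of ?f "coprod C X Y" Y ?g "inr C X Y"] by auto
  note [simp] = is_coequaliserD(5)[OF c]
  have [simp]: "dom c = Y" using is_coequaliserD(6)[OF c] by simp
  have eq: "u \<cdot> ?f = u \<cdot> ?g \<longleftrightarrow> u \<cdot> f = u \<cdot> g" if "u \<in> hom C Y T" for u T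
  proof
    assume "u \<cdot> ?f = u \<cdot> ?g"
    hence "(u \<cdot> ?f) \<cdot> inl C X Y = (u \<cdot> ?g) \<cdot> inl C X Y" by simp
    thus "u \<cdot> f = u \<cdot> g" using that by simp
  qed (use that in simp)
  have "is_coequaliser C f g c"
  proof (rule is_coequaliserI[OF assms])
    show "c \<cdot> f = c \<cdot> g" using eq[of c "cod c"] is_coequaliserD(7)[OF c] by simp
    fix T u assume u: "u \<in> hom C Y T" "u \<cdot> f = u \<cdot> g"
    thus "\<exists>w. w \<in> hom C (cod c) T \<and> w \<cdot> c = u" using is_coequaliser_desc[OF c, of u T] eq[OF u(1)] by auto
  next
    fix T w w' assume "w \<in> hom C (cod c) T" "w' \<in> hom C (cod c) T" "w \<cdot> c = w' \<cdot> c"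
    thus "w = w'" using regular_epi_epi[OF is_coequaliserD(8)[OF c]] by blast
  qed auto
  thus thesis by (rule that)
qed

lemma cokernel:
  assumes "f \<in> hom C X Y"
  shows "is_cokernel C f (coker C f)" "regular_epi C (coker C f)"
proof -
  note [simp] = assms[THEN homD]
  have fXY: "dom f = X" "cod f = Y" by simp_all
  \<comment> \<open>Stated for every cokernel because regularity is claimed for the representative
    that \<open>coker\<close> chooses.\<close>
  have coeq: "is_coequaliser C f (zero C X Y) c" if c: "is_cokernel C f c" for c
  proof -
    have cD: "arr c" "dom c = Y" "c \<cdot> f = zero C X (cod c)" using c by (auto simp: is_cokernel_def)
    have un: "\<exists>!w. w \<in> hom C (cod c) T \<and> w \<cdot> c = u" if "u \<in> hom C Y T" "u \<cdot> f = zero C X T" for u T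
      using c that unfolding is_cokernel_def fXY by blast
    note [simp] = cD(1,2)
    show ?thesis
    proof (rule is_coequaliserI[OF assms])
      fix T u assume u: "u \<in> hom C Y T" "u \<cdot> f = u \<cdot> zero C X Y"
      have "u \<cdot> f = zero C X T" using u by simp
      from un[OF u(1) this] show "\<exists>w. w \<in> hom C (cod c) T \<and> w \<cdot> c = u" by blast
    next
      fix T w w' assume w: "w \<in> hom C (cod c) T" "w' \<in> hom C (cod c) T" "w \<cdot> c = w' \<cdot> c"
      have "w \<cdot> c \<in> hom C Y T" "(w \<cdot> c) \<cdot> f = zero C X T" using w cD by auto
      from un[OF this] show "w = w'" using w by metis
    qed (use cD in auto)
  qed
  obtain c where c: "is_coequaliser C f (zero C X Y) c"
    using coequaliser_exists[of f X Y "zero C X Y"] by auto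
  have "is_cokernel C f c"
    unfolding is_cokernel_def
  proof (intro conjI allI impI)
    note cD = is_coequaliserD[OF c]
    show "c \<in> hom C (cod f) (cod c)" "c \<cdot> f = zero C (dom f) (cod c)" using cD by auto
    fix T u assume u: "u \<in> hom C (cod f) T \<and> u \<cdot> f = zero C (dom f) T"
    hence "u \<cdot> f = u \<cdot> zero C X Y" by auto
    thus "\<exists>!w. w \<in> hom C (cod c) T \<and> w \<cdot> c = u" using c u unfolding is_coequaliser_def by blast
  qed simp
  hence k: "is_cokernel C f (coker C f)" unfolding coker_def by (rule someI)
  thus "is_cokernel C f (coker C f)" .
  show "regular_epi C (coker C f)" using is_coequaliserD(8)[OF coeq[OF k]] .
qed

lemma coker_simps [simp]:
  assumes "arr f"
  shows "arr (coker C f)" "dom (coker C f) = cod f" "coker C f \<cdot> f = zero C (dom f) (cod (coker C f))"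
  using cokernel(1)[of f "dom f" "cod f"] assms by (auto simp: is_cokernel_def)

lemma coker_desc:
  assumes "f \<in> hom C X Y" "u \<in> hom C Y T" "u \<cdot> f = zero C X T"
  obtains w where "w \<in> hom C (cod (coker C f)) T" "w \<cdot> coker C f = u"
proof -
  have "\<exists>!w. w \<in> hom C (cod (coker C f)) T \<and> w \<cdot> coker C f = u"
    using cokernel(1)[OF assms(1)] assms(2,3) assms(1)[THEN homD] unfolding is_cokernel_def by metis
  thus thesis using that by blast
qed

lemma pushout:
  assumes "arr f" "arr g" "dom f = dom g"
  shows "is_pushout C f g (po1 C f g) (po2 C f g)"
proof -
  note [simp] = assms
  let ?i = "inl C (cod f) (cod g)" and ?j = "inr C (cod f) (cod g)"
  obtain c where c: "is_coequaliser C (?i \<cdot> f) (?j \<cdot> g) c"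
    using coequaliser_exists[of "?i \<cdot> f" "dom g" "coprod C (cod f) (cod g)" "?j \<cdot> g"] by auto
  note [simp] = is_coequaliserD(5)[OF c]
  have [simp]: "dom c = coprod C (cod f) (cod g)" using is_coequaliserD(6)[OF c] by simp
  have "is_pushout C f g (c \<cdot> ?i) (c \<cdot> ?j)"
    unfolding is_pushout_def
  proof (intro conjI allI impI)
    show "(c \<cdot> ?i) \<cdot> f = (c \<cdot> ?j) \<cdot> g" using is_coequaliserD(7)[OF c] by simp
    fix T u v assume uv: "u \<in> hom C (cod f) T \<and> v \<in> hom C (cod g) T \<and> u \<cdot> f = v \<cdot> g"
    hence "copair C u v \<cdot> (?i \<cdot> f) = copair C u v \<cdot> (?j \<cdot> g)" by simp
    then obtain w where w: "w \<in> hom C (cod c) T" "w \<cdot> c = copair C u v"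
      using is_coequaliser_desc[OF c, of "copair C u v" T] uv by auto
    note [simp] = w(2)[THEN reassoc]
    show "\<exists>!w. w \<in> hom C (cod (c \<cdot> ?i)) T \<and> w \<cdot> (c \<cdot> ?i) = u \<and> w \<cdot> (c \<cdot> ?j) = v"
    proof (rule ex1I)
      show "w \<in> hom C (cod (c \<cdot> ?i)) T \<and> w \<cdot> (c \<cdot> ?i) = u \<and> w \<cdot> (c \<cdot> ?j) = v" using uv w by auto
      fix z assume z: "z \<in> hom C (cod (c \<cdot> ?i)) T \<and> z \<cdot> (c \<cdot> ?i) = u \<and> z \<cdot> (c \<cdot> ?j) = v"
      hence "z \<cdot> c = w \<cdot> c"
        by (intro coprod_ext[of "z \<cdot> c" "cod f" "cod g" T "w \<cdot> c"]) (use w uv in auto)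
      thus "z = w" by (rule regular_epi_epi[OF is_coequaliserD(8)[OF c], of _ _ T]) (use z w in auto)
    qed
  qed auto
  hence "\<exists>z. case z of (i, j) \<Rightarrow> is_pushout C f g i j" by auto
  hence "case (SOME (i, j). is_pushout C f g i j) of (i, j) \<Rightarrow> is_pushout C f g i j"
    by (rule someI_ex)
  thus ?thesis by (simp add: po1_def po2_def case_prod_beta)
qed

abbreviation poo :: "'a \<Rightarrow> 'a \<Rightarrow> 'o" where "poo f g \<equiv> cod (po1 C f g)"

lemma po_simps [simp]:
  assumes "arr f" "arr g" "dom f = dom g"
  shows "arr (po1 C f g)" "dom (po1 C f g) = cod f" "arr (po2 C f g)" "dom (po2 C f g) = cod g"
    "cod (po2 C f g) = poo f g"
  using pushout[OF assms] by (auto simp: is_pushout_def)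

lemma po_comm:
  assumes "arr f" "arr g" "dom f = dom g"
  shows "po1 C f g \<cdot> f = po2 C f g \<cdot> g"
  using pushout[OF assms] by (auto simp: is_pushout_def)

lemma po_copair:
  assumes "arr f" "arr g" "dom f = dom g" "u \<in> hom C (cod f) T" "v \<in> hom C (cod g) T" "u \<cdot> f = v \<cdot> g"
  shows "po_copair C f g u v \<in> hom C (poo f g) T \<and> po_copair C f g u v \<cdot> po1 C f g = u \<and> po_copair C f g u v \<cdot> po2 C f g = v"
proof -
  have "\<exists>!w. w \<in> hom C (poo f g) T \<and> w \<cdot> po1 C f g = u \<and> w \<cdot> po2 C f g = v"
    using pushout[OF assms(1-3)] assms(4-) unfolding is_pushout_def by blast
  from theI'[OF this] show ?thesis using assms(4) by (simp add: po_copair_def)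
qed

lemma po_ext:
  assumes "arr f" "arr g" "dom f = dom g" "w \<in> hom C (poo f g) T" "w' \<in> hom C (poo f g) T"
    "w \<cdot> po1 C f g = w' \<cdot> po1 C f g" "w \<cdot> po2 C f g = w' \<cdot> po2 C f g"
  shows "w = w'"
proof -
  note [simp] = assms(1-3)
  have "w \<cdot> po1 C f g \<in> hom C (cod f) T" "w \<cdot> po2 C f g \<in> hom C (cod g) T" "(w \<cdot> po1 C f g) \<cdot> f = (w \<cdot> po2 C f g) \<cdot> g"
    using assms(4) po_comm[OF assms(1-3)] by auto
  hence "\<exists>!z. z \<in> hom C (poo f g) T \<and> z \<cdot> po1 C f g = w \<cdot> po1 C f g \<and> z \<cdot> po2 C f g = w \<cdot> po2 C f g"
    using pushout[OF assms(1-3)] unfolding is_pushout_def by blast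
  thus ?thesis using assms(4-) by metis
qed

section \<open>Images, joins and normal closures\<close>

lemma image:
  assumes "arr f" shows "is_image C f (image_of C f)"
proof -
  obtain e m where "regular_epi C e" "e \<in> hom C (dom f) (dom m)" "monic C m" "cod m = cod f" "m \<cdot> e = f"
    using image_factor[of f "dom f" "cod f"] assms by auto
  hence "is_image C f m" unfolding is_image_def by blast
  thus ?thesis unfolding image_of_def by (rule someI)
qed

lemma imageE:
  assumes "f \<in> hom C X Y"
  obtains e where "regular_epi C e" "e \<in> hom C X (dom (image_of C f))" "image_of C f \<cdot> e = f"
    "monic C (image_of C f)" "cod (image_of C f) = Y"
proof -
  obtain e where e: "regular_epi C e" "e \<in> hom C X (dom (image_of C f))" "image_of C f \<cdot> e = f"
    "monic C (image_of C f)" using image[of f] assms unfolding is_image_def by auto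
  moreover have "cod (image_of C f) = Y"
    using arg_cong[OF e(3), of cod] e(2)[THEN homD] assms monic_arr[OF e(4)] by simp
  ultimately show thesis using that by blast
qed

lemma join_exists:
  assumes "monic C m" "monic C n" "cod m = cod n"
  shows "is_join C m n (join C m n)"
proof -
  note [simp] = assms(1,2)[THEN monic_arr] assms(3)
  \<comment> \<open>The join is the image of the copairing of the two subobjects.\<close>
  obtain e j where ej: "regular_epi C e" "e \<in> hom C (coprod C (dom m) (dom n)) (dom j)" "monic C j" "cod j = cod n" "j \<cdot> e = copair C m n"
    using image_factor[of "copair C m n" "coprod C (dom m) (dom n)" "cod n"] by auto
  note [simp] = ej(2)[THEN homD] ej(5)[THEN reassoc] monic_arr[OF ej(3)] ej(4)
  have "is_join C m n j"
    unfolding is_join_def sub_le_def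
  proof (intro conjI allI impI)
    show "\<exists>w\<in>hom C (dom m) (dom j). j \<cdot> w = m"
      by (rule bexI[of _ "e \<cdot> inl C (dom m) (dom n)"]) auto
    show "\<exists>w\<in>hom C (dom n) (dom j). j \<cdot> w = n"
      by (rule bexI[of _ "e \<cdot> inr C (dom m) (dom n)"]) auto
    fix k assume k: "monic C k \<and> cod k = cod m \<and> (\<exists>w\<in>hom C (dom m) (dom k). k \<cdot> w = m) \<and> (\<exists>w\<in>hom C (dom n) (dom k). k \<cdot> w = n)"
    then obtain a b where ab: "a \<in> hom C (dom m) (dom k)" "k \<cdot> a = m" "b \<in> hom C (dom n) (dom k)" "k \<cdot> b = n" and mk: "monic C k" by blast
    note [simp] = ab(1,3)[THEN homD] monic_arr[OF mk]
    have kab: "k \<cdot> copair C a b = copair C m n" using ab by simp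
    obtain x y where xy: "is_coequaliser C x y e" using ej(1) by (auto simp: regular_epi_def)
    note [simp] = is_coequaliserD(1-4)[OF xy]
    have [simp]: "cod x = coprod C (dom m) (dom n)" using is_coequaliserD(6)[OF xy] by simp
    have "copair C m n \<cdot> x = copair C m n \<cdot> y"
      using ej(5)[THEN reassoc, of x] ej(5)[THEN reassoc, of y] is_coequaliserD(7)[OF xy] by simp
    hence "k \<cdot> (copair C a b \<cdot> x) = k \<cdot> (copair C a b \<cdot> y)" using ab by simp
    hence "copair C a b \<cdot> x = copair C a b \<cdot> y" by (rule monicD[OF mk, of _ _ "dom x"]) auto
    then obtain w where w: "w \<in> hom C (cod e) (dom k)" "w \<cdot> e = copair C a b"
      using is_coequaliser_desc[OF xy, of "copair C a b" "dom k"] by auto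
    have "k \<cdot> w = j" by (rule regular_epi_epi[OF ej(1), of _ _ "cod n"]) (use w k ej ab in auto)
    thus "\<exists>w\<in>hom C (dom j) (dom k). k \<cdot> w = j" using w by auto
  qed (use ej in auto)
  thus ?thesis unfolding join_def by (rule someI)
qed

lemma normal_closure_exists:
  assumes "arr m"
  shows "is_normal_closure C m (normal_closure C m)"
proof -
  note [simp] = assms
  \<comment> \<open>Any \<open>f\<close> whose kernel contains \<open>m\<close> kills
    \<open>m\<close>, hence factors through the cokernel of \<open>m\<close>; so its kernel contains
    the kernel of that cokernel.\<close>
  have "is_normal_closure C m (ker C (coker C m))"
    unfolding is_normal_closure_def sub_le_def
  proof (intro conjI allI impI)
    show "normal_mono C (ker C (coker C m))" unfolding normal_mono_def using kernel[of "coker C m"] by auto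
    show "cod (ker C (coker C m)) = cod m" by simp
    obtain w where "w \<in> hom C (dom m) (dom (ker C (coker C m)))" "ker C (coker C m) \<cdot> w = m"
      by (rule ker_lift[of "coker C m" m "dom m"]) auto
    thus "\<exists>w\<in>hom C (dom m) (dom (ker C (coker C m))). ker C (coker C m) \<cdot> w = m" by blast
    fix k assume k: "normal_mono C k \<and> cod k = cod m \<and> (\<exists>w\<in>hom C (dom m) (dom k). k \<cdot> w = m)"
    then obtain f w where f: "is_kernel C f k" and w: "w \<in> hom C (dom m) (dom k)" "k \<cdot> w = m" unfolding normal_mono_def by blast
    note [simp] = is_kernelD(1,2)[OF f] w(1)[THEN homD]
    have [simp]: "dom f = cod m" using k is_kernelD(3)[OF f] by simp
    have "f \<cdot> m = zero C (dom m) (cod f)" using is_kernelD(4)[OF f, THEN reassoc, of w] w k by simp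
    then obtain v where v: "v \<in> hom C (cod (coker C m)) (cod f)" "v \<cdot> coker C m = f"
      using coker_desc[of m "dom m" "cod m" f "cod f"] by auto
    have "f \<cdot> ker C (coker C m) = zero C (dom (ker C (coker C m))) (cod f)"
      using v(2)[THEN reassoc, of "ker C (coker C m)"] v by simp
    then obtain w where "w \<in> hom C (dom (ker C (coker C m))) (dom k)" "k \<cdot> w = ker C (coker C m)"
      by (rule is_kernel_lift[OF f, rotated]) auto
    thus "\<exists>w\<in>hom C (dom (ker C (coker C m))) (dom k). k \<cdot> w = ker C (coker C m)" by blast
  qed
  thus ?thesis unfolding normal_closure_def by (rule someI)
qed

section \<open>Commuting morphisms and the Huq commutator\<close>

abbreviation inc1 :: "'o \<Rightarrow> 'o \<Rightarrow> 'a" where "inc1 A B \<equiv> pair C (ide A) (zero C A B)"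
abbreviation inc2 :: "'o \<Rightarrow> 'o \<Rightarrow> 'a" where "inc2 A B \<equiv> pair C (zero C B A) (ide B)"

lemma proj1_kernel:
  assumes "obj A" "obj B"
  shows "is_kernel C (proj1 C A B) (inc2 A B)"
proof (rule is_kernelI)
  note [simp] = assms
  show "monic C (inc2 A B)"
  proof (rule monicI)
    fix u v T assume uv: "u \<in> hom C T (dom (inc2 A B))" "v \<in> hom C T (dom (inc2 A B))"
      "inc2 A B \<cdot> u = inc2 A B \<cdot> v"
    show "u = v" using arg_cong[OF uv(3), of "\<lambda>x. proj2 C A B \<cdot> x"] uv(1,2)[THEN homD] by simp
  qed simp
  fix T u assume u: "u \<in> hom C T (dom (proj1 C A B))" "proj1 C A B \<cdot> u = zero C T (cod (proj1 C A B))"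
  note [simp] = u(1)[THEN homD]
  have "inc2 A B \<cdot> (proj2 C A B \<cdot> u) = u"
    by (rule prod_ext[of _ T A B]) (use u in auto)
  thus "\<exists>w. w \<in> hom C T (dom (inc2 A B)) \<and> inc2 A B \<cdot> w = u"
    by (intro exI[of _ "proj2 C A B \<cdot> u"]) auto
qed (use assms in auto)

lemma sum_to_prod_simps [simp]:
  assumes "obj A" "obj B"
  shows "arr (sum_to_prod C A B)" "dom (sum_to_prod C A B) = coprod C A B" "cod (sum_to_prod C A B) = prd A B"
    "sum_to_prod C A B \<cdot> inl C A B = inc1 A B"
    "sum_to_prod C A B \<cdot> inr C A B = inc2 A B"
  using assms by (auto simp: sum_to_prod_def)

text \<open>The product is a split extension of \<open>A\<close> with section \<open>inc1\<close>
  and kernel \<open>inc2\<close>, and the comparison arrow is the copairing of the two.\<close>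

lemma sum_to_prod_regular:
  assumes "obj A" "obj B"
  shows "regular_epi C (sum_to_prod C A B)"
proof -
  note [simp] = assms
  have "sum_to_prod C A B = copair C (inc1 A B) (inc2 A B)"
    by (rule coprod_ext[of _ A B "prd A B"]) auto
  thus ?thesis
    using split_ext_regular[of "proj1 C A B" "prd A B" A "inc1 A B", OF _ _ _ proj1_kernel] by simp
qed

text \<open>The arrow \<open>\<phi>\<close> is a cooperator in the sense of Huq. Working with
  cooperators instead of \<open>huq_vanishes\<close> makes restriction, composition and descent
  direct; \<open>huq_props\<close> gives the link to the commutator.\<close>

definition commute :: "'a \<Rightarrow> 'a \<Rightarrow> bool" where
  "commute a b \<longleftrightarrow> (\<exists>\<phi>. \<phi> \<in> hom C (prd (dom a) (dom b)) (cod a) \<and>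
     \<phi> \<cdot> inc1 (dom a) (dom b) = a \<and>
     \<phi> \<cdot> inc2 (dom a) (dom b) = b)"

lemma commuteI:
  assumes "a \<in> hom C A X" "b \<in> hom C B X" "\<phi> \<in> hom C (prd A B) X"
    "\<phi> \<cdot> inc1 A B = a" "\<phi> \<cdot> inc2 A B = b"
  shows "commute a b"
  using assms unfolding commute_def by auto

lemma commuteE:
  assumes "commute a b" "a \<in> hom C A X" "b \<in> hom C B X"
  obtains \<phi> where "\<phi> \<in> hom C (prd A B) X" "\<phi> \<cdot> inc1 A B = a" "\<phi> \<cdot> inc2 A B = b"
  using assms unfolding commute_def by auto

text \<open>By \<open>sum_to_prod_regular\<close> the product is the quotient of the coproduct by
  the kernel of the comparison, so a cooperator is exactly a factorisation of
  \<open>copair C a b\<close> through that quotient.\<close>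

lemma commute_iff:
  assumes "a \<in> hom C A X" "b \<in> hom C B X"
  shows "commute a b \<longleftrightarrow> copair C a b \<cdot> ker C (sum_to_prod C A B) = zero C (dom (ker C (sum_to_prod C A B))) X"
proof
  note [simp] = assms[THEN homD]
  {
    assume "commute a b"
    then obtain \<phi> where \<phi>: "\<phi> \<in> hom C (prd A B) X" "\<phi> \<cdot> inc1 A B = a" "\<phi> \<cdot> inc2 A B = b"
      using commuteE[OF _ assms] by blast
    note [simp] = \<phi>(1)[THEN homD]
    have e: "\<phi> \<cdot> sum_to_prod C A B = copair C a b"
      by (rule coprod_ext[of _ A B X]) (use \<phi> in auto)
    show "copair C a b \<cdot> ker C (sum_to_prod C A B) = zero C (dom (ker C (sum_to_prod C A B))) X"
      using e[THEN reassoc, of "ker C (sum_to_prod C A B)"] by simp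
  next
    assume "copair C a b \<cdot> ker C (sum_to_prod C A B) = zero C (dom (ker C (sum_to_prod C A B))) X"
    then obtain \<phi> where \<phi>: "\<phi> \<in> hom C (prd A B) X" "\<phi> \<cdot> sum_to_prod C A B = copair C a b"
      using regular_epi_desc0[OF sum_to_prod_regular[of A B], of "copair C a b" X] by auto
    note [simp] = \<phi>(1)[THEN homD]
    show "commute a b"
    proof (rule commuteI[OF assms \<phi>(1)])
      show "\<phi> \<cdot> inc1 A B = a" using \<phi>(2)[THEN reassoc, of "inl C A B"] by simp
      show "\<phi> \<cdot> inc2 A B = b" using \<phi>(2)[THEN reassoc, of "inr C A B"] by simp
    qed
  }
qed

lemma commute_sym:
  assumes "commute a b" "a \<in> hom C A X" "b \<in> hom C B X"
  shows "commute b a"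
proof -
  note [simp] = assms(2,3)[THEN homD]
  obtain \<phi> where \<phi>: "\<phi> \<in> hom C (prd A B) X" "\<phi> \<cdot> inc1 A B = a" "\<phi> \<cdot> inc2 A B = b"
    using commuteE[OF assms] by blast
  note [simp] = \<phi>(1)[THEN homD] \<phi>(2,3)
  show ?thesis
    by (rule commuteI[OF assms(3,2), of "\<phi> \<cdot> pair C (proj2 C B A) (proj1 C B A)"]) simp_all
qed

lemma commute_comp:
  assumes "commute a b" "a \<in> hom C A X" "b \<in> hom C B X" "f \<in> hom C X Y"
  shows "commute (f \<cdot> a) (f \<cdot> b)"
proof -
  note [simp] = assms(2-4)[THEN homD]
  obtain \<phi> where \<phi>: "\<phi> \<in> hom C (prd A B) X" "\<phi> \<cdot> inc1 A B = a" "\<phi> \<cdot> inc2 A B = b"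
    using commuteE[OF assms(1-3)] by blast
  note [simp] = \<phi>(1)[THEN homD] \<phi>(2,3)
  show ?thesis
    by (rule commuteI[of _ A Y _ B "f \<cdot> \<phi>"]) simp_all
qed

lemma commute_precomp:
  assumes "commute a b" "a \<in> hom C A X" "b \<in> hom C B X" "u \<in> hom C A' A" "v \<in> hom C B' B"
  shows "commute (a \<cdot> u) (b \<cdot> v)"
proof -
  note [simp] = assms(2-5)[THEN homD]
  obtain \<phi> where \<phi>: "\<phi> \<in> hom C (prd A B) X" "\<phi> \<cdot> inc1 A B = a" "\<phi> \<cdot> inc2 A B = b"
    using commuteE[OF assms(1-3)] by blast
  note [simp] = \<phi>(1)[THEN homD]
  show ?thesis
  proof (rule commuteI[of _ A' X _ B' "\<phi> \<cdot> pair C (u \<cdot> proj1 C A' B') (v \<cdot> proj2 C A' B')"])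
    show "(\<phi> \<cdot> pair C (u \<cdot> proj1 C A' B') (v \<cdot> proj2 C A' B')) \<cdot> inc1 A' B' = a \<cdot> u"
      using \<phi>(2)[THEN reassoc, of u] by simp
    show "(\<phi> \<cdot> pair C (u \<cdot> proj1 C A' B') (v \<cdot> proj2 C A' B')) \<cdot> inc2 A' B' = b \<cdot> v"
      using \<phi>(3)[THEN reassoc, of v] by simp
  qed simp_all
qed

text \<open>The product of \<open>t\<close> with the identity of \<open>B\<close> is a pullback of
  \<open>t\<close>, hence a regular epimorphism. Its kernel lies in the factor \<open>T\<close>,
  where the given cooperator is \<open>a \<cdot> t\<close> and so vanishes on it; the cooperator
  descends.\<close>

lemma commute_descend:
  assumes t: "regular_epi C t" "t \<in> hom C T A" and c: "commute (a \<cdot> t) b" and ab: "a \<in> hom C A X" "b \<in> hom C B X"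
  shows "commute a b"
proof -
  note [simp] = t(2)[THEN homD] ab[THEN homD]
  have "a \<cdot> t \<in> hom C T X" by simp
  then obtain \<phi> where \<phi>: "\<phi> \<in> hom C (prd T B) X" "\<phi> \<cdot> inc1 T B = a \<cdot> t" "\<phi> \<cdot> inc2 T B = b"
    using commuteE[OF c _ ab(2)] by blast
  note [simp] = \<phi>(1)[THEN homD]
  define s where "s = pair C (t \<cdot> proj1 C T B) (proj2 C T B)"
  have s: "s \<in> hom C (prd T B) (prd A B)" unfolding s_def by simp
  note [simp] = s[THEN homD]
  have "is_pullback C t (proj1 C A B) (proj1 C T B) s"
  proof (rule is_pullbackI[where V = "prd T B"])
    show "t \<cdot> proj1 C T B = proj1 C A B \<cdot> s" unfolding s_def by simp
    fix S u v assume uv: "u \<in> hom C S (dom t)" "v \<in> hom C S (dom (proj1 C A B))" "t \<cdot> u = proj1 C A B \<cdot> v"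
    note [simp] = uv(1,2)[THEN homD]
    have "s \<cdot> pair C u (proj2 C A B \<cdot> v) = v"
      by (rule prod_ext[of _ S A B]) (use uv(3) in \<open>auto simp: s_def\<close>)
    thus "\<exists>w. w \<in> hom C S (prd T B) \<and> proj1 C T B \<cdot> w = u \<and> s \<cdot> w = v"
      by (intro exI[of _ "pair C u (proj2 C A B \<cdot> v)"]) auto
  next
    fix S w w' assume w: "w \<in> hom C S (prd T B)" "w' \<in> hom C S (prd T B)" "proj1 C T B \<cdot> w = proj1 C T B \<cdot> w'" "s \<cdot> w = s \<cdot> w'"
    have "proj2 C T B \<cdot> w = proj2 C T B \<cdot> w'"
      using arg_cong[OF w(4), of "\<lambda>x. proj2 C A B \<cdot> x"] w(1,2) by (simp add: s_def)
    thus "w = w'"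
      using prod_ext[OF w(1,2)] w(3) by simp
  qed auto
  hence sr: "regular_epi C s" using regular_epi_pb t(1) by blast
  let ?z = "ker C s"
  have sz: "s \<cdot> ?z = zero C (dom ?z) (prd A B)" by simp
  have ps: "proj1 C A B \<cdot> s = t \<cdot> proj1 C T B" "proj2 C A B \<cdot> s = proj2 C T B" unfolding s_def by simp_all
  have z1: "t \<cdot> (proj1 C T B \<cdot> ?z) = zero C (dom ?z) A" using ps(1)[THEN reassoc, of ?z] by simp
  have z2: "proj2 C T B \<cdot> ?z = zero C (dom ?z) B" using ps(2)[THEN reassoc, of ?z] by simp
  have z: "?z = inc1 T B \<cdot> (proj1 C T B \<cdot> ?z)"
    by (rule prod_ext[of _ "dom ?z" T B]) (use z2 in auto)
  have "\<phi> \<cdot> (inc1 T B \<cdot> (proj1 C T B \<cdot> ?z)) = zero C (dom ?z) X"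
    using \<phi>(2)[THEN reassoc, of "proj1 C T B \<cdot> ?z"] z1 by simp
  hence "\<phi> \<cdot> ?z = zero C (dom ?z) X" using z by simp
  then obtain \<psi> where \<psi>: "\<psi> \<in> hom C (prd A B) X" "\<psi> \<cdot> s = \<phi>"
    using regular_epi_desc0[OF sr, of \<phi> X] by auto
  note [simp] = \<psi>(1)[THEN homD]
  show ?thesis
  proof (rule commuteI[OF ab \<psi>(1)])
    have "\<psi> \<cdot> (s \<cdot> inc1 T B) = a \<cdot> t" using \<psi>(2)[THEN reassoc, of "inc1 T B"] \<phi> by simp
    moreover have "s \<cdot> inc1 T B = inc1 A B \<cdot> t" unfolding s_def by simp
    ultimately have "(\<psi> \<cdot> inc1 A B) \<cdot> t = a \<cdot> t" by simp
    thus "\<psi> \<cdot> inc1 A B = a" by (rule regular_epi_epi[OF t(1), of _ _ X]) auto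
    have "s \<cdot> inc2 T B = inc2 A B" unfolding s_def by simp
    thus "\<psi> \<cdot> inc2 A B = b" using \<psi>(2)[THEN reassoc, of "inc2 T B"] \<phi> by simp
  qed
qed

text \<open>The third claim is the universal property of the commutator. Since the kernel of
  \<open>f\<close> is normal, killing the normal closure amounts to killing the Higgins commutator;
  since the image part is epic, this amounts to the criterion of \<open>commute_iff\<close> for the
  composites with \<open>f\<close>.\<close>

lemma huq_props:
  assumes "a \<in> hom C A X" "b \<in> hom C B X"
  shows "monic C (huq C a b)" "cod (huq C a b) = X"
    "f \<in> hom C X Y \<Longrightarrow> f \<cdot> huq C a b = zero C (dom (huq C a b)) Y \<longleftrightarrow> commute (f \<cdot> a) (f \<cdot> b)"
proof -
  note [simp] = assms[THEN homD]
  let ?k = "ker C (sum_to_prod C A B)"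
  let ?m = "higgins C a b" and ?n = "huq C a b"
  have h: "copair C a b \<cdot> ?k \<in> hom C (dom ?k) X" by simp
  have m: "?m = image_of C (copair C a b \<cdot> ?k)" by (simp add: higgins_def)
  obtain e where e: "regular_epi C e" "e \<in> hom C (dom ?k) (dom ?m)" "?m \<cdot> e = copair C a b \<cdot> ?k" "monic C ?m" "cod ?m = X"
    unfolding m by (rule imageE[OF h])
  note [simp] = monic_arr[OF e(4)] e(2)[THEN homD] e(5)
  have n: "is_normal_closure C ?m ?n" unfolding huq_def by (rule normal_closure_exists) simp
  then obtain g where g: "is_kernel C g ?n" unfolding is_normal_closure_def normal_mono_def by blast
  show mn: "monic C ?n" by (rule is_kernel_monic[OF g])
  show cn: "cod ?n = X" using n by (simp add: is_normal_closure_def)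
  note [simp] = monic_arr[OF mn] cn
  assume f: "f \<in> hom C X Y"
  note [simp] = f[THEN homD]
  have "f \<cdot> ?n = zero C (dom ?n) Y \<longleftrightarrow> f \<cdot> ?m = zero C (dom ?m) Y"
  proof
    obtain w where w: "w \<in> hom C (dom ?m) (dom ?n)" "?n \<cdot> w = ?m" using n unfolding is_normal_closure_def sub_le_def by blast
    assume "f \<cdot> ?n = zero C (dom ?n) Y"
    thus "f \<cdot> ?m = zero C (dom ?m) Y" using w(1) reassoc[of f ?n _ w] w(2) by simp
  next
    assume "f \<cdot> ?m = zero C (dom ?m) Y"
    then obtain w where "w \<in> hom C (dom ?m) (dom (ker C f))" "ker C f \<cdot> w = ?m" using ker_lift[of f ?m "dom ?m"] by auto
    hence "sub_le C ?m (ker C f)" unfolding sub_le_def by blast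
    moreover have "normal_mono C (ker C f)" unfolding normal_mono_def using kernel[of f] by auto
    ultimately have "sub_le C ?n (ker C f)" using n unfolding is_normal_closure_def by simp
    then obtain v where v: "v \<in> hom C (dom ?n) (dom (ker C f))" "ker C f \<cdot> v = ?n" unfolding sub_le_def by blast
    have "f \<cdot> (ker C f \<cdot> v) = zero C (dom ?n) Y" using v(1) by simp
    thus "f \<cdot> ?n = zero C (dom ?n) Y" using v(2) by simp
  qed
  also have "\<dots> \<longleftrightarrow> f \<cdot> (copair C a b \<cdot> ?k) = zero C (dom ?k) Y"
  proof
    assume "f \<cdot> ?m = zero C (dom ?m) Y"
    thus "f \<cdot> (copair C a b \<cdot> ?k) = zero C (dom ?k) Y" using reassoc[of f ?m _ e] e(3) by simp
  next
    assume "f \<cdot> (copair C a b \<cdot> ?k) = zero C (dom ?k) Y"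
    hence "(f \<cdot> ?m) \<cdot> e = zero C (dom ?m) Y \<cdot> e" using e(3) by simp
    thus "f \<cdot> ?m = zero C (dom ?m) Y" by (rule regular_epi_epi[OF e(1), of _ _ Y]) auto
  qed
  also have "\<dots> \<longleftrightarrow> commute (f \<cdot> a) (f \<cdot> b)"
    using commute_iff[of "f \<cdot> a" A Y "f \<cdot> b" B] by simp
  finally show "f \<cdot> ?n = zero C (dom ?n) Y \<longleftrightarrow> commute (f \<cdot> a) (f \<cdot> b)" .
qed

lemma zero_objI:
  assumes "obj A" "ide A = zero C A A"
  shows "is_zero C A"
proof -
  have "f = zero C A B" if "f \<in> hom C A B" for f B
  proof -
    have "f \<cdot> ide A = zero C A B" unfolding assms(2) using that assms(1) by auto
    thus ?thesis using that by simp
  qed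
  moreover have "f = zero C B A" if "f \<in> hom C B A" for f B
  proof -
    have "ide A \<cdot> f = zero C B A" unfolding assms(2) using that assms(1) by auto
    thus ?thesis using that by simp
  qed
  ultimately show ?thesis
    unfolding is_zero_def is_initial_def is_terminal_def using assms(1) by (metis hom_iff zero_simps)
qed

lemma commute_huq_vanishes:
  assumes "commute a b" "a \<in> hom C A X" "b \<in> hom C B X"
  shows "huq_vanishes C a b"
proof -
  note [simp] = assms(2,3)[THEN homD]
  let ?n = "huq C a b"
  note n = huq_props(1,2)[OF assms(2,3)]
  note [simp] = monic_arr[OF n(1)] n(2)
  have "ide X \<cdot> ?n = zero C (dom ?n) X"
    using huq_props(3)[OF assms(2,3), of "ide X" X] assms(1) by simp
  hence "?n \<cdot> ide (dom ?n) = ?n \<cdot> zero C (dom ?n) (dom ?n)" by simp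
  hence "ide (dom ?n) = zero C (dom ?n) (dom ?n)" by (rule monicD[OF n(1), of _ _ "dom ?n"]) auto
  thus ?thesis unfolding huq_vanishes_def by (intro zero_objI) auto
qed

section \<open>Connectors\<close>

lemma equivalence_relationD:
  assumes "equivalence_relation C X r1 r2"
  obtains R \<delta> where "r1 \<in> hom C R X" "r2 \<in> hom C R X" "\<delta> \<in> hom C X R" "r1 \<cdot> \<delta> = ide X" "r2 \<cdot> \<delta> = ide X" "monic C (pair C r1 r2)"
proof -
  obtain d where rd: "r1 \<in> hom C (dom r1) X" "r2 \<in> hom C (dom r1) X" "d \<in> hom C X (dom r1)" "r1 \<cdot> d = ide X" "r2 \<cdot> d = ide X"
    and mono: "\<forall>T u v. u \<in> hom C T (dom r1) \<and> v \<in> hom C T (dom r1) \<and> r1 \<cdot> u = r1 \<cdot> v \<and> r2 \<cdot> u = r2 \<cdot> v \<longrightarrow> u = v"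
    using assms unfolding equivalence_relation_def by blast
  have [simp]: "arr r1" "cod r1 = X" "arr r2" "dom r2 = dom r1" "cod r2 = X" using rd(1,2) by auto
  have "monic C (pair C r1 r2)"
  proof (rule monicI)
    fix u v T assume uv: "u \<in> hom C T (dom (pair C r1 r2))" "v \<in> hom C T (dom (pair C r1 r2))" "pair C r1 r2 \<cdot> u = pair C r1 r2 \<cdot> v"
    note [simp] = uv(1,2)[THEN homD]
    have e: "pair C (r1 \<cdot> u) (r2 \<cdot> u) = pair C (r1 \<cdot> v) (r2 \<cdot> v)" using uv(3) by simp
    have "r1 \<cdot> u = r1 \<cdot> v" by (rule pair_eqD(1)[OF e, of T X X]) simp_all
    moreover have "r2 \<cdot> u = r2 \<cdot> v" by (rule pair_eqD(2)[OF e, of T X X]) simp_all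
    moreover have "u \<in> hom C T (dom r1)" "v \<in> hom C T (dom r1)" by simp_all
    ultimately show "u = v" using mono by blast
  qed simp
  thus thesis using that rd by blast
qed

text \<open>The definition quantifies over all diagonals of the two relations. Joint monicity makes
  each diagonal unique, so one chosen pair suffices.\<close>

lemma smith_cocone_iff:
  assumes r: "r1 \<in> hom C R X" "r2 \<in> hom C R X" "\<delta> \<in> hom C X R" "r1 \<cdot> \<delta> = ide X" "r2 \<cdot> \<delta> = ide X" "monic C (pair C r1 r2)"
   and s: "s1 \<in> hom C S X" "s2 \<in> hom C S X" "\<epsilon> \<in> hom C X S" "s1 \<cdot> \<epsilon> = ide X" "s2 \<cdot> \<epsilon> = ide X" "monic C (pair C s1 s2)"
  shows "smith_cocone C r1 r2 s1 s2 T t \<phi> \<longleftrightarrow> t \<in> hom C X T \<and> \<phi> \<in> hom C (pbo r2 s1) T \<and>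
     \<phi> \<cdot> pb_pair C r2 s1 (ide R) (\<epsilon> \<cdot> r2) = t \<cdot> r1 \<and> \<phi> \<cdot> pb_pair C r2 s1 (\<delta> \<cdot> s1) (ide S) = t \<cdot> s2"
proof -
  have "\<delta>' = \<delta>" if "\<delta>' \<in> hom C X R" "r1 \<cdot> \<delta>' = ide X" "r2 \<cdot> \<delta>' = ide X" for \<delta>'
  proof (rule monicD[OF r(6), of _ _ X])
    show "pair C r1 r2 \<cdot> \<delta>' = pair C r1 r2 \<cdot> \<delta>" using that r by auto
  qed (use that r in auto)
  moreover have "\<epsilon>' = \<epsilon>" if "\<epsilon>' \<in> hom C X S" "s1 \<cdot> \<epsilon>' = ide X" "s2 \<cdot> \<epsilon>' = ide X" for \<epsilon>'
  proof (rule monicD[OF s(6), of _ _ X])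
    show "pair C s1 s2 \<cdot> \<epsilon>' = pair C s1 s2 \<cdot> \<epsilon>" using that s by auto
  qed (use that s in auto)
  moreover have "cod r1 = X" "dom r1 = R" "dom s1 = S" using r s by auto
  ultimately show ?thesis
    unfolding smith_cocone_def using r(3-5) s(3-5) by metis
qed

text \<open>The Smith quotient is a finite colimit. It is built as a quotient of the coproduct of
  \<open>X\<close> and the pullback \<open>V\<close> by the two cocone equations, combined into one
  parallel pair out of the coproduct of \<open>R\<close> and \<open>S\<close>.\<close>

lemma smith_quotient_exists:
  assumes "equivalence_relation C X r1 r2" "equivalence_relation C X s1 s2"
  shows "is_smith_quotient C r1 r2 s1 s2 (smith_quotient C r1 r2 s1 s2)"
proof -
  obtain R \<delta> where r: "r1 \<in> hom C R X" "r2 \<in> hom C R X" "\<delta> \<in> hom C X R" "r1 \<cdot> \<delta> = ide X" "r2 \<cdot> \<delta> = ide X" "monic C (pair C r1 r2)"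
    by (rule equivalence_relationD[OF assms(1)]) blast
  obtain S \<epsilon> where s: "s1 \<in> hom C S X" "s2 \<in> hom C S X" "\<epsilon> \<in> hom C X S" "s1 \<cdot> \<epsilon> = ide X" "s2 \<cdot> \<epsilon> = ide X" "monic C (pair C s1 s2)"
    by (rule equivalence_relationD[OF assms(2)]) blast
  note cocone = smith_cocone_iff[OF r s]
  note [simp] = r(1-3)[THEN homD] s(1-3)[THEN homD] r(4,5) s(4,5) r(4,5)[THEN reassoc] s(4,5)[THEN reassoc]
  define lR lS V where "lR = pb_pair C r2 s1 (ide R) (\<epsilon> \<cdot> r2)" and "lS = pb_pair C r2 s1 (\<delta> \<cdot> s1) (ide S)" and "V = pbo r2 s1"
  have [simp]: "arr lR" "dom lR = R" "cod lR = V" "arr lS" "dom lS = S" "cod lS = V" "obj V"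
    unfolding lR_def lS_def V_def by simp_all
  note cocone = cocone[folded lR_def lS_def V_def]
  let ?i = "inl C X V" and ?j = "inr C X V"
  let ?f = "copair C (?j \<cdot> lR) (?j \<cdot> lS)" and ?g = "copair C (?i \<cdot> r1) (?i \<cdot> s2)"
  obtain q where q: "is_coequaliser C ?f ?g q"
    using coequaliser_exists[of ?f "coprod C R S" "coprod C X V" ?g] by auto
  note [simp] = is_coequaliserD(5)[OF q]
  have [simp]: "dom q = coprod C X V" using is_coequaliserD(6)[OF q] by simp
  have fg: "?f \<cdot> inl C R S = ?j \<cdot> lR" "?f \<cdot> inr C R S = ?j \<cdot> lS" "?g \<cdot> inl C R S = ?i \<cdot> r1" "?g \<cdot> inr C R S = ?i \<cdot> s2" by simp_all
  have qfg: "q \<cdot> ?f = q \<cdot> ?g" by (rule is_coequaliserD(7)[OF q])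
  have c1: "q \<cdot> (?j \<cdot> lR) = q \<cdot> (?i \<cdot> r1)"
    using arg_cong[OF qfg, of "\<lambda>x. x \<cdot> inl C R S"] by simp
  have c2: "q \<cdot> (?j \<cdot> lS) = q \<cdot> (?i \<cdot> s2)"
    using arg_cong[OF qfg, of "\<lambda>x. x \<cdot> inr C R S"] by simp
  have "smith_cocone C r1 r2 s1 s2 (cod (q \<cdot> ?i)) (q \<cdot> ?i) (q \<cdot> ?j)"
    unfolding cocone using c1 c2 by simp
  moreover have "\<exists>!w. w \<in> hom C (cod (q \<cdot> ?i)) T' \<and> w \<cdot> (q \<cdot> ?i) = t' \<and> w \<cdot> (q \<cdot> ?j) = \<phi>'"
    if "smith_cocone C r1 r2 s1 s2 T' t' \<phi>'" for T' t' \<phi>'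
  proof -
    have t: "t' \<in> hom C X T'" "\<phi>' \<in> hom C V T'" "\<phi>' \<cdot> lR = t' \<cdot> r1" "\<phi>' \<cdot> lS = t' \<cdot> s2"
      using that unfolding cocone by auto
    note [simp] = t(1,2)[THEN homD] t(3,4)
    have "copair C t' \<phi>' \<cdot> ?f = copair C t' \<phi>' \<cdot> ?g" by simp
    then obtain w where w: "w \<in> hom C (cod q) T'" "w \<cdot> q = copair C t' \<phi>'"
      using is_coequaliser_desc[OF q, of "copair C t' \<phi>'" T'] by auto
    note [simp] = w(2)[THEN reassoc] w(1)[THEN homD]
    show ?thesis
    proof (rule ex1I)
      show "w \<in> hom C (cod (q \<cdot> ?i)) T' \<and> w \<cdot> (q \<cdot> ?i) = t' \<and> w \<cdot> (q \<cdot> ?j) = \<phi>'" by simp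
      fix z assume z: "z \<in> hom C (cod (q \<cdot> ?i)) T' \<and> z \<cdot> (q \<cdot> ?i) = t' \<and> z \<cdot> (q \<cdot> ?j) = \<phi>'"
      have "z \<cdot> q = w \<cdot> q"
        by (rule coprod_ext[of "z \<cdot> q" X V T' "w \<cdot> q"]) (use z in auto)
      thus "z = w" by (rule regular_epi_epi[OF is_coequaliserD(8)[OF q], of _ _ T']) (use z in auto)
    qed
  qed
  ultimately have "is_smith_quotient C r1 r2 s1 s2 (q \<cdot> ?i)" unfolding is_smith_quotient_def by blast
  thus ?thesis unfolding smith_quotient_def by (rule someI)
qed

text \<open>
  If the commutator vanishes, the Smith quotient \<open>t\<close> is monic; as the two sections of the pullback
  are jointly strongly epic, \<open>\<phi>\<close> then factors through \<open>t\<close>.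
\<close>

lemma smith_vanishes_connector:
  assumes "smith_vanishes C r1 r2 s1 s2" "equivalence_relation C X r1 r2" "equivalence_relation C X s1 s2"
  obtains \<psi> where "smith_cocone C r1 r2 s1 s2 X (ide X) \<psi>"
proof -
  obtain R \<delta> where r: "r1 \<in> hom C R X" "r2 \<in> hom C R X" "\<delta> \<in> hom C X R" "r1 \<cdot> \<delta> = ide X" "r2 \<cdot> \<delta> = ide X" "monic C (pair C r1 r2)"
    by (rule equivalence_relationD[OF assms(2)]) blast
  obtain S \<epsilon> where s: "s1 \<in> hom C S X" "s2 \<in> hom C S X" "\<epsilon> \<in> hom C X S" "s1 \<cdot> \<epsilon> = ide X" "s2 \<cdot> \<epsilon> = ide X" "monic C (pair C s1 s2)"
    by (rule equivalence_relationD[OF assms(3)]) blast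
  note cocone = smith_cocone_iff[OF r s]
  note [simp] = r(1-3)[THEN homD] s(1-3)[THEN homD] r(4,5) s(4,5) r(4,5)[THEN reassoc] s(4,5)[THEN reassoc]
  define lR lS V where "lR = pb_pair C r2 s1 (ide R) (\<epsilon> \<cdot> r2)" and "lS = pb_pair C r2 s1 (\<delta> \<cdot> s1) (ide S)" and "V = pbo r2 s1"
  have [simp]: "arr lR" "dom lR = R" "cod lR = V" "arr lS" "dom lS = S" "cod lS = V" "obj V"
    unfolding lR_def lS_def V_def by simp_all
  note cocone = cocone[folded lR_def lS_def V_def]
  define t where "t = smith_quotient C r1 r2 s1 s2"
  have "is_smith_quotient C r1 r2 s1 s2 t" unfolding t_def by (rule smith_quotient_exists[OF assms(2,3)])
  then obtain \<phi> where "smith_cocone C r1 r2 s1 s2 (cod t) t \<phi>" unfolding is_smith_quotient_def by blast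
  hence \<phi>: "t \<in> hom C X (cod t)" "\<phi> \<in> hom C V (cod t)" "\<phi> \<cdot> lR = t \<cdot> r1" "\<phi> \<cdot> lS = t \<cdot> s2" unfolding cocone by auto
  have [simp]: "arr t" "dom t = X" "arr \<phi>" "dom \<phi> = V" "cod \<phi> = cod t" using \<phi>(1,2) by auto
  note [simp] = \<phi>(3,4)
  have pp: "pb1 C t t = pb2 C t t"
    using assms(1) unfolding smith_vanishes_def smith_commutator_def t_def[symmetric] by (auto simp: Let_def)
  have t: "monic C t"
  proof (rule monicI)
    fix u v T assume uv: "u \<in> hom C T (dom t)" "v \<in> hom C T (dom t)" "t \<cdot> u = t \<cdot> v"
    note [simp] = uv(1,2)[THEN homD] uv(3)
    have "pb1 C t t \<cdot> pb_pair C t t u v = u" "pb2 C t t \<cdot> pb_pair C t t u v = v" by simp_all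
    thus "u = v" unfolding pp by metis
  qed simp
  \<comment> \<open>The part of the pullback on which \<open>\<phi>\<close> takes values in the
    subobject \<open>t\<close>. The cocone equations put both sections into it, so it is
    everything.\<close>
  let ?m = "pb1 C \<phi> t"
  have "iso C ?m"
  proof (rule split_pb_strong[of r2 R X s1 S \<delta> \<epsilon> ?m])
    show "monic C ?m" by (rule monic_pb1[OF t]) auto
    show "cod ?m = pbo r2 s1" by (simp add: V_def)
    show "pb_pair C \<phi> t lR r1 \<in> hom C R (dom ?m)" "pb_pair C \<phi> t lS s2 \<in> hom C S (dom ?m)" by simp_all
    show "?m \<cdot> pb_pair C \<phi> t lR r1 = pb_pair C r2 s1 (ide R) (\<epsilon> \<cdot> r2)" unfolding lR_def[symmetric] by simp
    show "?m \<cdot> pb_pair C \<phi> t lS s2 = pb_pair C r2 s1 (\<delta> \<cdot> s1) (ide S)" unfolding lS_def[symmetric] by simp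
  qed simp_all
  then obtain n where n: "n \<in> hom C V (dom ?m)" "?m \<cdot> n = ide V" by (rule isoE) auto
  note [simp] = n(1)[THEN homD]
  define \<psi> where "\<psi> = pb2 C \<phi> t \<cdot> n"
  have \<psi>: "\<psi> \<in> hom C V X" "t \<cdot> \<psi> = \<phi>"
    unfolding \<psi>_def using pb_comm'[of \<phi> t n] n(2) by simp_all
  note [simp] = \<psi>(1)[THEN homD]
  have "\<psi> \<cdot> lR = r1" by (rule monicD[OF t, of _ _ R]) (use \<psi>(2)[THEN reassoc, of lR] in auto)
  moreover have "\<psi> \<cdot> lS = s2" by (rule monicD[OF t, of _ _ S]) (use \<psi>(2)[THEN reassoc, of lS] in auto)
  ultimately have "smith_cocone C r1 r2 s1 s2 X (ide X) \<psi>" unfolding cocone by simp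
  thus thesis by (rule that)
qed

lemma monic_kernel_pair:
  assumes "arr f" shows "monic C (pair C (pb1 C f f) (pb2 C f f))"
proof (rule monicI)
  note [simp] = assms
  fix u v T assume uv: "u \<in> hom C T (dom (pair C (pb1 C f f) (pb2 C f f)))" "v \<in> hom C T (dom (pair C (pb1 C f f) (pb2 C f f)))"
    "pair C (pb1 C f f) (pb2 C f f) \<cdot> u = pair C (pb1 C f f) (pb2 C f f) \<cdot> v"
  note [simp] = uv(1,2)[THEN homD]
  have e: "pair C (pb1 C f f \<cdot> u) (pb2 C f f \<cdot> u) = pair C (pb1 C f f \<cdot> v) (pb2 C f f \<cdot> v)" using uv(3) by simp
  show "u = v"
    by (rule pb_ext[of _ T f f]) (use pair_eqD[OF e, of T "dom f" "dom f"] in auto)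
qed (use assms in auto)

lemma kernel_pair_equivalence:
  assumes "arr f" shows "equivalence_relation C (dom f) (pb1 C f f) (pb2 C f f)"
  by (rule reflexive_equivalence[OF _ _ monic_kernel_pair, of f "pbo f f" "dom f" "pb_pair C f f (ide (dom f)) (ide (dom f))"])
    (use assms in auto)

lemma kernel_pair_normalisation:
  assumes "arr f"
  obtains w where "w \<in> hom C (dom (normalisation C (pb1 C f f) (pb2 C f f))) (dom (ker C f))"
    "ker C f \<cdot> w = normalisation C (pb1 C f f) (pb2 C f f)"
    "normalisation C (pb1 C f f) (pb2 C f f) \<in> hom C (dom (normalisation C (pb1 C f f) (pb2 C f f))) (dom f)"
proof -
  note [simp] = assms
  let ?n = "normalisation C (pb1 C f f) (pb2 C f f)"
  have n: "?n \<in> hom C (dom ?n) (dom f)" unfolding normalisation_def by simp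
  have "f \<cdot> ?n = zero C (dom ?n) (cod f)"
    unfolding normalisation_def using pb_comm'[of f f "ker C (pb1 C f f)"] by simp
  then obtain w where "w \<in> hom C (dom ?n) (dom (ker C f))" "ker C f \<cdot> w = ?n"
    using ker_lift[OF assms n] by blast
  thus thesis using that n by blast
qed

text \<open>The normalisations of the two kernel pairs factor through the kernels of
  \<open>c\<close> and \<open>d\<close>, so the cooperator restricts to them and Smith is Huq
  applies. The relation of \<open>c\<close> is put first so that the connector acts on triples with
  c x = c y and d y = d z.\<close>

lemma connector:
  assumes SH: "smith_is_huq C" and dc: "d \<in> hom C X Y" "c \<in> hom C X Z" and cm: "commute (ker C d) (ker C c)"
  obtains \<phi> where "smith_cocone C (pb1 C c c) (pb2 C c c) (pb1 C d d) (pb2 C d d) X (ide X) \<phi>"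
proof -
  note [simp] = dc[THEN homD]
  let ?R = "normalisation C (pb1 C c c) (pb2 C c c)" and ?S = "normalisation C (pb1 C d d) (pb2 C d d)"
  obtain u where u: "u \<in> hom C (dom ?R) (dom (ker C c))" "ker C c \<cdot> u = ?R" "?R \<in> hom C (dom ?R) X"
    using kernel_pair_normalisation[of c] by auto
  obtain v where v: "v \<in> hom C (dom ?S) (dom (ker C d))" "ker C d \<cdot> v = ?S" "?S \<in> hom C (dom ?S) X"
    using kernel_pair_normalisation[of d] by auto
  have k: "ker C d \<in> hom C (dom (ker C d)) X" "ker C c \<in> hom C (dom (ker C c)) X" by simp_all
  have "commute ?R ?S"
    using commute_precomp[OF commute_sym[OF cm k] k(2,1) u(1) v(1)] u(2) v(2) by simp
  hence "huq_vanishes C ?R ?S" by (rule commute_huq_vanishes[OF _ u(3) v(3)])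
  moreover have eq: "equivalence_relation C X (pb1 C c c) (pb2 C c c)" "equivalence_relation C X (pb1 C d d) (pb2 C d d)"
    using kernel_pair_equivalence[of c] kernel_pair_equivalence[of d] by simp_all
  ultimately have "smith_vanishes C (pb1 C c c) (pb2 C c c) (pb1 C d d) (pb2 C d d)"
    using SH unfolding smith_is_huq_def by blast
  from smith_vanishes_connector[OF this eq that] show thesis .
qed

end

section \<open>Groupoids from connectors\<close>

locale connected_graph = semi_abelian_category C for C :: "('o, 'a) cat" (structure) +
  fixes X Y :: 'o and d c e \<phi> :: 'a
  assumes d: "d \<in> hom C X Y" and c: "c \<in> hom C X Y" and e: "e \<in> hom C Y X"
    and de: "d \<cdot> e = ide Y" and ce: "c \<cdot> e = ide Y"
    and connector: "smith_cocone C (pb1 C c c) (pb2 C c c) (pb1 C d d) (pb2 C d d) X (ide X) \<phi>"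
begin

lemma graph_simps [simp]:
  "arr d" "dom d = X" "cod d = Y" "arr c" "dom c = X" "cod c = Y" "arr e" "dom e = Y" "cod e = X" "obj X" "obj Y"
  "d \<cdot> e = ide Y" "c \<cdot> e = ide Y"
  using d c e de ce by auto

lemma graph_simps' [simp]:
  assumes "arr t" "cod t = Y" shows "d \<cdot> (e \<cdot> t) = t" "c \<cdot> (e \<cdot> t) = t"
  using de[THEN reassoc, of t] ce[THEN reassoc, of t] assms by auto

lemma connector_laws:
  "\<phi> \<in> hom C (pbo (pb2 C c c) (pb1 C d d)) X"
  "\<phi> \<cdot> pb_pair C (pb2 C c c) (pb1 C d d) (ide (pbo c c)) (pb_pair C d d (ide X) (ide X) \<cdot> pb2 C c c) = pb1 C c c"
  "\<phi> \<cdot> pb_pair C (pb2 C c c) (pb1 C d d) (pb_pair C c c (ide X) (ide X) \<cdot> pb1 C d d) (ide (pbo d d)) = pb2 C d d"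
proof -
  have "smith_cocone C (pb1 C c c) (pb2 C c c) (pb1 C d d) (pb2 C d d) T t \<psi> \<longleftrightarrow> t \<in> hom C X T \<and> \<psi> \<in> hom C (pbo (pb2 C c c) (pb1 C d d)) T \<and>
     \<psi> \<cdot> pb_pair C (pb2 C c c) (pb1 C d d) (ide (pbo c c)) (pb_pair C d d (ide X) (ide X) \<cdot> pb2 C c c) = t \<cdot> pb1 C c c \<and>
     \<psi> \<cdot> pb_pair C (pb2 C c c) (pb1 C d d) (pb_pair C c c (ide X) (ide X) \<cdot> pb1 C d d) (ide (pbo d d)) = t \<cdot> pb2 C d d" for T t \<psi>
    by (rule smith_cocone_iff) (simp_all add: monic_kernel_pair)
  from this[of X "ide X" \<phi>] connector
  have *: "\<phi> \<in> hom C (pbo (pb2 C c c) (pb1 C d d)) X \<and>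
     \<phi> \<cdot> pb_pair C (pb2 C c c) (pb1 C d d) (ide (pbo c c)) (pb_pair C d d (ide X) (ide X) \<cdot> pb2 C c c) = ide X \<cdot> pb1 C c c \<and>
     \<phi> \<cdot> pb_pair C (pb2 C c c) (pb1 C d d) (pb_pair C c c (ide X) (ide X) \<cdot> pb1 C d d) (ide (pbo d d)) = ide X \<cdot> pb2 C d d"
    by blast
  show "\<phi> \<in> hom C (pbo (pb2 C c c) (pb1 C d d)) X"
    using * by blast
  have i: "ide X \<cdot> pb1 C c c = pb1 C c c" "ide X \<cdot> pb2 C d d = pb2 C d d" by simp_all
  show "\<phi> \<cdot> pb_pair C (pb2 C c c) (pb1 C d d) (ide (pbo c c)) (pb_pair C d d (ide X) (ide X) \<cdot> pb2 C c c) = pb1 C c c"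
    using * unfolding i by blast
  show "\<phi> \<cdot> pb_pair C (pb2 C c c) (pb1 C d d) (pb_pair C c c (ide X) (ide X) \<cdot> pb1 C d d) (ide (pbo d d)) = pb2 C d d"
    using * unfolding i by blast
qed

text \<open>For groups this is \<open>x y\<^sup>-\<^sup>1 z\<close>; it is meaningful only if \<open>c x = c y\<close> and \<open>d y = d z\<close>.\<close>

definition tri :: "'a \<Rightarrow> 'a \<Rightarrow> 'a \<Rightarrow> 'a" where
  "tri x y z = \<phi> \<cdot> pb_pair C (pb2 C c c) (pb1 C d d) (pb_pair C c c x y) (pb_pair C d d y z)"

lemma tri_simps [simp]:
  assumes "arr x" "arr y" "arr z" "dom y = dom x" "dom z = dom x" "cod x = X" "cod y = X" "cod z = X"
    "c \<cdot> x = c \<cdot> y" "d \<cdot> y = d \<cdot> z"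
  shows "arr (tri x y z)" "dom (tri x y z) = dom x" "cod (tri x y z) = X"
    "arr t \<Longrightarrow> cod t = dom x \<Longrightarrow> tri x y z \<cdot> t = tri (x \<cdot> t) (y \<cdot> t) (z \<cdot> t)"
  using connector_laws(1)[THEN homD] assms by (simp_all add: tri_def)

lemma tri_left [simp]:
  assumes "arr x" "arr y" "dom y = dom x" "cod x = X" "cod y = X" "c \<cdot> x = c \<cdot> y"
  shows "tri x y y = x"
  using connector_laws(1)[THEN homD] connector_laws(2)[THEN reassoc, of "pb_pair C c c x y"] assms by (simp add: tri_def)

lemma tri_right [simp]:
  assumes "arr y" "arr z" "dom z = dom y" "cod y = X" "cod z = X" "d \<cdot> y = d \<cdot> z"
  shows "tri y y z = z"
  using connector_laws(1)[THEN homD] connector_laws(3)[THEN reassoc, of "pb_pair C d d y z"] assms by (simp add: tri_def)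

text \<open>Both equations are checked on the two sections of the pullback of triples, where y = z
  or x = y and the connector laws give the value of \<open>\<phi>\<close>.\<close>

lemma tri_dc [simp]:
  assumes "arr x" "arr y" "arr z" "dom y = dom x" "dom z = dom x" "cod x = X" "cod y = X" "cod z = X"
    "c \<cdot> x = c \<cdot> y" "d \<cdot> y = d \<cdot> z"
  shows "d \<cdot> tri x y z = d \<cdot> x" "c \<cdot> tri x y z = c \<cdot> z"
proof -
  note [simp] = connector_laws(1)[THEN homD]
  let ?p = "pb1 C (pb2 C c c) (pb1 C d d)" and ?q = "pb2 C (pb2 C c c) (pb1 C d d)"
  let ?l = "pb_pair C (pb2 C c c) (pb1 C d d) (ide (pbo c c)) (pb_pair C d d (ide X) (ide X) \<cdot> pb2 C c c)"
  let ?r = "pb_pair C (pb2 C c c) (pb1 C d d) (pb_pair C c c (ide X) (ide X) \<cdot> pb1 C d d) (ide (pbo d d))"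
  have cc: "c \<cdot> pb1 C c c = c \<cdot> pb2 C c c" "d \<cdot> pb1 C d d = d \<cdot> pb2 C d d" by (rule pb_comm; simp)+
  have 1: "d \<cdot> \<phi> = d \<cdot> (pb1 C c c \<cdot> ?p)"
  proof (rule split_pb_epi[of "pb2 C c c" "pbo c c" X "pb1 C d d" "pbo d d" "pb_pair C c c (ide X) (ide X)" "pb_pair C d d (ide X) (ide X)"])
    show "(d \<cdot> \<phi>) \<cdot> ?l = (d \<cdot> (pb1 C c c \<cdot> ?p)) \<cdot> ?l" using connector_laws(2) by simp
    show "(d \<cdot> \<phi>) \<cdot> ?r = (d \<cdot> (pb1 C c c \<cdot> ?p)) \<cdot> ?r" using connector_laws(3) cc by simp
  qed simp_all
  have 2: "c \<cdot> \<phi> = c \<cdot> (pb2 C d d \<cdot> ?q)"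
  proof (rule split_pb_epi[of "pb2 C c c" "pbo c c" X "pb1 C d d" "pbo d d" "pb_pair C c c (ide X) (ide X)" "pb_pair C d d (ide X) (ide X)"])
    show "(c \<cdot> \<phi>) \<cdot> ?l = (c \<cdot> (pb2 C d d \<cdot> ?q)) \<cdot> ?l" using connector_laws(2) cc by simp
    show "(c \<cdot> \<phi>) \<cdot> ?r = (c \<cdot> (pb2 C d d \<cdot> ?q)) \<cdot> ?r" using connector_laws(3) by simp
  qed simp_all
  show "d \<cdot> tri x y z = d \<cdot> x" using 1[THEN reassoc] assms by (simp add: tri_def)
  show "c \<cdot> tri x y z = c \<cdot> z" using 2[THEN reassoc] assms by (simp add: tri_def)
qed

lemma tri_dc' [simp]:
  assumes "arr x" "arr y" "arr z" "dom y = dom x" "dom z = dom x" "cod x = X" "cod y = X" "cod z = X"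
    "c \<cdot> x = c \<cdot> y" "d \<cdot> y = d \<cdot> z" "arr t" "cod t = dom x"
  shows "d \<cdot> (tri x y z \<cdot> t) = d \<cdot> (x \<cdot> t)" "c \<cdot> (tri x y z \<cdot> t) = c \<cdot> (z \<cdot> t)"
  using tri_dc(1)[OF assms(1-10), THEN reassoc, of t] tri_dc(2)[OF assms(1-10), THEN reassoc, of t] assms
    tri_simps(1-3)[OF assms(1-10)] by (simp_all del: tri_simps)

text \<open>
  By protomodularity the diagonal and the kernel of
  a kernel pair are jointly epic, so it suffices to check them at \<open>(f, f)\<close> and \<open>(0, k)\<close>.
\<close>

lemma tri_inverse_right:
  assumes "arr f" "arr z" "dom z = dom f" "cod f = X" "cod z = X" "d \<cdot> f = d \<cdot> z"
  shows "tri f (e \<cdot> (c \<cdot> f)) (tri (e \<cdot> (c \<cdot> f)) f z) = z"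
proof -
  let ?p = "pb1 C d d" and ?q = "pb2 C d d"
  have cc [simp]: "d \<cdot> ?p = d \<cdot> ?q" by (rule pb_comm; simp)
  have cc' [simp]: "d \<cdot> (?p \<cdot> t) = d \<cdot> (?q \<cdot> t)" if "arr t" "cod t = pbo d d" for t by (rule pb_comm') (use that in auto)
  let ?u = "tri ?p (e \<cdot> (c \<cdot> ?p)) (tri (e \<cdot> (c \<cdot> ?p)) ?p ?q)"
  let ?s = "pb_pair C d d (ide X) (ide X)" and ?k = "pb_pair C d d (zero C (dom (ker C d)) X) (ker C d)"
  have eq: "?u = ?q"
  proof (rule split_ext_epi[OF _ _ _ pb1_kernel[of d X Y d X]])
    show "?u \<cdot> ?s = ?q \<cdot> ?s" by simp
    show "?u \<cdot> ?k = ?q \<cdot> ?k" by simp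
    show "?s \<in> hom C X (pbo d d)" by simp
  qed simp_all
  show ?thesis using arg_cong[OF eq, of "\<lambda>x. x \<cdot> pb_pair C d d f z"] assms by simp
qed

lemma tri_inverse_left:
  assumes "arr f" "arr x" "dom x = dom f" "cod f = X" "cod x = X" "c \<cdot> f = c \<cdot> x"
  shows "tri (tri x f (e \<cdot> (d \<cdot> f))) (e \<cdot> (d \<cdot> f)) f = x"
proof -
  let ?p = "pb1 C c c" and ?q = "pb2 C c c"
  have cc [simp]: "c \<cdot> ?p = c \<cdot> ?q" by (rule pb_comm; simp)
  have cc' [simp]: "c \<cdot> (?p \<cdot> t) = c \<cdot> (?q \<cdot> t)" if "arr t" "cod t = pbo c c" for t by (rule pb_comm') (use that in auto)
  let ?u = "tri (tri ?q ?p (e \<cdot> (d \<cdot> ?p))) (e \<cdot> (d \<cdot> ?p)) ?p"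
  let ?s = "pb_pair C c c (ide X) (ide X)" and ?k = "pb_pair C c c (zero C (dom (ker C c)) X) (ker C c)"
  have eq: "?u = ?q"
  proof (rule split_ext_epi[OF _ _ _ pb1_kernel[of c X Y c X]])
    show "?u \<cdot> ?s = ?q \<cdot> ?s" by simp
    show "?u \<cdot> ?k = ?q \<cdot> ?k" by simp
    show "?s \<in> hom C X (pbo c c)" by simp
  qed simp_all
  show ?thesis using arg_cong[OF eq, of "\<lambda>w. w \<cdot> pb_pair C c c f x"] assms by simp
qed

text \<open>The multiplication is x y^-1 z with y the identity arrow at the object where the two
  composable arrows meet.\<close>

definition groupoid :: "'a grpd" where
  "groupoid = \<lparr>gd = d, gc = c, ge = e, gm = tri (pb1 C c d) (e \<cdot> (c \<cdot> pb1 C c d)) (pb2 C c d)\<rparr>"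

lemma groupoid_sel [simp]: "gd groupoid = d" "gc groupoid = c" "ge groupoid = e"
  by (simp_all add: groupoid_def)

lemma gm_groupoid: "gm groupoid = tri (pb1 C c d) (e \<cdot> (c \<cdot> pb1 C c d)) (pb2 C c d)"
  by (simp add: groupoid_def)

lemma gcomp_groupoid:
  assumes "arr f" "arr g" "dom g = dom f" "cod f = X" "cod g = X" "c \<cdot> f = d \<cdot> g"
  shows "gcomp C groupoid f g = tri f (e \<cdot> (c \<cdot> f)) g"
proof -
  have cc [simp]: "c \<cdot> pb1 C c d = d \<cdot> pb2 C c d" by (rule pb_comm; simp)
  show ?thesis using assms by (simp add: gcomp_def gm_groupoid)
qed

text \<open>The composable pair (f, g) is treated as a single argument \<open>v\<close> in the
  pullback of \<open>c\<close> and \<open>d\<close>. It then suffices to take \<open>k\<close> an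
  identity, or \<open>f\<close> and \<open>g\<close> both identities, and there only unit laws
  remain.\<close>

lemma groupoid_assoc:
  assumes "f \<in> hom C T X" "g \<in> hom C T X" "k \<in> hom C T X" "c \<cdot> f = d \<cdot> g" "c \<cdot> g = d \<cdot> k"
  shows "tri (tri f (e \<cdot> (c \<cdot> f)) g) (e \<cdot> (c \<cdot> g)) k = tri f (e \<cdot> (c \<cdot> f)) (tri g (e \<cdot> (c \<cdot> g)) k)"
proof -
  let ?p = "pb1 C c d" and ?q = "pb2 C c d"
  have cc: "c \<cdot> ?p = d \<cdot> ?q" by (rule pb_comm; simp)
  have cc' [simp]: "c \<cdot> (?p \<cdot> t) = d \<cdot> (?q \<cdot> t)" if "arr t" "cod t = pbo c d" for t by (rule pb_comm') (use that in auto)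
  note [simp] = assms(1-3)[THEN homD]
  let ?Phi = "\<lambda>v k. tri (tri (?p \<cdot> v) (e \<cdot> (c \<cdot> (?p \<cdot> v))) (?q \<cdot> v)) (e \<cdot> (c \<cdot> (?q \<cdot> v))) k"
  let ?Psi = "\<lambda>v k. tri (?p \<cdot> v) (e \<cdot> (c \<cdot> (?p \<cdot> v))) (tri (?q \<cdot> v) (e \<cdot> (c \<cdot> (?q \<cdot> v))) k)"
  have "?Phi (pb_pair C c d f g) k = ?Psi (pb_pair C c d f g) k"
  proof (rule split_pb_induct[where f = "c \<cdot> ?q" and X = "pbo c d" and Z = Y and g = d and Y = X and r = "pb_pair C c d e e" and s = e
        and \<Phi> = ?Phi and \<Psi> = ?Psi and W = X and T = T])
    fix T v k assume vk: "v \<in> hom C T (pbo c d)" "k \<in> hom C T X" "(c \<cdot> ?q) \<cdot> v = d \<cdot> k"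
    note [simp] = vk(1,2)[THEN homD]
    have [simp]: "c \<cdot> (?q \<cdot> v) = d \<cdot> k" using vk(3) by simp
    show "?Phi v k \<in> hom C T X \<and> ?Psi v k \<in> hom C T X \<and>
        (\<forall>S t. t \<in> hom C S T \<longrightarrow> ?Phi (v \<cdot> t) (k \<cdot> t) = ?Phi v k \<cdot> t \<and> ?Psi (v \<cdot> t) (k \<cdot> t) = ?Psi v k \<cdot> t)"
    proof (intro conjI allI impI)
      fix S t assume t: "t \<in> hom C S T"
      have [simp]: "arr t" "cod t = T" using t by auto
      have [simp]: "c \<cdot> (?q \<cdot> (v \<cdot> t)) = d \<cdot> (k \<cdot> t)" using reassoc[OF vk(3), of t] by simp
      show "?Phi (v \<cdot> t) (k \<cdot> t) = ?Phi v k \<cdot> t" "?Psi (v \<cdot> t) (k \<cdot> t) = ?Psi v k \<cdot> t" by simp_all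
    qed simp_all
  qed (use cc assms(4,5) in simp_all)
  thus ?thesis using assms(4,5) by simp
qed

lemma internal_groupoid: "internal_groupoid C X Y groupoid"
proof -
  have cc [simp]: "c \<cdot> pb1 C c d = d \<cdot> pb2 C c d" by (rule pb_comm; simp)
  show ?thesis
    unfolding internal_groupoid_def
  proof (intro conjI allI impI)
    fix T f g k assume a: "f \<in> hom C T X \<and> g \<in> hom C T X \<and> k \<in> hom C T X \<and> gc groupoid \<cdot> f = gd groupoid \<cdot> g \<and> gc groupoid \<cdot> g = gd groupoid \<cdot> k"
    hence [simp]: "arr f" "dom f = T" "cod f = X" "arr g" "dom g = T" "cod g = X" "arr k" "dom k = T" "cod k = X" "c \<cdot> f = d \<cdot> g" "c \<cdot> g = d \<cdot> k" "obj T" by auto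
    show "gcomp C groupoid (gcomp C groupoid f g) k = gcomp C groupoid f (gcomp C groupoid g k)"
      using groupoid_assoc[of f T g k] by (simp add: gcomp_groupoid)
  next
    \<comment> \<open>The inverse of an arrow f is x y^-1 z with y = f and with x, z the identities
      at its codomain and its domain.\<close>
    let ?i = "tri (e \<cdot> c) (ide X) (e \<cdot> d)"
    have "gcomp C groupoid (ide X) ?i = e \<cdot> d"
      using tri_inverse_right[of "ide X" "e \<cdot> d"] by (simp add: gcomp_groupoid)
    moreover have "gcomp C groupoid ?i (ide X) = e \<cdot> c"
      using tri_inverse_left[of "ide X" "e \<cdot> c"] by (simp add: gcomp_groupoid)
    ultimately show "\<exists>i\<in>hom C X X. gd groupoid \<cdot> i = gc groupoid \<and> gc groupoid \<cdot> i = gd groupoid \<and>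
        gcomp C groupoid (ide X) i = ge groupoid \<cdot> gd groupoid \<and> gcomp C groupoid i (ide X) = ge groupoid \<cdot> gc groupoid"
      by (intro bexI[of _ ?i]) simp_all
  qed (simp_all add: gm_groupoid gcomp_groupoid)
qed

end

section \<open>Functors between groupoids and the interchange law\<close>

context semi_abelian_category
begin

lemma commute_groupoid:
  assumes "smith_is_huq C" "d \<in> hom C X Y" "c \<in> hom C X Y" "e \<in> hom C Y X" "d \<cdot> e = ide Y" "c \<cdot> e = ide Y"
    "commute (ker C d) (ker C c)"
  obtains G where "internal_groupoid C X Y G" "gd G = d" "gc G = c" "ge G = e"
proof -
  obtain \<phi> where "smith_cocone C (pb1 C c c) (pb2 C c c) (pb1 C d d) (pb2 C d d) X (ide X) \<phi>"
    using connector[OF assms(1-3,7)] by blast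
  then interpret g: connected_graph C X Y d c e \<phi>
    using assms by unfold_locales
  show thesis by (rule that[OF g.internal_groupoid]) simp_all
qed

lemma groupoidD:
  assumes "internal_groupoid C X Y G"
  shows "arr (gd G)" "dom (gd G) = X" "cod (gd G) = Y" "arr (gc G)" "dom (gc G) = X" "cod (gc G) = Y"
    "arr (ge G)" "dom (ge G) = Y" "cod (ge G) = X" "obj X" "obj Y" "gd G \<cdot> ge G = ide Y" "gc G \<cdot> ge G = ide Y"
    "arr (gm G)" "dom (gm G) = pbo (gc G) (gd G)" "cod (gm G) = X"
  using assms by (auto simp: internal_groupoid_def)

lemma gcomp_simps:
  assumes G: "internal_groupoid C X Y G" and xy: "arr x" "arr y" "dom y = dom x" "cod x = X" "cod y = X" "gc G \<cdot> x = gd G \<cdot> y"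
  shows "arr (gcomp C G x y)" "dom (gcomp C G x y) = dom x" "cod (gcomp C G x y) = X"
    "gd G \<cdot> gcomp C G x y = gd G \<cdot> x" "gc G \<cdot> gcomp C G x y = gc G \<cdot> y"
proof -
  note [simp] = groupoidD[OF G] xy
  have dm: "gd G \<cdot> gm G = gd G \<cdot> pb1 C (gc G) (gd G)" "gc G \<cdot> gm G = gc G \<cdot> pb2 C (gc G) (gd G)"
    using G by (simp_all add: internal_groupoid_def)
  show "arr (gcomp C G x y)" "dom (gcomp C G x y) = dom x" "cod (gcomp C G x y) = X"
    by (simp_all add: gcomp_def)
  show "gd G \<cdot> gcomp C G x y = gd G \<cdot> x" "gc G \<cdot> gcomp C G x y = gc G \<cdot> y"
    using dm[THEN reassoc] by (simp_all add: gcomp_def)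
qed

lemma gcomp_comp:
  assumes G: "internal_groupoid C X Y G" and xy: "arr x" "arr y" "dom y = dom x" "cod x = X" "cod y = X" "gc G \<cdot> x = gd G \<cdot> y"
    and t: "arr t" "cod t = dom x"
  shows "gcomp C G x y \<cdot> t = gcomp C G (x \<cdot> t) (y \<cdot> t)"
  using groupoidD[OF G] xy t by (simp add: gcomp_def)

lemma gcomp_unit:
  assumes G: "internal_groupoid C X Y G" and x: "arr x" "cod x = X"
  shows "gcomp C G (ge G \<cdot> (gd G \<cdot> x)) x = x" "gcomp C G x (ge G \<cdot> (gc G \<cdot> x)) = x"
proof -
  note [simp] = groupoidD[OF G] groupoidD(12,13)[OF G, THEN reassoc] x
  have l: "gcomp C G (ge G \<cdot> gd G) (ide X) = ide X" and r: "gcomp C G (ide X) (ge G \<cdot> gc G) = ide X"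
    using G by (simp_all add: internal_groupoid_def)
  show "gcomp C G (ge G \<cdot> (gd G \<cdot> x)) x = x"
    using gcomp_comp[OF G, of "ge G \<cdot> gd G" "ide X" x] l by simp
  show "gcomp C G x (ge G \<cdot> (gc G \<cdot> x)) = x"
    using gcomp_comp[OF G, of "ide X" "ge G \<cdot> gc G" x] r by simp
qed

text \<open>Preservation of the multiplication is automatic: pairs with one identity jointly cover
  the composable pairs, and on those both sides reduce to \<open>F1\<close> by the unit
  laws.\<close>

lemma graph_morphism_functor:
  assumes G: "internal_groupoid C X Y G" and H: "internal_groupoid C X' Y' H"
    and F: "F1 \<in> hom C X X'" "F0 \<in> hom C Y Y'" "gd H \<cdot> F1 = F0 \<cdot> gd G" "gc H \<cdot> F1 = F0 \<cdot> gc G" "F1 \<cdot> ge G = ge H \<cdot> F0"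
  shows "internal_functor C G H F1 F0"
proof -
  note [simp] = groupoidD[OF G] groupoidD(12,13)[OF G, THEN reassoc] groupoidD[OF H] F(1,2)[THEN homD] F(3-5) F(3-5)[THEN reassoc]
  let ?p = "pb1 C (gc G) (gd G)" and ?q = "pb2 C (gc G) (gd G)"
  have cc: "gc G \<cdot> ?p = gd G \<cdot> ?q" by (rule pb_comm; simp)
  have cc': "gc G \<cdot> (?p \<cdot> t) = gd G \<cdot> (?q \<cdot> t)" if "arr t" "cod t = pbo (gc G) (gd G)" for t by (rule pb_comm') (use that in auto)
  have l: "gm G \<cdot> pb_pair C (gc G) (gd G) (ide X) (ge G \<cdot> gc G) = ide X"
    and r: "gm G \<cdot> pb_pair C (gc G) (gd G) (ge G \<cdot> gd G) (ide X) = ide X"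
    using G by (simp_all add: internal_groupoid_def gcomp_def)
  have "F1 \<cdot> gm G = gcomp C H (F1 \<cdot> ?p) (F1 \<cdot> ?q)"
  proof (rule split_pb_epi[of "gc G" X Y "gd G" X "ge G" "ge G"])
    show "(F1 \<cdot> gm G) \<cdot> pb_pair C (gc G) (gd G) (ide X) (ge G \<cdot> gc G)
      = gcomp C H (F1 \<cdot> ?p) (F1 \<cdot> ?q) \<cdot> pb_pair C (gc G) (gd G) (ide X) (ge G \<cdot> gc G)"
      using l gcomp_unit(2)[OF H, of F1] cc by (simp add: gcomp_comp[OF H])
    show "(F1 \<cdot> gm G) \<cdot> pb_pair C (gc G) (gd G) (ge G \<cdot> gd G) (ide X)
      = gcomp C H (F1 \<cdot> ?p) (F1 \<cdot> ?q) \<cdot> pb_pair C (gc G) (gd G) (ge G \<cdot> gd G) (ide X)"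
      using r gcomp_unit(1)[OF H, of F1] cc by (simp add: gcomp_comp[OF H])
  qed (use cc in \<open>simp_all add: gcomp_simps[OF H]\<close>)
  thus ?thesis unfolding internal_functor_def by simp
qed

lemma functor_gcomp:
  assumes G: "internal_groupoid C X Y G" and H: "internal_groupoid C X' Y' H" and F: "internal_functor C G H F1 F0"
    and xy: "arr x" "arr y" "dom y = dom x" "cod x = X" "cod y = X" "gc G \<cdot> x = gd G \<cdot> y"
  shows "F1 \<cdot> gcomp C G x y = gcomp C H (F1 \<cdot> x) (F1 \<cdot> y)"
proof -
  note [simp] = groupoidD[OF G] groupoidD[OF H] xy
  have [simp]: "arr F1" "dom F1 = X" "cod F1 = X'" "arr F0" "dom F0 = Y" "cod F0 = Y'"
    using F by (auto simp: internal_functor_def)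
  have dc: "gd H \<cdot> F1 = F0 \<cdot> gd G" "gc H \<cdot> F1 = F0 \<cdot> gc G"
    and m: "F1 \<cdot> gm G = gcomp C H (F1 \<cdot> pb1 C (gc G) (gd G)) (F1 \<cdot> pb2 C (gc G) (gd G))"
    using F by (auto simp: internal_functor_def)
  have cc: "gc G \<cdot> pb1 C (gc G) (gd G) = gd G \<cdot> pb2 C (gc G) (gd G)" by (rule pb_comm; simp)
  show ?thesis
    using m[THEN reassoc, of "pb_pair C (gc G) (gd G) x y"] cc
    by (simp add: gcomp_def[of C G] gcomp_comp[OF H] gcomp_simps[OF H] dc[THEN reassoc])
qed

text \<open>For interchange, a quadruple of squares is read as two \<open>gU\<close>-composable
  pairs that match along \<open>gL\<close>. By \<open>split_pb_induct\<close> one of these pairs may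
  be taken to consist of \<open>gL\<close>-identities; functoriality of \<open>ge (gL G)\<close> and
  the unit laws of \<open>gL\<close> then settle the equation.\<close>

lemma double_groupoidI:
  assumes U: "internal_groupoid C A B (gU G)" and L: "internal_groupoid C A E (gL G)"
    and R: "internal_groupoid C B D (gR G)" and Dn: "internal_groupoid C E D (gD G)"
    and dc: "gd (gR G) \<cdot> gd (gU G) = gd (gD G) \<cdot> gd (gL G)" "gd (gR G) \<cdot> gc (gU G) = gc (gD G) \<cdot> gd (gL G)"
      "gc (gR G) \<cdot> gd (gU G) = gd (gD G) \<cdot> gc (gL G)" "gc (gR G) \<cdot> gc (gU G) = gc (gD G) \<cdot> gc (gL G)"
    and eL: "gd (gU G) \<cdot> ge (gL G) = ge (gR G) \<cdot> gd (gD G)" "gc (gU G) \<cdot> ge (gL G) = ge (gR G) \<cdot> gc (gD G)"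
    and eU: "gd (gL G) \<cdot> ge (gU G) = ge (gD G) \<cdot> gd (gR G)" "gc (gL G) \<cdot> ge (gU G) = ge (gD G) \<cdot> gc (gR G)"
    and ee: "ge (gU G) \<cdot> ge (gR G) = ge (gL G) \<cdot> ge (gD G)"
  shows "double_groupoid C A B E D G"
proof -
  note [simp] = groupoidD[OF U] groupoidD[OF L] groupoidD[OF R] groupoidD[OF Dn]
    groupoidD(12,13)[OF U, THEN reassoc] groupoidD(12,13)[OF L, THEN reassoc] groupoidD(12,13)[OF R, THEN reassoc] groupoidD(12,13)[OF Dn, THEN reassoc]
  have F: "internal_functor C (gL G) (gR G) (gd (gU G)) (gd (gD G))"
    "internal_functor C (gL G) (gR G) (gc (gU G)) (gc (gD G))"
    "internal_functor C (gR G) (gL G) (ge (gU G)) (ge (gD G))"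
    "internal_functor C (gU G) (gD G) (gd (gL G)) (gd (gR G))"
    "internal_functor C (gU G) (gD G) (gc (gL G)) (gc (gR G))"
    "internal_functor C (gD G) (gU G) (ge (gL G)) (ge (gR G))"
    by (rule graph_morphism_functor[OF L R] graph_morphism_functor[OF R L] graph_morphism_functor[OF U Dn]
        graph_morphism_functor[OF Dn U]; simp add: dc eL eU ee)+
  note fd = functor_gcomp[OF U Dn F(4)] and fc = functor_gcomp[OF U Dn F(5)] and fe = functor_gcomp[OF Dn U F(6)]
  note ld = functor_gcomp[OF L R F(1)] and lc = functor_gcomp[OF L R F(2)]
  define V W where "V = pbo (gc (gU G)) (gd (gU G))" and "W = pbo (gc (gD G)) (gd (gD G))"
  define p q p' q' where "p = pb1 C (gc (gU G)) (gd (gU G))" and "q = pb2 C (gc (gU G)) (gd (gU G))"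
    and "p' = pb1 C (gc (gD G)) (gd (gD G))" and "q' = pb2 C (gc (gD G)) (gd (gD G))"
  have [simp]: "arr p" "dom p = V" "cod p = A" "arr q" "dom q = V" "cod q = A" "obj V"
    "arr p'" "dom p' = W" "cod p' = E" "arr q'" "dom q' = W" "cod q' = E" "obj W"
    unfolding p_def q_def p'_def q'_def V_def W_def by simp_all
  have W_ext: "w = w'" if "w \<in> hom C T W" "w' \<in> hom C T W" "p' \<cdot> w = p' \<cdot> w'" "q' \<cdot> w = q' \<cdot> w'" for w w' T
    using pb_ext[of w T "gc (gD G)" "gd (gD G)" w'] that unfolding p'_def q'_def W_def by simp
  have pq: "gc (gU G) \<cdot> p = gd (gU G) \<cdot> q" "gc (gD G) \<cdot> p' = gd (gD G) \<cdot> q'"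
    unfolding p_def q_def p'_def q'_def by (rule pb_comm; simp)+
  note pq' = pq[THEN reassoc]
  \<comment> \<open>The reflexive graph that \<open>gL\<close> induces, componentwise, between
    composable pairs of \<open>gU\<close> and composable pairs of \<open>gD\<close>: codomain,
    domain and unit.\<close>
  define f g s where "f = pb_pair C (gc (gD G)) (gd (gD G)) (gc (gL G) \<cdot> p) (gc (gL G) \<cdot> q)"
    and "g = pb_pair C (gc (gD G)) (gd (gD G)) (gd (gL G) \<cdot> p) (gd (gL G) \<cdot> q)"
    and "s = pb_pair C (gc (gU G)) (gd (gU G)) (ge (gL G) \<cdot> p') (ge (gL G) \<cdot> q')"
  note dcr = dc dc[THEN reassoc] and elr = eL eL[THEN reassoc] and eur = eU eU[THEN reassoc]
  have fc1: "gc (gD G) \<cdot> (gc (gL G) \<cdot> p) = gd (gD G) \<cdot> (gc (gL G) \<cdot> q)"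
    using dc(4)[THEN reassoc, of p] dc(3)[THEN reassoc, of q] pq(1) by simp
  have gc1: "gc (gD G) \<cdot> (gd (gL G) \<cdot> p) = gd (gD G) \<cdot> (gd (gL G) \<cdot> q)"
    using dc(2)[THEN reassoc, of p] dc(1)[THEN reassoc, of q] pq(1) by simp
  have sc1: "gc (gU G) \<cdot> (ge (gL G) \<cdot> p') = gd (gU G) \<cdot> (ge (gL G) \<cdot> q')"
    using eL(2)[THEN reassoc, of p'] eL(1)[THEN reassoc, of q'] pq(2) by simp
  have f: "arr f" "dom f = V" "cod f = W" "p' \<cdot> f = gc (gL G) \<cdot> p" "q' \<cdot> f = gc (gL G) \<cdot> q"
    unfolding f_def p'_def q'_def W_def using fc1 by simp_all
  have g: "arr g" "dom g = V" "cod g = W" "p' \<cdot> g = gd (gL G) \<cdot> p" "q' \<cdot> g = gd (gL G) \<cdot> q"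
    unfolding g_def p'_def q'_def W_def using gc1 by simp_all
  have s: "arr s" "dom s = W" "cod s = V" "p \<cdot> s = ge (gL G) \<cdot> p'" "q \<cdot> s = ge (gL G) \<cdot> q'"
    unfolding s_def p_def q_def V_def using sc1 by simp_all
  note [simp] = f(1-3) g(1-3) s(1-3)
  note fgs = f(4,5) g(4,5) s(4,5) f(4,5)[THEN reassoc] g(4,5)[THEN reassoc] s(4,5)[THEN reassoc]
  have fs: "f \<cdot> s = ide W" "g \<cdot> s = ide W"
    by (rule W_ext[of _ W], simp_all add: fgs)+
  let ?Phi = "\<lambda>x y. gcomp C (gL G) (gcomp C (gU G) (p \<cdot> x) (q \<cdot> x)) (gcomp C (gU G) (p \<cdot> y) (q \<cdot> y))"
  let ?Psi = "\<lambda>x y. gcomp C (gU G) (gcomp C (gL G) (p \<cdot> x) (p \<cdot> y)) (gcomp C (gL G) (q \<cdot> x) (q \<cdot> y))"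
  have main: "?Phi x y = ?Psi x y" if xy: "x \<in> hom C T V" "y \<in> hom C T V" "f \<cdot> x = g \<cdot> y" for x y T
  proof (rule split_pb_induct[where f = f and g = g and r = s and s = s and X = V and Y = V and Z = W and \<Phi> = ?Phi and \<Psi> = ?Psi and W = A and T = T])
    fix T x y assume xy: "x \<in> hom C T V" "y \<in> hom C T V" "f \<cdot> x = g \<cdot> y"
    note [simp] = xy(1,2)[THEN homD]
    have 1: "gc (gL G) \<cdot> (p \<cdot> x) = gd (gL G) \<cdot> (p \<cdot> y)"
      using f(4)[THEN reassoc, of x] g(4)[THEN reassoc, of y] xy(3) by simp
    have 2: "gc (gL G) \<cdot> (q \<cdot> x) = gd (gL G) \<cdot> (q \<cdot> y)"
      using f(5)[THEN reassoc, of x] g(5)[THEN reassoc, of y] xy(3) by simp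
    have px: "gc (gU G) \<cdot> (p \<cdot> x) = gd (gU G) \<cdot> (q \<cdot> x)" "gc (gU G) \<cdot> (p \<cdot> y) = gd (gU G) \<cdot> (q \<cdot> y)"
      using pq'(1)[of x] pq'(1)[of y] by simp_all
    note sU = gcomp_simps[OF U] and sL = gcomp_simps[OF L]
    have a: "gc (gL G) \<cdot> gcomp C (gU G) (p \<cdot> x) (q \<cdot> x) = gd (gL G) \<cdot> gcomp C (gU G) (p \<cdot> y) (q \<cdot> y)"
      using 1 2 px by (simp add: fc fd)
    have b: "gc (gU G) \<cdot> gcomp C (gL G) (p \<cdot> x) (p \<cdot> y) = gd (gU G) \<cdot> gcomp C (gL G) (q \<cdot> x) (q \<cdot> y)"
      using 1 2 px by (simp add: lc ld)
    have t1: "arr (?Phi x y) \<and> dom (?Phi x y) = T \<and> cod (?Phi x y) = A" using a px by (simp add: sU sL)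
    have t2: "arr (?Psi x y) \<and> dom (?Psi x y) = T \<and> cod (?Psi x y) = A" using b 1 2 by (simp add: sU sL)
    show "?Phi x y \<in> hom C T A \<and> ?Psi x y \<in> hom C T A \<and>
        (\<forall>S t. t \<in> hom C S T \<longrightarrow> ?Phi (x \<cdot> t) (y \<cdot> t) = ?Phi x y \<cdot> t \<and> ?Psi (x \<cdot> t) (y \<cdot> t) = ?Psi x y \<cdot> t)"
    proof (intro conjI allI impI)
      fix S t assume t: "t \<in> hom C S T"
      have [simp]: "arr t" "cod t = T" using t by auto
      show "?Phi (x \<cdot> t) (y \<cdot> t) = ?Phi x y \<cdot> t" using a px by (simp add: sU sL gcomp_comp[OF U] gcomp_comp[OF L])
      show "?Psi (x \<cdot> t) (y \<cdot> t) = ?Psi x y \<cdot> t" using b 1 2 by (simp add: sU sL gcomp_comp[OF U] gcomp_comp[OF L])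
    qed (use t1 t2 in simp_all)
  next
    note sU = gcomp_simps[OF U]
    \<comment> \<open>The composite of two \<open>gL\<close>-identities in \<open>gU\<close> is
      again a \<open>gL\<close>-identity, namely the one at the \<open>gL\<close>-codomain of the
      composite of \<open>p\<close> and \<open>q\<close>.\<close>
    have h1: "gcomp C (gU G) (ge (gL G) \<cdot> (gc (gL G) \<cdot> p)) (ge (gL G) \<cdot> (gc (gL G) \<cdot> q)) = ge (gL G) \<cdot> (gc (gL G) \<cdot> gcomp C (gU G) p q)"
      using pq(1) fc1 by (simp add: fc fe)
    show "?Phi (ide V) (s \<cdot> f) = ?Psi (ide V) (s \<cdot> f)"
      using pq(1) h1 by (simp add: fgs sU gcomp_unit[OF L])
    have h2: "gcomp C (gU G) (ge (gL G) \<cdot> (gd (gL G) \<cdot> p)) (ge (gL G) \<cdot> (gd (gL G) \<cdot> q)) = ge (gL G) \<cdot> (gd (gL G) \<cdot> gcomp C (gU G) p q)"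
      using pq(1) gc1 by (simp add: fd fe)
    show "?Phi (s \<cdot> g) (ide V) = ?Psi (s \<cdot> g) (ide V)"
      using pq(1) h2 by (simp add: fgs sU gcomp_unit[OF L])
  qed (use xy fs in simp_all)
  have inter: "gcomp C (gL G) (gcomp C (gU G) a b) (gcomp C (gU G) a' b') = gcomp C (gU G) (gcomp C (gL G) a a') (gcomp C (gL G) b b')"
    if ab: "a \<in> hom C T A" "b \<in> hom C T A" "a' \<in> hom C T A" "b' \<in> hom C T A" "gc (gU G) \<cdot> a = gd (gU G) \<cdot> b" "gc (gU G) \<cdot> a' = gd (gU G) \<cdot> b'"
        "gc (gL G) \<cdot> a = gd (gL G) \<cdot> a'" "gc (gL G) \<cdot> b = gd (gL G) \<cdot> b'" for T a b a' b'
  proof -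
    note [simp] = ab(1-4)[THEN homD]
    define x y where "x = pb_pair C (gc (gU G)) (gd (gU G)) a b" and "y = pb_pair C (gc (gU G)) (gd (gU G)) a' b'"
    have x: "arr x" "dom x = T" "cod x = V" "p \<cdot> x = a" "q \<cdot> x = b" unfolding x_def p_def q_def V_def using ab(5) by simp_all
    have y: "arr y" "dom y = T" "cod y = V" "p \<cdot> y = a'" "q \<cdot> y = b'" unfolding y_def p_def q_def V_def using ab(6) by simp_all
    note [simp] = x(1-3) y(1-3)
    have "f \<cdot> x = g \<cdot> y"
      by (rule W_ext[of _ T]) (simp_all add: fgs x y ab(7,8))
    from main[OF _ _ this, of T] show ?thesis by (simp add: x y)
  qed
  show ?thesis
    unfolding double_groupoid_def using U L R Dn F inter by blast
qed

section \<open>Semidirect products\<close>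

lemma kflat_simps [simp]:
  assumes "obj A" "obj X"
  shows "arr (kflat C A X)" "dom (kflat C A X) = flat C A X" "cod (kflat C A X) = coprod C A X" "obj (flat C A X)"
    "retr A X \<cdot> kflat C A X = zero C (flat C A X) A"
  using assms ker_simps[of "retr A X"] by (simp_all add: kflat_def flat_def)

lemma kflat_lift:
  assumes "obj A" "obj X" "u \<in> hom C T (coprod C A X)" "retr A X \<cdot> u = zero C T A"
  obtains w where "w \<in> hom C T (flat C A X)" "kflat C A X \<cdot> w = u"
  using ker_lift[of "retr A X" u T] assms that by (auto simp: kflat_def flat_def)

lemma kflat_ext:
  assumes "obj A" "obj X" "w \<in> hom C T (flat C A X)" "w' \<in> hom C T (flat C A X)" "kflat C A X \<cdot> w = kflat C A X \<cdot> w'"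
  shows "w = w'"
  using monicD[OF ker_monic, of "retr A X" w w' T] assms by (auto simp: kflat_def flat_def)

lemma kflat_the:
  assumes "obj A" "obj X" "u \<in> hom C T (coprod C A X)" "retr A X \<cdot> u = zero C T A"
    and t: "t = (THE w. w \<in> hom C T (flat C A X) \<and> kflat C A X \<cdot> w = u)"
  shows "t \<in> hom C T (flat C A X) \<and> kflat C A X \<cdot> t = u"
proof -
  obtain w where w: "w \<in> hom C T (flat C A X)" "kflat C A X \<cdot> w = u" using kflat_lift[OF assms(1-4)] by blast
  hence "\<exists>!w. w \<in> hom C T (flat C A X) \<and> kflat C A X \<cdot> w = u" using kflat_ext[OF assms(1,2)] by (metis (no_types, lifting))
  from theI'[OF this] show ?thesis unfolding t .
qed

lemma flat_map:
  assumes "f \<in> hom C A B" "g \<in> hom C X Y"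
  shows "flat_map C f g \<in> hom C (flat C A X) (flat C B Y) \<and>
    kflat C B Y \<cdot> flat_map C f g = copair C (inl C B Y \<cdot> f) (inr C B Y \<cdot> g) \<cdot> kflat C A X"
proof -
  note [simp] = assms[THEN homD]
  have 1: "copair C f (zero C X B) \<cdot> kflat C A X = zero C (flat C A X) B"
    using comp_copair'[of "ide A" "zero C X A" f "kflat C A X"] by simp
  show ?thesis
    by (rule kflat_the) (use 1 in \<open>simp_all add: flat_map_def cosum_def\<close>)
qed

lemma flat_map_simps [simp]:
  assumes "arr f" "arr g"
  shows "arr (flat_map C f g)" "dom (flat_map C f g) = flat C (dom f) (dom g)" "cod (flat_map C f g) = flat C (cod f) (cod g)"
  using flat_map[of f "dom f" "cod f" g "dom g" "cod g"] assms by auto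

lemma kflat_flat_map:
  assumes "arr f" "arr g" "cod f = B" "cod g = Y"
  shows "kflat C B Y \<cdot> flat_map C f g = copair C (inl C B Y \<cdot> f) (inr C B Y \<cdot> g) \<cdot> kflat C (dom f) (dom g)"
  using flat_map[of f "dom f" B g "dom g" Y] assms by auto

lemma copair_flat_map:
  assumes "f \<in> hom C A B" "g \<in> hom C X Y" "u \<in> hom C B T" "v \<in> hom C Y T"
  shows "copair C u v \<cdot> (kflat C B Y \<cdot> flat_map C f g) = copair C (u \<cdot> f) (v \<cdot> g) \<cdot> kflat C A X"
  using flat_map[OF assms(1,2)] assms[THEN homD] by simp

text \<open>Reduces conjugation to a copairing on the kernel object, the form in which all actions
  are computed below.\<close>

lemma conjugation_flat_map:
  assumes "u \<in> hom C A T" "v \<in> hom C X T"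
  shows "conjugation C T \<cdot> flat_map C u v = copair C u v \<cdot> kflat C A X"
  using copair_flat_map[OF assms, of "ide T" T "ide T"] assms[THEN homD] by (simp add: conjugation_def)

lemma conjugation_simps [simp]:
  assumes "obj A" shows "arr (conjugation C A)" "dom (conjugation C A) = flat C A A" "cod (conjugation C A) = A"
  using assms by (simp_all add: conjugation_def)

lemma flat_unit:
  assumes "obj A" "obj X"
  shows "flat_unit C A X \<in> hom C X (flat C A X) \<and> kflat C A X \<cdot> flat_unit C A X = inr C A X"
  by (rule kflat_the) (use assms in \<open>simp_all add: flat_unit_def\<close>)

lemma flat_mult:
  assumes "obj A" "obj X"
  shows "flat_mult C A X \<in> hom C (flat C A (flat C A X)) (flat C A X) \<and>
    kflat C A X \<cdot> flat_mult C A X = copair C (inl C A X) (kflat C A X) \<cdot> kflat C A (flat C A X)"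
  by (rule kflat_the) (use assms in \<open>simp_all add: flat_mult_def\<close>)

end

section \<open>The split extension and the groupoid of a crossed module\<close>

locale xmodule = semi_abelian_category C for C :: "('o, 'a) cat" (structure) +
  fixes X A :: 'o and \<delta> \<xi> :: 'a
  assumes xmodule: "crossed_module C X A (\<delta>, \<xi>)"
begin

abbreviation \<sigma> where "\<sigma> \<equiv> sd_quot C (\<delta>, \<xi>)"
abbreviation S where "S \<equiv> cod (sd_quot C (\<delta>, \<xi>))"
abbreviation d where "d \<equiv> sd_d C (\<delta>, \<xi>)"
abbreviation c where "c \<equiv> sd_c C (\<delta>, \<xi>)"
abbreviation e where "e \<equiv> sd_e C (\<delta>, \<xi>)"
abbreviation k where "k \<equiv> sd_k C (\<delta>, \<xi>)"

lemma bdry_simps [simp]: "arr \<delta>" "dom \<delta> = X" "cod \<delta> = A" "arr \<xi>" "dom \<xi> = flat C A X" "cod \<xi> = X" "obj X" "obj A"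
  and action_unit: "\<xi> \<cdot> flat_unit C A X = ide X"
  and action_mult: "\<xi> \<cdot> flat_mult C A X = \<xi> \<cdot> flat_map C (ide A) \<xi>"
  and equivariant: "\<delta> \<cdot> \<xi> = conjugation C A \<cdot> flat_map C (ide A) \<delta>"
  and peiffer: "\<xi> \<cdot> flat_map C \<delta> (ide X) = conjugation C X"
  using xmodule by (auto simp: crossed_module_def is_action_def)

lemma sd_quot: "is_coequaliser C (inr C A X \<cdot> \<xi>) (kflat C A X) \<sigma>"
proof -
  obtain q where "is_coequaliser C (inr C A X \<cdot> \<xi>) (kflat C A X) q"
    using coequaliser_exists[of "inr C A X \<cdot> \<xi>" "flat C A X" "coprod C A X" "kflat C A X"] by auto
  thus ?thesis by (simp add: sd_quot_def someI)
qed

lemma sd_quot_simps [simp]: "arr \<sigma>" "dom \<sigma> = coprod C A X" "obj S"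
  using is_coequaliserD(5,6)[OF sd_quot] by simp_all

lemma sd_quot_regular: "regular_epi C \<sigma>"
  by (rule is_coequaliserD(8)[OF sd_quot])

lemma sd_quot_kflat: "\<sigma> \<cdot> kflat C A X = \<sigma> \<cdot> (inr C A X \<cdot> \<xi>)"
  using is_coequaliserD(7)[OF sd_quot] by simp

lemma sd_quot_the:
  assumes "u \<in> hom C (coprod C A X) T" "u \<cdot> (inr C A X \<cdot> \<xi>) = u \<cdot> kflat C A X"
    and t: "t = (THE w. w \<in> hom C S T \<and> w \<cdot> \<sigma> = u)"
  shows "t \<in> hom C S T \<and> t \<cdot> \<sigma> = u"
proof -
  obtain w where w: "w \<in> hom C S T" "w \<cdot> \<sigma> = u" using is_coequaliser_desc[OF sd_quot, of u T] assms(1,2) by auto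
  hence "\<exists>!w. w \<in> hom C S T \<and> w \<cdot> \<sigma> = u" using regular_epi_epi[OF sd_quot_regular] by (metis (no_types, lifting))
  from theI'[OF this] show ?thesis unfolding t .
qed

lemma sd_d: "d \<in> hom C S A \<and> d \<cdot> \<sigma> = retr A X"
  by (rule sd_quot_the) (simp_all add: sd_d_def Let_def)

text \<open>Equivariance of \<open>\<delta>\<close> is precisely what lets the copairing of the
  identity and \<open>\<delta>\<close> coequalise the pair defining \<open>\<sigma>\<close>.\<close>

lemma sd_c: "c \<in> hom C S A \<and> c \<cdot> \<sigma> = copair C (ide A) \<delta>"
  by (rule sd_quot_the) (simp_all add: sd_c_def Let_def equivariant conjugation_flat_map)

lemma sd_simps [simp]:
  "arr d" "dom d = S" "cod d = A" "arr c" "dom c = S" "cod c = A"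
  "arr e" "dom e = A" "cod e = S" "arr k" "dom k = X" "cod k = S"
  using sd_d sd_c by (simp_all add: sd_e_def sd_k_def)

lemma sd_laws [simp]:
  "d \<cdot> e = ide A" "c \<cdot> e = ide A" "d \<cdot> k = zero C X A" "c \<cdot> k = \<delta>"
  using sd_d[THEN conjunct2, THEN reassoc] sd_c[THEN conjunct2, THEN reassoc] by (simp_all add: sd_e_def sd_k_def)

lemmas sd_laws' [simp] = sd_laws[THEN reassoc]

lemma sd_quot_copair: "\<sigma> = copair C e k"
  by (rule coprod_ext[of _ A X S]) (simp_all add: sd_e_def sd_k_def)

text \<open>The coequaliser equation of \<open>\<sigma>\<close>, read as: inside the semidirect
  product the action is conjugation.\<close>

lemma sd_conj: "k \<cdot> \<xi> = copair C e k \<cdot> kflat C A X"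
  unfolding sd_quot_copair[symmetric] sd_quot_kflat by (simp add: sd_k_def)

text \<open>
  The kernel pair of \<open>\<sigma>\<close> is the image of the reflexive pair \<open>A + (A \<flat> X) \<rightrightarrows> A + X\<close>. Restricted to the
  kernels over \<open>A\<close> this pair becomes \<open>A \<flat> (A \<flat> X) \<rightrightarrows> A \<flat> X\<close>, whose coequaliser is \<open>\<xi>\<close>.
\<close>

lemma sd_kernel: "is_kernel C d k"
proof -
  let ?kf = "kflat C A X" and ?FX = "flat C A X"
  define \<eta> where "\<eta> = flat_unit C A X"
  have \<eta>: "arr \<eta>" "dom \<eta> = X" "cod \<eta> = ?FX" "?kf \<cdot> \<eta> = inr C A X" "\<xi> \<cdot> \<eta> = ide X"
    using flat_unit[of A X] action_unit unfolding \<eta>_def by auto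
  note [simp] = \<eta>(1-3)
  \<comment> \<open>Adjoining \<open>A\<close> makes the defining pair of \<open>\<sigma>\<close>
    reflexive; the common section comes from the unit of the monad, through
    \<open>action_unit\<close> for \<open>?g\<close>.\<close>
  let ?f = "copair C (inl C A X) ?kf" and ?g = "copair C (inl C A X) (inr C A X \<cdot> \<xi>)"
  have fg: "?f \<in> hom C (coprod C A ?FX) (coprod C A X)" "?g \<in> hom C (coprod C A ?FX) (coprod C A X)"
    "copair C (inl C A ?FX) (inr C A ?FX \<cdot> \<eta>) \<in> hom C (coprod C A X) (coprod C A ?FX)"
    "?f \<cdot> copair C (inl C A ?FX) (inr C A ?FX \<cdot> \<eta>) = ide (coprod C A X)"
    "?g \<cdot> copair C (inl C A ?FX) (inr C A ?FX \<cdot> \<eta>) = ide (coprod C A X)"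
    using \<eta>(4,5) by simp_all
  obtain r r1 r2 R q where r: "regular_epi C r" "r \<in> hom C (coprod C A ?FX) R" "r1 \<in> hom C R (coprod C A X)" "r2 \<in> hom C R (coprod C A X)"
    "r1 \<cdot> r = ?f" "r2 \<cdot> r = ?g" and q: "is_coequaliser C ?f ?g q" "is_pullback C q q r1 r2"
    by (rule reflexive_pair[OF fg])
  note [simp] = r(2-4)[THEN homD] is_coequaliserD(5)[OF q(1)]
  have [simp]: "dom q = coprod C A X" using is_coequaliserD(6)[OF q(1)] by simp
  have "q \<cdot> ?f \<cdot> inr C A ?FX = q \<cdot> ?g \<cdot> inr C A ?FX"
    using is_coequaliserD(7)[OF q(1), THEN reassoc, of "inr C A ?FX"] by simp
  hence "q \<cdot> (inr C A X \<cdot> \<xi>) = q \<cdot> ?kf" by simp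
  \<comment> \<open>This transfers identifications: what \<open>\<sigma>\<close> identifies is also
    identified by \<open>q\<close>, whose kernel pair is known.\<close>
  then obtain z where z: "z \<in> hom C S (cod q)" "z \<cdot> \<sigma> = q"
    using is_coequaliser_desc[OF sd_quot, of q "cod q"] by auto
  have [simp]: "arr z" "dom z = S" using z(1) by auto
  let ?K = "dom (ker C d)" and ?\<kappa> = "ker C d"
  have d\<sigma>: "d \<cdot> \<sigma> = retr A X" using sd_d by blast
  have "d \<cdot> (\<sigma> \<cdot> ?kf) = zero C ?FX A" using d\<sigma>[THEN reassoc, of ?kf] by simp
  then obtain s where s: "s \<in> hom C ?FX ?K" "?\<kappa> \<cdot> s = \<sigma> \<cdot> ?kf"
    using ker_lift[of d "\<sigma> \<cdot> ?kf" ?FX] by auto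
  note [simp] = s(1)[THEN homD]
  \<comment> \<open>As a pullback of \<open>\<sigma>\<close>, the arrow \<open>s\<close> onto the
    true kernel of \<open>d\<close> is a regular epimorphism; it remains to see that it is
    \<open>\<xi>\<close> up to isomorphism.\<close>
  have "is_pullback C \<sigma> ?\<kappa> ?kf s"
  proof (rule is_pullbackI[where V = ?FX])
    fix T u v assume uv: "u \<in> hom C T (dom \<sigma>)" "v \<in> hom C T (dom ?\<kappa>)" "\<sigma> \<cdot> u = ?\<kappa> \<cdot> v"
    note [simp] = uv(1,2)[THEN homD]
    have "retr A X \<cdot> u = zero C T A" using d\<sigma>[THEN reassoc, of u] uv(3) by simp
    then obtain w where w: "w \<in> hom C T ?FX" "?kf \<cdot> w = u" using kflat_lift[of A X u T] by auto
    note [simp] = w(1)[THEN homD]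
    have "?\<kappa> \<cdot> (s \<cdot> w) = ?\<kappa> \<cdot> v" using s(2)[THEN reassoc, of w] w(2) uv(3) by simp
    hence "s \<cdot> w = v" by (rule monicD[OF ker_monic[OF sd_simps(1)], of _ _ T]) simp_all
    thus "\<exists>w. w \<in> hom C T ?FX \<and> ?kf \<cdot> w = u \<and> s \<cdot> w = v" using w by blast
  next
    fix T w w' assume "w \<in> hom C T ?FX" "w' \<in> hom C T ?FX" "?kf \<cdot> w = ?kf \<cdot> w'"
    thus "w = w'" using kflat_ext[of A X w T w'] by simp
  qed (use s in simp_all)
  hence sr: "regular_epi C s" by (rule regular_epi_pb[OF sd_quot_regular])
  \<comment> \<open>Two elements identified by \<open>s\<close> are related by \<open>R\<close>, and
    over a cover they come from an element \<open>p\<close> of the coproduct of \<open>A\<close>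
    with the kernel object; that element lies over zero in \<open>A\<close>.\<close>
  have "\<xi> \<cdot> pb1 C s s = \<xi> \<cdot> pb2 C s s"
  proof -
    define u v T where "u = pb1 C s s" and "v = pb2 C s s" and "T = pbo s s"
    have uv: "arr u" "dom u = T" "cod u = ?FX" "arr v" "dom v = T" "cod v = ?FX" "s \<cdot> u = s \<cdot> v"
      unfolding u_def v_def T_def using pb_comm[of s s] by simp_all
    note [simp] = uv(1-6)
    have "\<sigma> \<cdot> (?kf \<cdot> u) = \<sigma> \<cdot> (?kf \<cdot> v)" using s(2)[THEN reassoc, of u] s(2)[THEN reassoc, of v] uv(7) by simp
    hence "q \<cdot> (?kf \<cdot> u) = q \<cdot> (?kf \<cdot> v)" using z(2)[THEN reassoc, of "?kf \<cdot> u"] z(2)[THEN reassoc, of "?kf \<cdot> v"] by simp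
    then obtain w where w: "w \<in> hom C T R" "r1 \<cdot> w = ?kf \<cdot> u" "r2 \<cdot> w = ?kf \<cdot> v"
      using is_pullback_lift[OF q(2), of "?kf \<cdot> u" T "?kf \<cdot> v"] by auto
    note [simp] = w(1)[THEN homD]
    define t p where "t = pb2 C r w" and "p = pb1 C r w"
    have t: "regular_epi C t" unfolding t_def by (rule regular_epi_pb2[OF r(1)]) simp_all
    define T' where "T' = dom t"
    have tp [simp]: "arr t" "dom t = T'" "cod t = T" "arr p" "dom p = T'" "cod p = coprod C A ?FX" "obj T'"
      and rp: "r \<cdot> p = w \<cdot> t"
      unfolding T'_def t_def p_def using pb_comm[of r w] by simp_all
    have fp: "?f \<cdot> p = ?kf \<cdot> (u \<cdot> t)"
      using r(5)[THEN reassoc, of p] rp w(2)[THEN reassoc, of t] by simp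
    have gp: "?g \<cdot> p = ?kf \<cdot> (v \<cdot> t)"
      using r(6)[THEN reassoc, of p] rp w(3)[THEN reassoc, of t] by simp
    have kf0: "retr A X \<cdot> (?kf \<cdot> (u \<cdot> t)) = zero C T' A"
      using kflat_simps(5)[of A X, THEN reassoc, of "u \<cdot> t"] by simp
    have "retr A ?FX \<cdot> p = retr A X \<cdot> (?f \<cdot> p)" by simp
    also have "\<dots> = zero C T' A" unfolding fp by (rule kf0)
    finally obtain y where y: "y \<in> hom C T' (flat C A ?FX)" "kflat C A ?FX \<cdot> y = p"
      using kflat_lift[of A ?FX p T'] by auto
    note [simp] = y(1)[THEN homD]
    have \<mu>: "arr (flat_mult C A X)" "dom (flat_mult C A X) = flat C A ?FX" "cod (flat_mult C A X) = ?FX"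
      "?kf \<cdot> flat_mult C A X = ?f \<cdot> kflat C A ?FX" using flat_mult[of A X] by auto
    note [simp] = \<mu>(1-3)
    have 1: "flat_mult C A X \<cdot> y = u \<cdot> t"
      by (rule kflat_ext[of A X _ T']) (use \<mu>(4)[THEN reassoc, of y] y(2) fp in simp_all)
    have 2: "flat_map C (ide A) \<xi> \<cdot> y = v \<cdot> t"
      by (rule kflat_ext[of A X _ T']) (use kflat_flat_map[of "ide A" \<xi> A X, THEN reassoc, of y] y(2) gp in simp_all)
    have "(\<xi> \<cdot> u) \<cdot> t = (\<xi> \<cdot> v) \<cdot> t"
      using action_mult[THEN reassoc, of y] 1 2 by simp
    hence "\<xi> \<cdot> u = \<xi> \<cdot> v" by (rule regular_epi_epi[OF t, of _ _ X]) simp_all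
    thus ?thesis unfolding u_def v_def .
  qed
  then obtain \<rho> where \<rho>: "\<rho> \<in> hom C ?K X" "\<rho> \<cdot> s = \<xi>"
    using regular_epi_desc[OF sr, of \<xi> X] by auto
  note [simp] = \<rho>(1)[THEN homD]
  define k' where "k' = s \<cdot> \<eta>"
  have k': "arr k'" "dom k' = X" "cod k' = ?K" "?\<kappa> \<cdot> k' = k"
    unfolding k'_def using s(2)[THEN reassoc, of \<eta>] \<eta>(4) by (simp_all add: sd_k_def)
  note [simp] = k'(1-3)
  have \<rho>k: "\<rho> \<cdot> k' = ide X" unfolding k'_def using \<rho>(2)[THEN reassoc, of \<eta>] \<eta>(5) by simp
  have "?\<kappa> \<cdot> (k' \<cdot> \<xi>) = ?\<kappa> \<cdot> s"
    using k'(4)[THEN reassoc, of \<xi>] s(2) sd_quot_kflat by (simp add: sd_k_def)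
  hence k\<xi>: "k' \<cdot> \<xi> = s" by (rule monicD[OF ker_monic[OF sd_simps(1)], of _ _ ?FX]) simp_all
  have "(k' \<cdot> \<rho>) \<cdot> s = ide ?K \<cdot> s" using \<rho>(2) k\<xi> by simp
  hence k\<rho>: "k' \<cdot> \<rho> = ide ?K" by (rule regular_epi_epi[OF sr, of _ _ ?K]) simp_all
  show ?thesis
  proof (rule is_kernelI)
    show "monic C k"
    proof (rule monicI)
      fix u v T assume uv: "u \<in> hom C T (dom k)" "v \<in> hom C T (dom k)" "k \<cdot> u = k \<cdot> v"
      note [simp] = uv(1,2)[THEN homD]
      have "?\<kappa> \<cdot> (k' \<cdot> u) = ?\<kappa> \<cdot> (k' \<cdot> v)" using k'(4)[THEN reassoc, of u] k'(4)[THEN reassoc, of v] uv(3) by simp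
      hence "k' \<cdot> u = k' \<cdot> v" by (rule monicD[OF ker_monic[OF sd_simps(1)], of _ _ T]) simp_all
      hence "\<rho> \<cdot> (k' \<cdot> u) = \<rho> \<cdot> (k' \<cdot> v)" by simp
      thus "u = v" using \<rho>k[THEN reassoc, of u] \<rho>k[THEN reassoc, of v] by simp
    qed simp
    fix T u assume u: "u \<in> hom C T (dom d)" "d \<cdot> u = zero C T (cod d)"
    then obtain w where w: "w \<in> hom C T ?K" "?\<kappa> \<cdot> w = u" using ker_lift[of d u T] by auto
    note [simp] = w(1)[THEN homD]
    have "k \<cdot> (\<rho> \<cdot> w) = u" using k'(4)[THEN reassoc, of "\<rho> \<cdot> w"] k\<rho>[THEN reassoc, of w] w(2) by simp
    thus "\<exists>w. w \<in> hom C T (dom k) \<and> k \<cdot> w = u" by (intro exI[of _ "\<rho> \<cdot> w"]) simp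
  qed simp_all
qed

text \<open>
  For groups \<open>\<omega> (x, y)\<close> is the arrow \<open>x\<^sup>-\<^sup>1 y\<close> from \<open>\<delta> x\<close> to \<open>\<delta> y\<close>; the Peiffer condition is what makes
  it well defined on the product.
\<close>

lemma division:
  obtains \<omega> where "\<omega> \<in> hom C (prd X X) S" "\<omega> \<cdot> pair C (ide X) (ide X) = e \<cdot> \<delta>" "\<omega> \<cdot> inc2 X X = k"
    "d \<cdot> \<omega> = \<delta> \<cdot> proj1 C X X" "c \<cdot> \<omega> = \<delta> \<cdot> proj2 C X X"
proof -
  let ?D = "pair C (ide X) (ide X)" and ?j = "inc2 X X"
  let ?\<alpha> = "copair C ?D ?j" and ?\<beta> = "copair C (e \<cdot> \<delta>) k"
  have \<alpha>: "regular_epi C ?\<alpha>"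
    by (rule split_ext_regular[OF _ _ _ proj1_kernel[of X X]]) simp_all
  define a where "a = ?\<alpha>"
  define z where "z = ker C a"
  define Z where "Z = dom z"
  have a: "arr a" "dom a = coprod C X X" "cod a = prd X X" "proj1 C X X \<cdot> a = retr X X"
    "proj2 C X X \<cdot> a = copair C (ide X) (ide X)"
    unfolding a_def by simp_all
  note [simp] = a(1-3)
  have z: "arr z" "dom z = Z" "cod z = coprod C X X" "a \<cdot> z = zero C Z (prd X X)" "obj Z"
    unfolding Z_def z_def by simp_all
  note [simp] = z(1-3,5)
  \<comment> \<open>An element of the kernel of \<open>a\<close> is killed by both projections of
    the product. The first puts it into the kernel object \<open>flat C X X\<close>, the second says
    that its conjugation is trivial.\<close>
  have "retr X X \<cdot> z = zero C Z X" using a(4)[THEN reassoc, of z] z(4) by simp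
  then obtain y where y: "y \<in> hom C Z (flat C X X)" "kflat C X X \<cdot> y = z" using kflat_lift[of X X z Z] by auto
  note [simp] = y(1)[THEN homD]
  have "copair C (ide X) (ide X) \<cdot> z = zero C Z X" using a(5)[THEN reassoc, of z] z(4) by simp
  hence cy: "conjugation C X \<cdot> y = zero C Z X" using y(2) by (simp add: conjugation_def)
  \<comment> \<open>By the Peiffer condition \<open>?\<beta>\<close> restricts to \<open>k\<close>
    after conjugation, hence kills the kernel of \<open>a\<close> and descends to the
    product.\<close>
  have "?\<beta> \<cdot> kflat C X X = copair C e k \<cdot> (kflat C A X \<cdot> flat_map C \<delta> (ide X))"
    using copair_flat_map[of \<delta> X A "ide X" X X e S k] by simp
  also have "\<dots> = k \<cdot> (\<xi> \<cdot> flat_map C \<delta> (ide X))"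
    using sd_conj[THEN reassoc, of "flat_map C \<delta> (ide X)"] by simp
  finally have "?\<beta> \<cdot> kflat C X X = k \<cdot> conjugation C X" unfolding peiffer .
  hence "?\<beta> \<cdot> z = zero C Z S" using reassoc[of ?\<beta> "kflat C X X" "k \<cdot> conjugation C X" y] y(2) cy by simp
  then obtain \<omega> where \<omega>: "\<omega> \<in> hom C (prd X X) S" "\<omega> \<cdot> a = ?\<beta>"
    using regular_epi_desc0[OF \<alpha>[folded a_def], of ?\<beta> S] unfolding z_def[symmetric] by auto
  note [simp] = \<omega>(1)[THEN homD]
  have 1: "\<omega> \<cdot> ?D = e \<cdot> \<delta>" using \<omega>(2)[THEN reassoc, of "inl C X X"] by (simp add: a_def)
  have 2: "\<omega> \<cdot> ?j = k" using \<omega>(2)[THEN reassoc, of "inr C X X"] by (simp add: a_def)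
  have "(d \<cdot> \<omega>) \<cdot> a = (\<delta> \<cdot> proj1 C X X) \<cdot> a" using \<omega>(2) a(4) by simp
  hence 3: "d \<cdot> \<omega> = \<delta> \<cdot> proj1 C X X" by (rule regular_epi_epi[OF \<alpha>[folded a_def], of _ _ A]) simp_all
  have "(c \<cdot> \<omega>) \<cdot> a = (\<delta> \<cdot> proj2 C X X) \<cdot> a" using \<omega>(2) a(5) by simp
  hence 4: "c \<cdot> \<omega> = \<delta> \<cdot> proj2 C X X" by (rule regular_epi_epi[OF \<alpha>[folded a_def], of _ _ A]) simp_all
  show thesis by (rule that[OF \<omega>(1) 1 2 3 4])
qed

text \<open>An element of the kernel of \<open>\<delta>\<close> acts trivially, since it acts
  through its image zero in \<open>A\<close>; by the Peiffer condition this action is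
  conjugation.\<close>

lemma kernel_central: "commute (ker C \<delta>) (ide X)"
proof -
  let ?M = "dom (ker C \<delta>)"
  define a where "a = sum_to_prod C ?M X"
  define z where "z = ker C a"
  define Z where "Z = dom z"
  have a: "arr a" "dom a = coprod C ?M X" "cod a = prd ?M X" "proj1 C ?M X \<cdot> a = retr ?M X"
    "proj2 C ?M X \<cdot> a = copair C (zero C ?M X) (ide X)"
    unfolding a_def by (simp_all add: sum_to_prod_def)
  note [simp] = a(1-3)
  have z: "arr z" "dom z = Z" "cod z = coprod C ?M X" "a \<cdot> z = zero C Z (prd ?M X)" "obj Z"
    unfolding Z_def z_def by simp_all
  note [simp] = z(1-3,5)
  have "retr ?M X \<cdot> z = zero C Z ?M" using a(4)[THEN reassoc, of z] z(4) by simp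
  then obtain y where y: "y \<in> hom C Z (flat C ?M X)" "kflat C ?M X \<cdot> y = z" using kflat_lift[of ?M X z Z] by auto
  note [simp] = y(1)[THEN homD]
  have z2: "copair C (zero C ?M X) (ide X) \<cdot> z = zero C Z X" using a(5)[THEN reassoc, of z] z(4) by simp
  \<comment> \<open>The element at which the Peiffer condition is evaluated. It vanishes because its
    \<open>A\<close>-components are killed by \<open>\<delta>\<close> and what remains is the second
    projection of \<open>z\<close>, also zero.\<close>
  let ?F = "flat_map C \<delta> (ide X) \<cdot> (flat_map C (ker C \<delta>) (ide X) \<cdot> y)"
  have "kflat C A X \<cdot> ?F = copair C (inl C A X \<cdot> \<delta>) (inr C A X) \<cdot> (copair C (inl C X X \<cdot> ker C \<delta>) (inr C X X) \<cdot> z)"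
    using kflat_flat_map[of \<delta> "ide X" A X, THEN reassoc, of "flat_map C (ker C \<delta>) (ide X) \<cdot> y"]
      kflat_flat_map[of "ker C \<delta>" "ide X" X X, THEN reassoc, of y] y(2) by (simp del: comp_copair')
  also have "\<dots> = inr C A X \<cdot> (copair C (zero C ?M X) (ide X) \<cdot> z)" by simp
  finally have "kflat C A X \<cdot> ?F = zero C Z (coprod C A X)" unfolding z2 by simp
  hence "?F = zero C Z (flat C A X)" using kflat_ext[of A X ?F Z "zero C Z (flat C A X)"] by simp
  hence "\<xi> \<cdot> ?F = zero C Z X" by simp
  hence "conjugation C X \<cdot> (flat_map C (ker C \<delta>) (ide X) \<cdot> y) = zero C Z X"
    using peiffer[THEN reassoc, of "flat_map C (ker C \<delta>) (ide X) \<cdot> y"] by simp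
  hence "copair C (ker C \<delta>) (ide X) \<cdot> z = zero C Z X"
    using conjugation_flat_map[of "ker C \<delta>" ?M X "ide X" X, THEN reassoc, of y] y(2) by simp
  thus ?thesis using commute_iff[of "ker C \<delta>" ?M X "ide X" X] unfolding z_def Z_def a_def by simp
qed

text \<open>
  Every \<open>f\<close> in the kernel of \<open>c\<close> is locally of the form \<open>\<omega> (x, y)\<close> with \<open>\<delta> y = 0\<close>, and
  \<open>\<omega> (x, y z)\<close> then provides the cooperator because the kernel of \<open>\<delta>\<close> is central.
\<close>

lemma sd_commute: "commute (ker C d) (ker C c)"
proof -
  obtain \<omega> where \<omega>: "\<omega> \<in> hom C (prd X X) S" "\<omega> \<cdot> pair C (ide X) (ide X) = e \<cdot> \<delta>" "\<omega> \<cdot> inc2 X X = k"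
    "d \<cdot> \<omega> = \<delta> \<cdot> proj1 C X X" "c \<cdot> \<omega> = \<delta> \<cdot> proj2 C X X" by (rule division)
  note [simp] = \<omega>(1)[THEN homD]
  \<comment> \<open>Compares pairs (x, y) with pairs (x, f) such that \<delta> x = d f. Both are
    split extensions of \<open>X\<close> with kernel object \<open>X\<close>, so every such f is
    uniquely \<omega> (x, y).\<close>
  let ?g = "pb_pair C \<delta> d (proj1 C X X) \<omega>"
  have "iso C ?g"
  proof (rule split_short_five[of "proj1 C X X" "prd X X" X "pair C (ide X) (ide X)" "pb1 C \<delta> d" "pbo \<delta> d" ?g "inc2 X X"])
    show "is_kernel C (proj1 C X X) (inc2 X X)" by (rule proj1_kernel) simp_all
    show "is_kernel C (pb1 C \<delta> d) (?g \<cdot> inc2 X X)"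
      using pb1_is_kernel[OF _ _ sd_kernel, of \<delta> X A S] \<omega>(3,4) by simp
  qed (use \<omega>(4) in simp_all)
  then obtain n where n: "n \<in> hom C (pbo \<delta> d) (prd X X)" "?g \<cdot> n = ide (pbo \<delta> d)"
    by (rule isoE) (use \<omega>(4) in simp)
  note [simp] = n(1)[THEN homD]
  let ?M = "dom (ker C \<delta>)" and ?\<kappa> = "ker C c"
  let ?Kc = "dom ?\<kappa>"
  have "ker C \<delta> \<in> hom C ?M X" "ide X \<in> hom C X X" by simp_all
  then obtain m where m: "m \<in> hom C (prd ?M X) X" "m \<cdot> inc1 ?M X = ker C \<delta>" "m \<cdot> inc2 ?M X = ide X"
    using commuteE[OF kernel_central] by blast
  note [simp] = m(1)[THEN homD]
  have dce: "d \<in> hom C S A" "c \<in> hom C S A" "e \<in> hom C A S" "d \<cdot> e = ide A" "c \<cdot> e = ide A" by simp_all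
  \<comment> \<open>\<open>R\<close> is the relation on \<open>A\<close> of being joined by an
    arrow. Exactness makes it the kernel pair of \<open>q\<close>, which supplies its
    symmetry.\<close>
  obtain r r1 r2 R q where r: "regular_epi C r" "r \<in> hom C S R" "r1 \<in> hom C R A" "r2 \<in> hom C R A"
    "r1 \<cdot> r = d" "r2 \<cdot> r = c" and q: "is_coequaliser C d c q" "is_pullback C q q r1 r2"
    by (rule reflexive_pair[OF dce])
  note [simp] = r(2-4)[THEN homD] is_coequaliserD(5)[OF q(1)]
  have [simp]: "dom q = A" using is_coequaliserD(6)[OF q(1)] by simp
  \<comment> \<open>An arrow in the kernel of \<open>c\<close> runs from its domain to zero. By
    symmetry of \<open>R\<close> there is, over a cover, an arrow \<open>p\<close> from zero to that
    domain; being in the kernel of \<open>d\<close>, it comes from some \<open>x\<close> in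
    \<open>X\<close>.\<close>
  have "q \<cdot> zero C ?Kc A = q \<cdot> (d \<cdot> ?\<kappa>)"
    using is_coequaliserD(7)[OF q(1), THEN reassoc, of ?\<kappa>] by simp
  then obtain w where w: "w \<in> hom C ?Kc R" "r1 \<cdot> w = zero C ?Kc A" "r2 \<cdot> w = d \<cdot> ?\<kappa>"
    using is_pullback_lift[OF q(2), of "zero C ?Kc A" ?Kc "d \<cdot> ?\<kappa>"] by auto
  note [simp] = w(1)[THEN homD]
  define t p where "t = pb2 C r w" and "p = pb1 C r w"
  define T where "T = dom t"
  have t: "regular_epi C t" unfolding t_def by (rule regular_epi_pb2[OF r(1)]) simp_all
  have tp [simp]: "arr t" "dom t = T" "cod t = ?Kc" "arr p" "dom p = T" "cod p = S" "obj T"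
    and rp: "r \<cdot> p = w \<cdot> t"
    unfolding T_def t_def p_def using pb_comm[of r w] by simp_all
  have dp: "d \<cdot> p = zero C T A" using r(5)[THEN reassoc, of p] rp w(2)[THEN reassoc, of t] by simp
  have cp: "c \<cdot> p = d \<cdot> (?\<kappa> \<cdot> t)" using r(6)[THEN reassoc, of p] rp w(3)[THEN reassoc, of t] by simp
  obtain x where x: "x \<in> hom C T X" "k \<cdot> x = p" using is_kernel_lift[OF sd_kernel, of p T] dp by auto
  note [simp] = x(1)[THEN homD]
  have dx: "\<delta> \<cdot> x = d \<cdot> (?\<kappa> \<cdot> t)" using sd_laws(4)[THEN reassoc, of x] x(2) cp by simp
  \<comment> \<open>The second coordinate of the preimage of (x, \<kappa> t) under the isomorphism
    \<open>?g\<close>. Its boundary is the codomain of an element of the kernel of \<open>c\<close>,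
    hence zero.\<close>
  define y where "y = proj2 C X X \<cdot> (n \<cdot> pb_pair C \<delta> d x (?\<kappa> \<cdot> t))"
  define v where "v = pb_pair C \<delta> d x (?\<kappa> \<cdot> t)"
  have v: "arr v" "dom v = T" "cod v = pbo \<delta> d" "pb1 C \<delta> d \<cdot> v = x" "pb2 C \<delta> d \<cdot> v = ?\<kappa> \<cdot> t"
    unfolding v_def using dx by simp_all
  note [simp] = v(1-3)
  have gn: "?g \<cdot> (n \<cdot> v) = v" using n(2)[THEN reassoc, of v] \<omega>(4) by simp
  have n1: "proj1 C X X \<cdot> (n \<cdot> v) = x"
    using arg_cong[OF gn, of "\<lambda>w. pb1 C \<delta> d \<cdot> w"] v(4) \<omega>(4) \<omega>(4)[THEN reassoc] by simp
  have n2: "\<omega> \<cdot> (n \<cdot> v) = ?\<kappa> \<cdot> t"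
    using arg_cong[OF gn, of "\<lambda>w. pb2 C \<delta> d \<cdot> w"] v(5) \<omega>(4) \<omega>(4)[THEN reassoc] by simp
  have y: "arr y" "dom y = T" "cod y = X" "y = proj2 C X X \<cdot> (n \<cdot> v)" unfolding y_def v_def[symmetric] by simp_all
  note [simp] = y(1-3)
  have nv: "n \<cdot> v = pair C x y" by (rule prod_ext[of _ T X X]) (use n1 y(4) in simp_all)
  have "\<delta> \<cdot> y = c \<cdot> (\<omega> \<cdot> (n \<cdot> v))" using \<omega>(5)[THEN reassoc, of "n \<cdot> v"] nv by simp
  hence "\<delta> \<cdot> y = zero C T A" unfolding n2 by simp
  then obtain y' where y': "y' \<in> hom C T ?M" "ker C \<delta> \<cdot> y' = y" using ker_lift[of \<delta> y T] by auto
  note [simp] = y'(1)[THEN homD]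
  have kt: "?\<kappa> \<cdot> t \<in> hom C T S" "k \<in> hom C X S" "t \<in> hom C T ?Kc" "?\<kappa> \<in> hom C ?Kc S" by simp_all
  have "commute (?\<kappa> \<cdot> t) k"
  proof (rule commuteI[OF kt(1,2), of "\<omega> \<cdot> pair C (x \<cdot> proj1 C T X) (m \<cdot> pair C (y' \<cdot> proj1 C T X) (proj2 C T X))"])
    have "m \<cdot> pair C y' (zero C T X) = y" using m(2)[THEN reassoc, of y'] y'(2) by simp
    thus "(\<omega> \<cdot> pair C (x \<cdot> proj1 C T X) (m \<cdot> pair C (y' \<cdot> proj1 C T X) (proj2 C T X))) \<cdot> inc1 T X = ?\<kappa> \<cdot> t"
      using n2 nv by simp
    show "(\<omega> \<cdot> pair C (x \<cdot> proj1 C T X) (m \<cdot> pair C (y' \<cdot> proj1 C T X) (proj2 C T X))) \<cdot> inc2 T X = k"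
      using m(3) \<omega>(3) by simp
  qed simp
  hence "commute ?\<kappa> k" by (rule commute_descend[OF t kt(3) _ kt(4,2)])
  hence ck: "commute k ?\<kappa>" by (rule commute_sym[OF _ kt(4,2)])
  obtain i where i: "i \<in> hom C (dom (ker C d)) X" "k \<cdot> i = ker C d"
    using is_kernel_lift[OF sd_kernel, of "ker C d" "dom (ker C d)"] by auto
  have "ide ?Kc \<in> hom C ?Kc ?Kc" by simp
  from commute_precomp[OF ck kt(2,4) i(1) this] show ?thesis using i(2) by simp
qed

lemma sd_groupoid:
  assumes "smith_is_huq C"
  obtains G where "internal_groupoid C S A G" "gd G = d" "gc G = c" "ge G = e"
  by (rule commute_groupoid[OF assms, of d S A c e]) (simp_all add: sd_commute)

end

context semi_abelian_category
begin

section \<open>Quotients of double groupoids\<close>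

lemma commute_zero:
  assumes "b \<in> hom C B X" "obj A"
  shows "commute (zero C A X) b" "commute b (zero C A X)"
proof -
  note [simp] = assms(1)[THEN homD] assms(2)
  have z: "zero C A X \<in> hom C A X" by simp
  show c: "commute (zero C A X) b" by (rule commuteI[OF z assms(1), of "b \<cdot> proj2 C A B"]) simp_all
  show "commute b (zero C A X)" by (rule commute_sym[OF c z assms(1)])
qed

text \<open>\<open>f\<close> maps the kernels of \<open>d\<close> and \<open>c\<close> into those of
  \<open>d'\<close> and \<open>c'\<close>, so the cooperator restricts. This is how maps out of
  \<open>Q\<close> are seen to kill a commutator.\<close>

lemma commute_kernels_image:
  assumes f: "f \<in> hom C X Y" and X: "d \<in> hom C X Z" "c \<in> hom C X Z" and Y: "d' \<in> hom C Y W" "c' \<in> hom C Y W"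
    and g: "g \<in> hom C Z W" "d' \<cdot> f = g \<cdot> d" "g' \<in> hom C Z W" "c' \<cdot> f = g' \<cdot> c"
    and c: "commute (ker C d') (ker C c')"
  shows "commute (f \<cdot> ker C d) (f \<cdot> ker C c)"
proof -
  note [simp] = f[THEN homD] X[THEN homD] Y[THEN homD] g(1,3)[THEN homD]
  have "d' \<cdot> (f \<cdot> ker C d) = zero C (dom (ker C d)) W" using g(2)[THEN reassoc, of "ker C d"] by simp
  then obtain u where u: "u \<in> hom C (dom (ker C d)) (dom (ker C d'))" "ker C d' \<cdot> u = f \<cdot> ker C d"
    using ker_lift[of d' "f \<cdot> ker C d" "dom (ker C d)"] by auto
  have "c' \<cdot> (f \<cdot> ker C c) = zero C (dom (ker C c)) W" using g(4)[THEN reassoc, of "ker C c"] by simp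
  then obtain v where v: "v \<in> hom C (dom (ker C c)) (dom (ker C c'))" "ker C c' \<cdot> v = f \<cdot> ker C c"
    using ker_lift[of c' "f \<cdot> ker C c" "dom (ker C c)"] by auto
  have "ker C d' \<in> hom C (dom (ker C d')) Y" "ker C c' \<in> hom C (dom (ker C c')) Y" by simp_all
  from commute_precomp[OF c this u(1) v(1)] show ?thesis using u(2) v(2) by simp
qed

text \<open>Pulling \<open>r\<close> back along the kernel of \<open>d'\<close> gives a regular
  epimorphism whose elements have lifts in \<open>X\<close> that are killed by
  \<open>d\<close>.\<close>

lemma kernel_cover:
  assumes r: "regular_epi C r" "r \<in> hom C X X'" and d: "d' \<in> hom C X' Y" "d \<in> hom C X Y" "d' \<cdot> r = d"
  obtains t v T where "regular_epi C t" "t \<in> hom C T (dom (ker C d'))" "v \<in> hom C T (dom (ker C d))" "ker C d' \<cdot> t = r \<cdot> (ker C d \<cdot> v)"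
proof -
  note [simp] = r(2)[THEN homD] d(1,2)[THEN homD]
  define t p where "t = pb2 C r (ker C d')" and "p = pb1 C r (ker C d')"
  define T where "T = dom t"
  have t: "regular_epi C t" unfolding t_def by (rule regular_epi_pb2[OF r(1)]) simp_all
  have tp [simp]: "arr t" "dom t = T" "cod t = dom (ker C d')" "arr p" "dom p = T" "cod p = X" "obj T"
    and rp: "r \<cdot> p = ker C d' \<cdot> t"
    unfolding T_def t_def p_def using pb_comm[of r "ker C d'"] by simp_all
  have "d \<cdot> p = zero C T Y" using d(3)[THEN reassoc, of p] rp by simp
  then obtain v where v: "v \<in> hom C T (dom (ker C d))" "ker C d \<cdot> v = p" using ker_lift[of d p T] by auto
  show thesis by (rule that[OF t _ v(1)]) (use rp v(2) in simp_all)
qed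

text \<open>Each kernel downstairs is covered by the kernel upstairs, and the cooperator descends
  along the covers in one variable at a time, with symmetry in between.\<close>

lemma quotient_commute:
  assumes r: "regular_epi C r" "r \<in> hom C X X'"
    and d: "d' \<in> hom C X' Y" "d \<in> hom C X Y" "d' \<cdot> r = d" and c: "c' \<in> hom C X' Y" "c \<in> hom C X Y" "c' \<cdot> r = c"
    and cm: "commute (r \<cdot> ker C d) (r \<cdot> ker C c)"
  shows "commute (ker C d') (ker C c')"
proof -
  note [simp] = r(2)[THEN homD] d(1,2)[THEN homD] c(1,2)[THEN homD]
  obtain t v T where t: "regular_epi C t" "t \<in> hom C T (dom (ker C d'))" "v \<in> hom C T (dom (ker C d))" "ker C d' \<cdot> t = r \<cdot> (ker C d \<cdot> v)"
    by (rule kernel_cover[OF r d])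
  obtain s w S where s: "regular_epi C s" "s \<in> hom C S (dom (ker C c'))" "w \<in> hom C S (dom (ker C c))" "ker C c' \<cdot> s = r \<cdot> (ker C c \<cdot> w)"
    by (rule kernel_cover[OF r c])
  note [simp] = t(2,3)[THEN homD] s(2,3)[THEN homD]
  have h: "r \<cdot> ker C d \<in> hom C (dom (ker C d)) X'" "r \<cdot> ker C c \<in> hom C (dom (ker C c)) X'"
    "ker C d' \<in> hom C (dom (ker C d')) X'" "ker C c' \<in> hom C (dom (ker C c')) X'" "ker C c' \<cdot> s \<in> hom C S X'" by simp_all
  have "commute (ker C d' \<cdot> t) (ker C c' \<cdot> s)"
    using commute_precomp[OF cm h(1,2) t(3) s(3)] t(4) s(4) by simp
  hence "commute (ker C d') (ker C c' \<cdot> s)" by (rule commute_descend[OF t(1,2) _ h(3,5)])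
  hence "commute (ker C c' \<cdot> s) (ker C d')" by (rule commute_sym[OF _ h(3,5)])
  hence "commute (ker C c') (ker C d')" by (rule commute_descend[OF s(1,2) _ h(4,3)])
  thus ?thesis by (rule commute_sym[OF _ h(4,3)])
qed

text \<open>A witness \<open>f\<close> of normality factors through the cokernel of
  \<open>n\<close>, so anything killed by the cokernel is killed by \<open>f\<close> and factors
  through \<open>n\<close>.\<close>

lemma normal_mono_coker:
  assumes "normal_mono C n" shows "is_kernel C (coker C n) n"
proof -
  obtain f where f: "is_kernel C f n" using assms by (auto simp: normal_mono_def)
  note fD = is_kernelD[OF f]
  have n [simp]: "arr n" by (rule fD(2))
  have [simp]: "arr f" "dom f = cod n" using fD by simp_all
  obtain v where v: "v \<in> hom C (cod (coker C n)) (cod f)" "v \<cdot> coker C n = f"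
    using coker_desc[of n "dom n" "cod n" f "cod f"] fD(4) by auto
  have [simp]: "arr v" "dom v = cod (coker C n)" using v(1) by auto
  have cv: "cod v = cod f" using v(1) by auto
  show ?thesis
  proof (rule is_kernelI)
    fix T u assume u: "u \<in> hom C T (dom (coker C n))" "coker C n \<cdot> u = zero C T (cod (coker C n))"
    note [simp] = u(1)[THEN homD]
    have "f \<cdot> u = zero C T (cod f)" using v(2)[THEN reassoc, of u] u(2) cv by simp
    thus "\<exists>w. w \<in> hom C T (dom n) \<and> n \<cdot> w = u" using is_kernel_lift[OF f, of u T] by auto
  qed (simp_all add: is_kernel_monic[OF f])
qed

text \<open>Adding the fixed object \<open>A\<close> turns a coequaliser of \<open>f\<close> and
  \<open>g\<close> into a coequaliser of their composites with \<open>inr\<close>.\<close>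

lemma regular_epi_cosum:
  assumes h: "regular_epi C h" "h \<in> hom C X Y" and A: "obj A"
  shows "regular_epi C (copair C (inl C A Y) (inr C A Y \<cdot> h))"
proof -
  note [simp] = h(2)[THEN homD] A
  obtain f g where fg: "is_coequaliser C f g h" using h(1) by (auto simp: regular_epi_def)
  have fgD [simp]: "arr f" "arr g" "dom g = dom f" "cod g = cod f" "cod f = X" using is_coequaliserD(1-4,6)[OF fg] by simp_all
  let ?c = "copair C (inl C A Y) (inr C A Y \<cdot> h)" and ?j = "inr C A X"
  have "is_coequaliser C (?j \<cdot> f) (?j \<cdot> g) ?c"
  proof (rule is_coequaliserI[of _ "dom f" "coprod C A X"])
    show "?c \<cdot> (?j \<cdot> f) = ?c \<cdot> (?j \<cdot> g)" using is_coequaliserD(7)[OF fg] by simp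
    fix T u assume u: "u \<in> hom C (coprod C A X) T" "u \<cdot> (?j \<cdot> f) = u \<cdot> (?j \<cdot> g)"
    note [simp] = u(1)[THEN homD]
    obtain w where w: "w \<in> hom C Y T" "w \<cdot> h = u \<cdot> ?j"
      using is_coequaliser_desc[OF fg, of "u \<cdot> ?j" T] u(2) by auto
    note [simp] = w(1)[THEN homD]
    have "copair C (u \<cdot> inl C A X) w \<cdot> ?c = u"
      by (rule coprod_ext[of _ A X T]) (use w(2) in simp_all)
    thus "\<exists>w. w \<in> hom C (cod ?c) T \<and> w \<cdot> ?c = u"
      by (intro exI[of _ "copair C (u \<cdot> inl C A X) w"]) simp
  next
    fix T w w' assume w: "w \<in> hom C (cod ?c) T" "w' \<in> hom C (cod ?c) T" "w \<cdot> ?c = w' \<cdot> ?c"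
    have ww: "arr w" "dom w = coprod C A Y" "cod w = T" "arr w'" "dom w' = coprod C A Y" "cod w' = T" using w(1,2) by simp_all
    note [simp] = ww
    have 1: "w \<cdot> (?c \<cdot> inl C A X) = w' \<cdot> (?c \<cdot> inl C A X)" and 2: "w \<cdot> (?c \<cdot> inr C A X) = w' \<cdot> (?c \<cdot> inr C A X)"
      using reassoc[OF w(3), of "inl C A X"] reassoc[OF w(3), of "inr C A X"] by (simp_all del: comp_copair' comp_copair copair_in)
    have "(w \<cdot> inr C A Y) \<cdot> h = (w' \<cdot> inr C A Y) \<cdot> h" using 2 by simp
    hence "w \<cdot> inr C A Y = w' \<cdot> inr C A Y" by (rule regular_epi_epi[OF h(1), of _ _ T]) simp_all
    moreover have "w \<cdot> inl C A Y = w' \<cdot> inl C A Y" using 1 by simp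
    ultimately show "w = w'" using coprod_ext[of w A Y T w'] by simp
  qed simp_all
  thus ?thesis by (auto simp: regular_epi_def)
qed

text \<open>The sum of the identity and \<open>h\<close> commutes with the retractions onto
  \<open>A\<close>, so its restriction to their kernels is a pullback of it. The lemma serves to
  cancel this restriction when the action on \<open>P\<close> is identified.\<close>

lemma regular_epi_flat_map:
  assumes h: "regular_epi C h" "h \<in> hom C X Y" and A: "obj A"
  shows "regular_epi C (flat_map C (ide A) h)"
proof -
  note [simp] = h(2)[THEN homD] A
  define s where "s = copair C (inl C A Y) (inr C A Y \<cdot> h)"
  have s [simp]: "arr s" "dom s = coprod C A X" "cod s = coprod C A Y" unfolding s_def by simp_all
  have sk: "kflat C A Y \<cdot> flat_map C (ide A) h = s \<cdot> kflat C A X"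
    using kflat_flat_map[of "ide A" h A Y] unfolding s_def by simp
  have sp: "retr A Y \<cdot> s = retr A X"
    unfolding s_def by simp
  have "is_pullback C s (kflat C A Y) (kflat C A X) (flat_map C (ide A) h)"
  proof (rule is_pullbackI[where V = "flat C A X"])
    fix T u v assume uv: "u \<in> hom C T (dom s)" "v \<in> hom C T (dom (kflat C A Y))" "s \<cdot> u = kflat C A Y \<cdot> v"
    note [simp] = uv(1,2)[THEN homD]
    have "retr A X \<cdot> u = zero C T A"
      using sp[THEN reassoc, of u] kflat_simps(5)[of A Y, THEN reassoc, of v] uv(3) by simp
    then obtain w where w: "w \<in> hom C T (flat C A X)" "kflat C A X \<cdot> w = u" using kflat_lift[of A X u T] by auto
    note [simp] = w(1)[THEN homD]
    have "flat_map C (ide A) h \<cdot> w = v"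
      by (rule kflat_ext[of A Y _ T]) (use sk[THEN reassoc, of w] w(2) uv(3) in simp_all)
    thus "\<exists>w. w \<in> hom C T (flat C A X) \<and> kflat C A X \<cdot> w = u \<and> flat_map C (ide A) h \<cdot> w = v" using w by blast
  next
    fix T w w' assume "w \<in> hom C T (flat C A X)" "w' \<in> hom C T (flat C A X)" "kflat C A X \<cdot> w = kflat C A X \<cdot> w'"
    thus "w = w'" using kflat_ext[of A X w T w'] by simp
  qed (use sk in simp_all)
  moreover have "regular_epi C s" unfolding s_def by (rule regular_epi_cosum[OF assms])
  ultimately show ?thesis using regular_epi_pb by blast
qed

text \<open>Diagonal fill-in for a regular epimorphism against a monomorphism; it turns a
  factorisation over a cover into one downstairs.\<close>

lemma regular_epi_lift:
  assumes t: "regular_epi C t" and m: "monic C m" and uv: "u \<in> hom C (cod t) (cod m)" "v \<in> hom C (dom t) (dom m)" "u \<cdot> t = m \<cdot> v"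
  obtains w where "w \<in> hom C (cod t) (dom m)" "m \<cdot> w = u"
proof -
  have [simp]: "arr t" "arr m" using regular_epi_arr[OF t] monic_arr[OF m] .
  have [simp]: "arr u" "dom u = cod t" "cod u = cod m" "arr v" "dom v = dom t" "cod v = dom m" using uv(1,2) by simp_all
  have "m \<cdot> (v \<cdot> pb1 C t t) = m \<cdot> (v \<cdot> pb2 C t t)"
    using uv(3)[THEN reassoc, of "pb1 C t t"] uv(3)[THEN reassoc, of "pb2 C t t"] pb_comm[of t t] by simp
  hence "v \<cdot> pb1 C t t = v \<cdot> pb2 C t t" by (rule monicD[OF m, of _ _ "pbo t t"]) simp_all
  then obtain w where w: "w \<in> hom C (cod t) (dom m)" "w \<cdot> t = v" using regular_epi_desc[OF t uv(2)] by blast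
  have [simp]: "arr w" "dom w = cod t" "cod w = dom m" using w(1) by simp_all
  have "(m \<cdot> w) \<cdot> t = u \<cdot> t" using w(2) uv(3) by simp
  hence "m \<cdot> w = u" by (rule regular_epi_epi[OF t, of _ _ "cod m"]) simp_all
  thus thesis using that w(1) by blast
qed

end

section \<open>The tensor product\<close>

locale xmodule_pair = semi_abelian_category C + m: xmodule C M L \<mu> \<xi>M + n: xmodule C N L \<nu> \<xi>N
  for C :: "('o, 'a) cat" (structure) and M N L :: 'o and \<mu> \<nu> \<xi>M \<xi>N :: 'a
begin

abbreviation x :: "'a xmod" where "x \<equiv> (\<mu>, \<xi>M)"
abbreviation y :: "'a xmod" where "y \<equiv> (\<nu>, \<xi>N)"

text \<open>The equations of a double groupoid with prescribed right and bottom edges, leaving out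
  multiplications: these will come from commuting kernels, and their compatibilities from
  \<open>double_groupoidI\<close>.\<close>

definition double_graph :: "'o \<Rightarrow> 'a \<Rightarrow> 'a \<Rightarrow> 'a \<Rightarrow> 'a \<Rightarrow> 'a \<Rightarrow> 'a \<Rightarrow> bool" where
  "double_graph A dU cU eU dL cL eL \<longleftrightarrow>
     obj A \<and> arr dU \<and> dom dU = A \<and> cod dU = m.S \<and> arr cU \<and> dom cU = A \<and> cod cU = m.S \<and> arr eU \<and> dom eU = m.S \<and> cod eU = A \<and>
     arr dL \<and> dom dL = A \<and> cod dL = n.S \<and> arr cL \<and> dom cL = A \<and> cod cL = n.S \<and> arr eL \<and> dom eL = n.S \<and> cod eL = A \<and>
     dU \<cdot> eU = ide m.S \<and> cU \<cdot> eU = ide m.S \<and> dL \<cdot> eL = ide n.S \<and> cL \<cdot> eL = ide n.S \<and>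
     m.d \<cdot> dU = n.d \<cdot> dL \<and> m.d \<cdot> cU = n.c \<cdot> dL \<and> m.c \<cdot> dU = n.d \<cdot> cL \<and> m.c \<cdot> cU = n.c \<cdot> cL \<and>
     dU \<cdot> eL = m.e \<cdot> n.d \<and> cU \<cdot> eL = m.e \<cdot> n.c \<and> dL \<cdot> eU = n.e \<cdot> m.d \<and> cL \<cdot> eU = n.e \<cdot> m.c \<and>
     eU \<cdot> m.e = eL \<cdot> n.e"

lemma double_graphD:
  assumes "double_graph A dU cU eU dL cL eL"
  shows "obj A" "arr dU" "dom dU = A" "cod dU = m.S" "arr cU" "dom cU = A" "cod cU = m.S" "arr eU" "dom eU = m.S" "cod eU = A"
     "arr dL" "dom dL = A" "cod dL = n.S" "arr cL" "dom cL = A" "cod cL = n.S" "arr eL" "dom eL = n.S" "cod eL = A"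
  and "dU \<cdot> eU = ide m.S" "cU \<cdot> eU = ide m.S" "dL \<cdot> eL = ide n.S" "cL \<cdot> eL = ide n.S"
  and "m.d \<cdot> dU = n.d \<cdot> dL" "m.d \<cdot> cU = n.c \<cdot> dL" "m.c \<cdot> dU = n.d \<cdot> cL" "m.c \<cdot> cU = n.c \<cdot> cL"
  and "dU \<cdot> eL = m.e \<cdot> n.d" "cU \<cdot> eL = m.e \<cdot> n.c" "dL \<cdot> eU = n.e \<cdot> m.d" "cL \<cdot> eU = n.e \<cdot> m.c"
  and "eU \<cdot> m.e = eL \<cdot> n.e"
  using assms unfolding double_graph_def by blast+

lemma double_graph_quotient:
  assumes g: "double_graph A dU cU eU dL cL eL" and r: "regular_epi C r" "r \<in> hom C A A'"
    and q: "dU' \<in> hom C A' m.S" "dU' \<cdot> r = dU" "cU' \<in> hom C A' m.S" "cU' \<cdot> r = cU"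
      "dL' \<in> hom C A' n.S" "dL' \<cdot> r = dL" "cL' \<in> hom C A' n.S" "cL' \<cdot> r = cL"
  shows "double_graph A' dU' cU' (r \<cdot> eU) dL' cL' (r \<cdot> eL)"
proof -
  note [simp] = double_graphD(1-19)[OF g] r(2)[THEN homD] q(1)[THEN homD] q(3)[THEN homD] q(5)[THEN homD] q(7)[THEN homD]
  note eqs = double_graphD(20-32)[OF g] and qs = q(2,4,6,8)[THEN reassoc]
  have canc: "a = b" if "a \<cdot> r = b \<cdot> r" "a \<in> hom C A' L" "b \<in> hom C A' L" for a b
    using regular_epi_epi[OF r(1) that(1), of L] that(2,3) by simp
  have "m.d \<cdot> dU' = n.d \<cdot> dL'" by (rule canc) (simp_all add: q(2,4,6,8) eqs)
  moreover have "m.d \<cdot> cU' = n.c \<cdot> dL'" by (rule canc) (simp_all add: q(2,4,6,8) eqs)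
  moreover have "m.c \<cdot> dU' = n.d \<cdot> cL'" by (rule canc) (simp_all add: q(2,4,6,8) eqs)
  moreover have "m.c \<cdot> cU' = n.c \<cdot> cL'" by (rule canc) (simp_all add: q(2,4,6,8) eqs)
  moreover have "r \<cdot> (eU \<cdot> m.e) = r \<cdot> (eL \<cdot> n.e)" using eqs by simp
  ultimately show ?thesis unfolding double_graph_def by (simp add: qs eqs)
qed

lemma double_graph_groupoid:
  assumes SH: "smith_is_huq C" and g: "double_graph A dU cU eU dL cL eL"
    and U: "commute (ker C dU) (ker C cU)" and Lf: "commute (ker C dL) (ker C cL)"
  obtains G where "double_groupoid C A m.S n.S L G"
    "gd (gU G) = dU" "gc (gU G) = cU" "ge (gU G) = eU" "gd (gL G) = dL" "gc (gL G) = cL" "ge (gL G) = eL"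
    "gd (gR G) = m.d" "gc (gR G) = m.c" "ge (gR G) = m.e" "gd (gD G) = n.d" "gc (gD G) = n.c" "ge (gD G) = n.e"
proof -
  note [simp] = double_graphD(1-19)[OF g]
  note eqs = double_graphD(20-32)[OF g]
  obtain GU where GU: "internal_groupoid C A m.S GU" "gd GU = dU" "gc GU = cU" "ge GU = eU"
    by (rule commute_groupoid[OF SH, of dU A m.S cU eU]) (simp_all add: eqs U)
  obtain GL where GL: "internal_groupoid C A n.S GL" "gd GL = dL" "gc GL = cL" "ge GL = eL"
    by (rule commute_groupoid[OF SH, of dL A n.S cL eL]) (simp_all add: eqs Lf)
  obtain GR where GR: "internal_groupoid C m.S L GR" "gd GR = m.d" "gc GR = m.c" "ge GR = m.e" by (rule m.sd_groupoid[OF SH])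
  obtain GD where GD: "internal_groupoid C n.S L GD" "gd GD = n.d" "gc GD = n.c" "ge GD = n.e" by (rule n.sd_groupoid[OF SH])
  let ?G = "\<lparr>gU = GU, gL = GL, gR = GR, gD = GD\<rparr>"
  have "double_groupoid C A m.S n.S L ?G"
    by (rule double_groupoidI) (simp_all add: GU GL GR GD eqs)
  thus thesis by (rule that) (simp_all add: GU GL GR GD)
qed

section \<open>The structure maps on the pushout and on its quotient\<close>

abbreviation Q :: 'o where "Q \<equiv> poo m.e n.e"
abbreviation qdU :: 'a where "qdU \<equiv> q_dU C x y"
abbreviation qcU :: 'a where "qcU \<equiv> q_cU C x y"
abbreviation qeU :: 'a where "qeU \<equiv> q_eU C x y"
abbreviation qdL :: 'a where "qdL \<equiv> q_dL C x y"
abbreviation qcL :: 'a where "qcL \<equiv> q_cL C x y"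
abbreviation qeL :: 'a where "qeL \<equiv> q_eL C x y"
abbreviation TQ :: 'o where "TQ \<equiv> t_Q C x y"
abbreviation tq :: 'a where "tq \<equiv> t_quot C x y"
abbreviation tdU :: 'a where "tdU \<equiv> t_dU C x y"
abbreviation tcU :: 'a where "tcU \<equiv> t_cU C x y"
abbreviation teU :: 'a where "teU \<equiv> t_eU C x y"
abbreviation tdL :: 'a where "tdL \<equiv> t_dL C x y"
abbreviation tcL :: 'a where "tcL \<equiv> t_cL C x y"
abbreviation teL :: 'a where "teL \<equiv> t_eL C x y"
abbreviation MN :: 'o where "MN \<equiv> tensor C x y"
abbreviation \<gamma> :: 'a where "\<gamma> \<equiv> t_gamma C x y"

lemma double_graph_pushout:
  "double_graph Q qdU qcU qeU qdL qcL qeL"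
proof -
  have i: "arr qeU" "dom qeU = m.S" "cod qeU = Q" "arr qeL" "dom qeL = n.S" "cod qeL = Q"
    by (simp_all add: q_eU_def q_eL_def)
  have ie: "qeU \<cdot> m.e = qeL \<cdot> n.e" using po_comm[of m.e n.e] by (simp add: q_eU_def q_eL_def)
  have dU: "qdU \<in> hom C Q m.S \<and> qdU \<cdot> qeU = ide m.S \<and> qdU \<cdot> qeL = m.e \<cdot> n.d"
    unfolding q_dU_def q_eU_def q_eL_def m.sd_simps(9) by (rule po_copair) simp_all
  have cU: "qcU \<in> hom C Q m.S \<and> qcU \<cdot> qeU = ide m.S \<and> qcU \<cdot> qeL = m.e \<cdot> n.c"
    unfolding q_cU_def q_eU_def q_eL_def m.sd_simps(9) by (rule po_copair) simp_all
  have dL: "qdL \<in> hom C Q n.S \<and> qdL \<cdot> qeU = n.e \<cdot> m.d \<and> qdL \<cdot> qeL = ide n.S"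
    unfolding q_dL_def q_eU_def q_eL_def n.sd_simps(9) by (rule po_copair) simp_all
  have cL: "qcL \<in> hom C Q n.S \<and> qcL \<cdot> qeU = n.e \<cdot> m.c \<and> qcL \<cdot> qeL = ide n.S"
    unfolding q_cL_def q_eU_def q_eL_def n.sd_simps(9) by (rule po_copair) simp_all
  have h: "arr qdU" "dom qdU = Q" "cod qdU = m.S" "arr qcU" "dom qcU = Q" "cod qcU = m.S"
    "arr qdL" "dom qdL = Q" "cod qdL = n.S" "arr qcL" "dom qcL = Q" "cod qcL = n.S"
    using dU cU dL cL by simp_all
  have e: "qdU \<cdot> qeU = ide m.S" "qdU \<cdot> qeL = m.e \<cdot> n.d"
    "qcU \<cdot> qeU = ide m.S" "qcU \<cdot> qeL = m.e \<cdot> n.c"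
    "qdL \<cdot> qeU = n.e \<cdot> m.d" "qdL \<cdot> qeL = ide n.S"
    "qcL \<cdot> qeU = n.e \<cdot> m.c" "qcL \<cdot> qeL = ide n.S"
    using dU cU dL cL by blast+
  have ext: "a = b" if "a \<in> hom C Q L" "b \<in> hom C Q L" "a \<cdot> qeU = b \<cdot> qeU" "a \<cdot> qeL = b \<cdot> qeL" for a b
    using po_ext[of m.e n.e a L b] that unfolding q_eU_def q_eL_def by simp
  note [simp] = i h
  have "m.d \<cdot> qdU = n.d \<cdot> qdL" by (rule ext) (simp_all add: e)
  moreover have "m.d \<cdot> qcU = n.c \<cdot> qdL" by (rule ext) (simp_all add: e)
  moreover have "m.c \<cdot> qdU = n.d \<cdot> qcL" by (rule ext) (simp_all add: e)
  moreover have "m.c \<cdot> qcU = n.c \<cdot> qcL" by (rule ext) (simp_all add: e)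
  moreover have "obj Q" by (rule obj_cod) simp
  ultimately show ?thesis unfolding double_graph_def using e ie by simp
qed

lemmas q_simps [simp] = double_graphD(1-19)[OF double_graph_pushout]
lemmas q_laws = double_graphD(20-32)[OF double_graph_pushout]

abbreviation HL :: 'a where "HL \<equiv> huq C (ker C qdL) (ker C qcL)"
abbreviation HU :: 'a where "HU \<equiv> huq C (ker C qdU) (ker C qcU)"

lemma ker_homs:
  "ker C qdL \<in> hom C (dom (ker C qdL)) Q" "ker C qcL \<in> hom C (dom (ker C qcL)) Q"
  "ker C qdU \<in> hom C (dom (ker C qdU)) Q" "ker C qcU \<in> hom C (dom (ker C qcU)) Q"
  by simp_all

lemmas HL = huq_props[OF ker_homs(1,2)] and HU = huq_props[OF ker_homs(3,4)]

lemma join_HL_HU: "is_join C HL HU (join C HL HU)"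
  by (rule join_exists) (simp_all add: HL(1,2) HU(1,2))

lemma t_quot_simps [simp]: "arr tq" "dom tq = Q" "cod tq = TQ" "obj TQ"
  and t_quot_regular: "regular_epi C tq"
proof -
  have j: "arr (join C HL HU)" "cod (join C HL HU) = Q"
    using join_HL_HU HL(2) monic_arr by (auto simp: is_join_def)
  hence "arr tq" "dom tq = Q" by (simp_all add: t_quot_def)
  moreover have "cod tq = TQ" by (simp add: t_Q_def)
  ultimately show "arr tq" "dom tq = Q" "cod tq = TQ" "obj TQ"
    using obj_cod by metis+
  show "regular_epi C tq" unfolding t_quot_def using cokernel(2) j by simp
qed

text \<open>The cokernel of the join kills each commutator below it, and \<open>huq_props\<close>
  turns this into cooperators.\<close>

lemma t_quot_commute:
  "commute (tq \<cdot> ker C qdL) (tq \<cdot> ker C qcL)"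
  "commute (tq \<cdot> ker C qdU) (tq \<cdot> ker C qcU)"
proof -
  let ?j = "join C HL HU" and ?q = "tq"
  have j: "arr ?j" "cod ?j = Q" using join_HL_HU HL(2) monic_arr by (auto simp: is_join_def)
  have q: "?q \<in> hom C Q TQ" by simp
  have qj: "?q \<cdot> ?j = zero C (dom ?j) TQ" using j by (simp add: t_quot_def t_Q_def)
  have z: "?q \<cdot> h = zero C (dom h) TQ" if h: "sub_le C h ?j" for h
  proof -
    obtain w where w: "w \<in> hom C (dom h) (dom ?j)" "?j \<cdot> w = h" using h by (auto simp: sub_le_def)
    thus ?thesis using qj[THEN reassoc, of w] j by auto
  qed
  show "commute (?q \<cdot> ker C qdL) (?q \<cdot> ker C qcL)"
    using HL(3)[OF q] z join_HL_HU by (simp add: is_join_def)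
  show "commute (?q \<cdot> ker C qdU) (?q \<cdot> ker C qcU)"
    using HU(3)[OF q] z join_HL_HU by (simp add: is_join_def)
qed

text \<open>Universal property of the quotient: \<open>huq_props\<close> places both commutators
  inside the kernel of \<open>f\<close>, hence their join as well.\<close>

lemma t_desc:
  assumes f: "f \<in> hom C Q Y" and c: "commute (f \<cdot> ker C qdL) (f \<cdot> ker C qcL)"
    "commute (f \<cdot> ker C qdU) (f \<cdot> ker C qcU)"
  shows "t_desc C x y f \<in> hom C TQ Y \<and> t_desc C x y f \<cdot> tq = f"
proof -
  let ?j = "join C HL HU" and ?q = "tq"
  note [simp] = f[THEN homD]
  have j: "arr ?j" "cod ?j = Q" using join_HL_HU HL(2) monic_arr by (auto simp: is_join_def)
  have le: "sub_le C h (ker C f)" if h: "arr h" "cod h = Q" "f \<cdot> h = zero C (dom h) Y" for h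
  proof -
    obtain w where "w \<in> hom C (dom h) (dom (ker C f))" "ker C f \<cdot> w = h" using ker_lift[of f h "dom h"] h by auto
    thus ?thesis unfolding sub_le_def by blast
  qed
  have "sub_le C HL (ker C f)" by (rule le) (use HL(1,2) HL(3)[OF f] c(1) monic_arr in auto)
  moreover have "sub_le C HU (ker C f)" by (rule le) (use HU(1,2) HU(3)[OF f] c(2) monic_arr in auto)
  ultimately have "sub_le C ?j (ker C f)" using join_HL_HU ker_monic[of f] HL(2) by (simp add: is_join_def)
  then obtain w where w: "w \<in> hom C (dom ?j) (dom (ker C f))" "ker C f \<cdot> w = ?j" unfolding sub_le_def by blast
  have "f \<cdot> (ker C f \<cdot> w) = zero C (dom ?j) Y" using w(1) by simp
  hence "f \<cdot> ?j = zero C (dom ?j) Y" unfolding w(2) .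
  then obtain v where v: "v \<in> hom C TQ Y" "v \<cdot> ?q = f"
    using coker_desc[of ?j "dom ?j" Q f Y] j unfolding t_quot_def[symmetric] by auto
  have "\<exists>!w. w \<in> hom C TQ Y \<and> w \<cdot> ?q = f"
  proof (rule ex1I)
    show "v \<in> hom C TQ Y \<and> v \<cdot> ?q = f" using v by blast
    fix w assume w: "w \<in> hom C TQ Y \<and> w \<cdot> ?q = f"
    show "w = v" by (rule regular_epi_epi[OF t_quot_regular, of _ _ Y]) (use v w in simp_all)
  qed
  from theI'[OF this] show ?thesis by (simp add: t_desc_def)
qed

text \<open>For \<open>qdU\<close> and \<open>qcU\<close> one of the kernels of \<open>qdU\<close>,
  \<open>qcU\<close> is sent to zero, while the kernels of \<open>qdL\<close>, \<open>qcL\<close> go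
  into those of \<open>m.d\<close>, \<open>m.c\<close>, which commute by \<open>sd_commute\<close>.
  The other two maps are symmetric.\<close>

lemma t_maps:
  "tdU \<in> hom C TQ m.S \<and> tdU \<cdot> tq = qdU"
  "tcU \<in> hom C TQ m.S \<and> tcU \<cdot> tq = qcU"
  "tdL \<in> hom C TQ n.S \<and> tdL \<cdot> tq = qdL"
  "tcL \<in> hom C TQ n.S \<and> tcL \<cdot> tq = qcL"
proof -
  show "tdU \<in> hom C TQ m.S \<and> tdU \<cdot> tq = qdU"
    unfolding t_dU_def
  proof (rule t_desc)
    show "commute (qdU \<cdot> ker C qdL) (qdU \<cdot> ker C qcL)"
      by (rule commute_kernels_image[where X = Q and Z = "n.S" and g = "n.d" and g' = "n.d", OF _ _ _ _ _ _ _ _ _ m.sd_commute]) (simp_all add: q_laws)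
    show "commute (qdU \<cdot> ker C qdU) (qdU \<cdot> ker C qcU)"
      using commute_zero(1)[of "qdU \<cdot> ker C qcU"] by simp
  qed simp
  show "tcU \<in> hom C TQ m.S \<and> tcU \<cdot> tq = qcU"
    unfolding t_cU_def
  proof (rule t_desc)
    show "commute (qcU \<cdot> ker C qdL) (qcU \<cdot> ker C qcL)"
      by (rule commute_kernels_image[where X = Q and Z = "n.S" and g = "n.c" and g' = "n.c", OF _ _ _ _ _ _ _ _ _ m.sd_commute]) (simp_all add: q_laws)
    show "commute (qcU \<cdot> ker C qdU) (qcU \<cdot> ker C qcU)"
      using commute_zero(2)[of "qcU \<cdot> ker C qdU"] by simp
  qed simp
  show "tdL \<in> hom C TQ n.S \<and> tdL \<cdot> tq = qdL"
    unfolding t_dL_def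
  proof (rule t_desc)
    show "commute (qdL \<cdot> ker C qdU) (qdL \<cdot> ker C qcU)"
      by (rule commute_kernels_image[where X = Q and Z = "m.S" and g = "m.d" and g' = "m.d", OF _ _ _ _ _ _ _ _ _ n.sd_commute]) (simp_all add: q_laws)
    show "commute (qdL \<cdot> ker C qdL) (qdL \<cdot> ker C qcL)"
      using commute_zero(1)[of "qdL \<cdot> ker C qcL"] by simp
  qed simp
  show "tcL \<in> hom C TQ n.S \<and> tcL \<cdot> tq = qcL"
    unfolding t_cL_def
  proof (rule t_desc)
    show "commute (qcL \<cdot> ker C qdU) (qcL \<cdot> ker C qcU)"
      by (rule commute_kernels_image[where X = Q and Z = "m.S" and g = "m.c" and g' = "m.c", OF _ _ _ _ _ _ _ _ _ n.sd_commute]) (simp_all add: q_laws)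
    show "commute (qcL \<cdot> ker C qdL) (qcL \<cdot> ker C qcL)"
      using commute_zero(2)[of "qcL \<cdot> ker C qdL"] by simp
  qed simp
qed

lemma double_graph_tensor:
  "double_graph TQ tdU tcU teU tdL tcL teL"
  unfolding t_eU_def t_eL_def
  by (rule double_graph_quotient[OF double_graph_pushout t_quot_regular]) (use t_maps in simp_all)

lemmas t_simps [simp] = double_graphD(1-19)[OF double_graph_tensor]
lemmas t_laws = double_graphD(20-32)[OF double_graph_tensor]

lemma t_commute:
  "commute (ker C tdU) (ker C tcU)" "commute (ker C tdL) (ker C tcL)"
  by (rule quotient_commute[OF t_quot_regular _ _ _ _ _ _ _ t_quot_commute(2)]; use t_maps in simp)
    (rule quotient_commute[OF t_quot_regular _ _ _ _ _ _ _ t_quot_commute(1)]; use t_maps in simp)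

lemma t_gamma_simps [simp]:
  "arr \<gamma>" "dom \<gamma> = MN" "cod \<gamma> = TQ" "obj MN"
  by (simp_all add: t_gamma_def tensor_def)

lemma t_gamma_monic: "monic C \<gamma>"
  unfolding t_gamma_def by (rule ker_monic) simp

lemma t_gamma_zero [simp]:
  "tdU \<cdot> \<gamma> = zero C MN m.S" "tdL \<cdot> \<gamma> = zero C MN n.S"
proof -
  have "pair C tdU tdL \<cdot> \<gamma> = zero C MN (prd m.S n.S)"
    using ker_simps(3)[of "pair C tdU tdL"] by (simp add: t_gamma_def tensor_def)
  hence z: "pair C (tdU \<cdot> \<gamma>) (tdL \<cdot> \<gamma>) = zero C MN (prd m.S n.S)" by simp
  show "tdU \<cdot> \<gamma> = zero C MN m.S"
    using arg_cong[OF z, of "\<lambda>w. proj1 C m.S n.S \<cdot> w"] by simp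
  show "tdL \<cdot> \<gamma> = zero C MN n.S"
    using arg_cong[OF z, of "\<lambda>w. proj2 C m.S n.S \<cdot> w"] by simp
qed

lemma t_gamma_lift:
  assumes u: "u \<in> hom C T TQ" "tdU \<cdot> u = zero C T m.S" "tdL \<cdot> u = zero C T n.S"
  obtains w where "w \<in> hom C T MN" "\<gamma> \<cdot> w = u"
proof -
  note [simp] = u(1)[THEN homD]
  have "pair C tdU tdL \<cdot> u = zero C T (prd m.S n.S)"
    by (rule prod_ext[of _ T m.S n.S]) (use u in simp_all)
  then obtain w where "w \<in> hom C T (dom (ker C (pair C tdU tdL)))" "ker C (pair C tdU tdL) \<cdot> w = u"
    using ker_lift[of "pair C tdU tdL" u T] by auto
  thus thesis using that unfolding tensor_def t_gamma_def by blast
qed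

lemma monic_the:
  assumes "monic C k" "w \<in> hom C T (dom k)" "k \<cdot> w = u" and t: "t = (THE w. w \<in> hom C T (dom k) \<and> k \<cdot> w = u)"
  shows "t \<in> hom C T (dom k) \<and> k \<cdot> t = u"
proof -
  have "\<exists>!w. w \<in> hom C T (dom k) \<and> k \<cdot> w = u" using assms(2,3) monicD[OF assms(1)] by metis
  from theI'[OF this] show ?thesis unfolding t .
qed

lemma tensor_pi1: "tensor_pi1 C x y \<in> hom C MN M \<and> m.k \<cdot> tensor_pi1 C x y = tcU \<cdot> \<gamma>"
proof -
  have "m.d \<cdot> (tcU \<cdot> \<gamma>) = zero C MN L" using t_laws(6)[THEN reassoc, of "\<gamma>"] by simp
  then obtain w where "w \<in> hom C MN (dom m.k)" "m.k \<cdot> w = tcU \<cdot> \<gamma>"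
    using is_kernel_lift[OF m.sd_kernel, of "tcU \<cdot> \<gamma>" "MN"] by auto
  from monic_the[OF is_kernel_monic[OF m.sd_kernel] this] show ?thesis by (simp add: tensor_pi1_def)
qed

lemma tensor_pi2: "tensor_pi2 C x y \<in> hom C MN N \<and> n.k \<cdot> tensor_pi2 C x y = tcL \<cdot> \<gamma>"
proof -
  have "n.d \<cdot> (tcL \<cdot> \<gamma>) = zero C MN L" using t_laws(7)[THEN reassoc, of "\<gamma>"] by simp
  then obtain w where "w \<in> hom C MN (dom n.k)" "n.k \<cdot> w = tcL \<cdot> \<gamma>"
    using is_kernel_lift[OF n.sd_kernel, of "tcL \<cdot> \<gamma>" "MN"] by auto
  from monic_the[OF is_kernel_monic[OF n.sd_kernel] this] show ?thesis by (simp add: tensor_pi2_def)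
qed

text \<open>Conjugation restricts along \<open>\<gamma>\<close>: after a map that kills
  \<open>\<gamma>\<close>, the copairing factors through the retraction onto \<open>L\<close>, and
  this vanishes on \<open>kflat\<close>.\<close>

lemma tensor_act:
  "tensor_act C x y \<in> hom C (flat C L MN) MN \<and>
   \<gamma> \<cdot> tensor_act C x y = copair C (teU \<cdot> m.e) \<gamma> \<cdot> kflat C L MN"
proof -
  let ?T = "MN" and ?e = "teU \<cdot> m.e" and ?g = "\<gamma>"
  have z: "f \<cdot> (copair C ?e ?g \<cdot> kflat C L ?T) = zero C (flat C L ?T) Y"
    if f: "f \<in> hom C TQ Y" "f \<cdot> ?g = zero C ?T Y" for f Y
  proof -
    note [simp] = f(1)[THEN homD] f(2)
    have "f \<cdot> (copair C ?e ?g \<cdot> kflat C L ?T) = (f \<cdot> ?e) \<cdot> (retr L ?T \<cdot> kflat C L ?T)"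
      using comp_copair'[of "ide L" "zero C ?T L" "f \<cdot> ?e" "kflat C L ?T"] by (simp del: kflat_simps(5))
    thus ?thesis by simp
  qed
  obtain w where w: "w \<in> hom C (flat C L ?T) ?T" "?g \<cdot> w = copair C ?e ?g \<cdot> kflat C L ?T"
    using t_gamma_lift[of "copair C ?e ?g \<cdot> kflat C L ?T" "flat C L ?T"] z[of "tdU" m.S] z[of "tdL" n.S] by auto
  have c: "conjugation C TQ \<cdot> flat_map C ?e ?g = copair C ?e ?g \<cdot> kflat C L ?T"
    by (rule conjugation_flat_map) simp_all
  have "w \<in> hom C (flat C L ?T) (dom ?g)" using w(1) by simp
  from monic_the[OF t_gamma_monic this w(2)] show ?thesis by (simp add: tensor_act_def c)
qed

section \<open>The crossed square\<close>

lemma crossed_square: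
  assumes SH: "smith_is_huq C"
    and p: "pM \<in> hom C P M" "pN \<in> hom C P N" and xiP: "\<xi>P \<in> hom C (flat C L P) P"
    and h: "h \<in> hom C MN P" "pM \<cdot> h = tensor_pi1 C x y" "pN \<cdot> h = tensor_pi2 C x y"
      "h \<cdot> tensor_act C x y = \<xi>P \<cdot> flat_map C (ide L) h"
    and hr: "regular_epi C h" and nm: "normal_mono C (\<gamma> \<cdot> ker C h)"
  shows "\<exists>G. induced_by_double_groupoid C G P M N L pM pN \<mu> \<nu> \<xi>M \<xi>N \<xi>P h"
proof -
  note [simp] = p[THEN homD] xiP[THEN homD] h(1)[THEN homD]
  let ?kh = "ker C h"
  have n1: "arr (tensor_pi1 C x y)" "dom (tensor_pi1 C x y) = MN" "cod (tensor_pi1 C x y) = M" "m.k \<cdot> tensor_pi1 C x y = tcU \<cdot> \<gamma>"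
    using tensor_pi1 by simp_all
  have n2: "arr (tensor_pi2 C x y)" "dom (tensor_pi2 C x y) = MN" "cod (tensor_pi2 C x y) = N" "n.k \<cdot> tensor_pi2 C x y = tcL \<cdot> \<gamma>"
    using tensor_pi2 by simp_all
  note [simp] = n1(1-3) n2(1-3)
  define q where "q = coker C (\<gamma> \<cdot> ?kh)"
  define A where "A = cod q"
  have q: "q \<in> hom C TQ A" unfolding A_def q_def by simp
  note [simp] = q[THEN homD]
  have qr: "regular_epi C q" unfolding q_def by (rule cokernel(2)[of _ "dom ?kh" TQ]) simp
  have qk: "is_kernel C q (\<gamma> \<cdot> ?kh)" unfolding q_def by (rule normal_mono_coker[OF nm])
  have qz: "q \<cdot> (\<gamma> \<cdot> ?kh) = zero C (dom ?kh) A" using is_kernelD(4)[OF qk] by simp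
  have desc: "\<exists>w. w \<in> hom C A Y \<and> w \<cdot> q = f" if "f \<in> hom C TQ Y" "f \<cdot> (\<gamma> \<cdot> ?kh) = zero C (dom ?kh) Y" for f Y
    using coker_desc[of "\<gamma> \<cdot> ?kh" "dom ?kh" TQ f Y] that unfolding A_def q_def by auto
  have "tdU \<cdot> (\<gamma> \<cdot> ?kh) = zero C (dom ?kh) m.S" using t_gamma_zero(1)[THEN reassoc, of ?kh] by simp
  then obtain dU where dU: "dU \<in> hom C A m.S" "dU \<cdot> q = tdU" using desc[of tdU m.S] by auto
  have "tdL \<cdot> (\<gamma> \<cdot> ?kh) = zero C (dom ?kh) n.S" using t_gamma_zero(2)[THEN reassoc, of ?kh] by simp
  then obtain dL where dL: "dL \<in> hom C A n.S" "dL \<cdot> q = tdL" using desc[of tdL n.S] by auto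
  have "tcU \<cdot> (\<gamma> \<cdot> ?kh) = m.k \<cdot> (tensor_pi1 C x y \<cdot> ?kh)" using n1(4)[THEN reassoc, of ?kh] by simp
  also have "\<dots> = zero C (dom ?kh) m.S" using h(2)[THEN reassoc, of ?kh, symmetric] by simp
  finally obtain cU where cU: "cU \<in> hom C A m.S" "cU \<cdot> q = tcU" using desc[of tcU m.S] by auto
  have "tcL \<cdot> (\<gamma> \<cdot> ?kh) = n.k \<cdot> (tensor_pi2 C x y \<cdot> ?kh)" using n2(4)[THEN reassoc, of ?kh] by simp
  also have "\<dots> = zero C (dom ?kh) n.S" using h(3)[THEN reassoc, of ?kh, symmetric] by simp
  finally obtain cL where cL: "cL \<in> hom C A n.S" "cL \<cdot> q = tcL" using desc[of tcL n.S] by auto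
  have dg: "double_graph A dU cU (q \<cdot> teU) dL cL (q \<cdot> teL)"
    by (rule double_graph_quotient[OF double_graph_tensor qr q dU cU dL cL])
  note [simp] = double_graphD(1-19)[OF dg]
  note eqs = double_graphD(20-32)[OF dg]
  have U: "commute (ker C dU) (ker C cU)"
    by (rule quotient_commute[OF qr q dU(1) _ dU(2) cU(1) _ cU(2) commute_comp[OF t_commute(1) _ _ q]]) simp_all
  have Lf: "commute (ker C dL) (ker C cL)"
    by (rule quotient_commute[OF qr q dL(1) _ dL(2) cL(1) _ cL(2) commute_comp[OF t_commute(2) _ _ q]]) simp_all
  obtain G where G: "double_groupoid C A m.S n.S L G"
    "gd (gU G) = dU" "gc (gU G) = cU" "ge (gU G) = q \<cdot> teU" "gd (gL G) = dL" "gc (gL G) = cL" "ge (gL G) = q \<cdot> teL"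
    "gd (gR G) = m.d" "gc (gR G) = m.c" "ge (gR G) = m.e" "gd (gD G) = n.d" "gc (gD G) = n.c" "ge (gD G) = n.e"
    by (rule double_graph_groupoid[OF SH dg U Lf])
  obtain T where T: "double_groupoid C TQ m.S n.S L T"
    "gd (gU T) = tdU" "gc (gU T) = tcU" "ge (gU T) = teU" "gd (gL T) = tdL" "gc (gL T) = tcL" "ge (gL T) = teL"
    "gd (gR T) = m.d" "gc (gR T) = m.c" "ge (gR T) = m.e" "gd (gD T) = n.d" "gc (gD T) = n.c" "ge (gD T) = n.e"
    by (rule double_graph_groupoid[OF SH double_graph_tensor t_commute])
  have tdg: "tensor_double_groupoid C x y T" unfolding tensor_double_groupoid_def using T by simp
  note gG = G(1)[unfolded double_groupoid_def] and gT = T(1)[unfolded double_groupoid_def]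
  have df: "double_functor C T G q (ide m.S) (ide n.S) (ide L)"
    unfolding double_functor_def
  proof (intro conjI)
    show "internal_functor C (gU T) (gU G) q (ide m.S)"
      by (rule graph_morphism_functor[of TQ m.S _ A m.S]) (use gG gT in \<open>simp_all add: G T dU cU\<close>)
    show "internal_functor C (gL T) (gL G) q (ide n.S)"
      by (rule graph_morphism_functor[of TQ n.S _ A n.S]) (use gG gT in \<open>simp_all add: G T dL cL\<close>)
    show "internal_functor C (gR T) (gR G) (ide m.S) (ide L)"
      by (rule graph_morphism_functor[of m.S L _ m.S L]) (use gG gT in \<open>simp_all add: G T\<close>)
    show "internal_functor C (gD T) (gD G) (ide n.S) (ide L)"
      by (rule graph_morphism_functor[of n.S L _ n.S L]) (use gG gT in \<open>simp_all add: G T\<close>)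
  qed
  have "(q \<cdot> \<gamma>) \<cdot> ker C h = zero C (dom ?kh) A" using qz by simp
  then obtain j where j: "j \<in> hom C P A" "j \<cdot> h = q \<cdot> \<gamma>" using regular_epi_desc0[OF hr, of "q \<cdot> \<gamma>" A] by auto
  note [simp] = j(1)[THEN homD]
  \<comment> \<open>Factoring \<open>q \<cdot> \<gamma>\<close> gives a second regular epimorphism
    \<open>e\<close> out of the tensor product. Equal kernels make \<open>h\<close> and
    \<open>e\<close> factor through each other, so \<open>j\<close> is the mono \<open>i\<close> up
    to isomorphism.\<close>
  have "q \<cdot> \<gamma> \<in> hom C MN A" by simp
  then obtain e i where ei: "regular_epi C e" "e \<in> hom C MN (dom i)" "monic C i" "cod i = A" "i \<cdot> e = q \<cdot> \<gamma>"
    by (rule image_factor)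
  note [simp] = ei(2)[THEN homD] monic_arr[OF ei(3)] ei(4)
  have jm: "monic C j"
  proof (rule monicI)
    have "i \<cdot> (e \<cdot> ?kh) = zero C (dom ?kh) A" using ei(5)[THEN reassoc, of ?kh] qz by simp
    hence "i \<cdot> (e \<cdot> ?kh) = i \<cdot> zero C (dom ?kh) (dom i)" by simp
    hence "e \<cdot> ?kh = zero C (dom ?kh) (dom i)" by (rule monicD[OF ei(3), of _ _ "dom ?kh"]) simp_all
    then obtain w where w: "w \<in> hom C P (dom i)" "w \<cdot> h = e" using regular_epi_desc0[OF hr, of e "dom i"] by auto
    note [simp] = w(1)[THEN homD]
    \<comment> \<open>Here normality enters: what \<open>q\<close> kills factors through
      \<open>\<gamma> \<cdot> ?kh\<close> itself, not merely through its normal closure.\<close>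
    have "q \<cdot> (\<gamma> \<cdot> ker C e) = zero C (dom (ker C e)) A" using ei(5)[THEN reassoc, of "ker C e"] by simp
    then obtain z where z: "z \<in> hom C (dom (ker C e)) (dom ?kh)" "(\<gamma> \<cdot> ?kh) \<cdot> z = \<gamma> \<cdot> ker C e"
      using is_kernel_lift[OF qk, of "\<gamma> \<cdot> ker C e" "dom (ker C e)"] by auto
    note [simp] = z(1)[THEN homD]
    have "\<gamma> \<cdot> (?kh \<cdot> z) = \<gamma> \<cdot> ker C e" using z(2) by simp
    hence kz: "?kh \<cdot> z = ker C e" by (rule monicD[OF t_gamma_monic, of _ _ "dom (ker C e)"]) simp_all
    have "h \<cdot> (?kh \<cdot> z) = zero C (dom (ker C e)) P" by simp
    hence "h \<cdot> ker C e = zero C (dom (ker C e)) P" unfolding kz .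
    then obtain w' where w': "w' \<in> hom C (dom i) P" "w' \<cdot> e = h" using regular_epi_desc0[OF ei(1), of h P] by auto
    note [simp] = w'(1)[THEN homD]
    have "(w' \<cdot> w) \<cdot> h = ide P \<cdot> h" using w(2) w'(2) by simp
    hence ww: "w' \<cdot> w = ide P" by (rule regular_epi_epi[OF hr, of _ _ P]) simp_all
    have "(i \<cdot> w) \<cdot> h = j \<cdot> h" using w(2) ei(5) j(2) by simp
    hence iw: "i \<cdot> w = j" by (rule regular_epi_epi[OF hr, of _ _ A]) simp_all
    fix u v T assume uv: "u \<in> hom C T (dom j)" "v \<in> hom C T (dom j)" "j \<cdot> u = j \<cdot> v"
    note [simp] = uv(1,2)[THEN homD]
    have "i \<cdot> (w \<cdot> u) = i \<cdot> (w \<cdot> v)" using iw[THEN reassoc, of u] iw[THEN reassoc, of v] uv(3) by simp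
    hence "w \<cdot> u = w \<cdot> v" by (rule monicD[OF ei(3), of _ _ T]) simp_all
    hence "w' \<cdot> (w \<cdot> u) = w' \<cdot> (w \<cdot> v)" by simp
    thus "u = v" using ww[THEN reassoc, of u] ww[THEN reassoc, of v] by simp
  qed simp
  have "(dU \<cdot> j) \<cdot> h = zero C P m.S \<cdot> h" using j(2) dU(2)[THEN reassoc, of \<gamma>] by simp
  hence dUj: "dU \<cdot> j = zero C P m.S" by (rule regular_epi_epi[OF hr, of _ _ m.S]) simp_all
  have "(dL \<cdot> j) \<cdot> h = zero C P n.S \<cdot> h" using j(2) dL(2)[THEN reassoc, of \<gamma>] by simp
  hence dLj: "dL \<cdot> j = zero C P n.S" by (rule regular_epi_epi[OF hr, of _ _ n.S]) simp_all
  \<comment> \<open>An element of \<open>A\<close> killed by both domains lifts along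
    \<open>q\<close> over a cover; the lift is killed by \<open>tdU\<close> and \<open>tdL\<close>,
    hence lies in the tensor product, and \<open>h\<close> maps it to \<open>P\<close>. Monicity of
    \<open>j\<close> removes the cover.\<close>
  have lift: "\<exists>w. w \<in> hom C S P \<and> j \<cdot> w = u" if u: "u \<in> hom C S A" "dU \<cdot> u = zero C S m.S" "dL \<cdot> u = zero C S n.S" for u S
  proof -
    note [simp] = u(1)[THEN homD]
    define t s where "t = pb2 C q u" and "s = pb1 C q u"
    define S' where "S' = dom t"
    have t: "regular_epi C t" unfolding t_def by (rule regular_epi_pb2[OF qr]) simp_all
    have ts [simp]: "arr t" "dom t = S'" "cod t = S" "arr s" "dom s = S'" "cod s = TQ" "obj S'"
      and qs: "q \<cdot> s = u \<cdot> t"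
      unfolding S'_def t_def s_def using pb_comm[of q u] by simp_all
    have 1: "tdU \<cdot> s = zero C S' m.S" using dU(2)[THEN reassoc, of s] qs u(2)[THEN reassoc, of t] by simp
    have 2: "tdL \<cdot> s = zero C S' n.S" using dL(2)[THEN reassoc, of s] qs u(3)[THEN reassoc, of t] by simp
    obtain z where z: "z \<in> hom C S' MN" "\<gamma> \<cdot> z = s" by (rule t_gamma_lift[of s S']) (use 1 2 in simp_all)
    note [simp] = z(1)[THEN homD]
    have "u \<cdot> t = j \<cdot> (h \<cdot> z)" using j(2)[THEN reassoc, of z] z(2) qs by simp
    then obtain w where "w \<in> hom C (cod t) (dom j)" "j \<cdot> w = u" by (rule regular_epi_lift[OF t jm, rotated 2]) simp_all
    thus ?thesis by auto
  qed
  have meet: "is_meet C (ker C dU) (ker C dL) j"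
    unfolding is_meet_def
  proof (intro conjI allI impI)
    obtain w where "w \<in> hom C P (dom (ker C dU))" "ker C dU \<cdot> w = j" using ker_lift[of dU j P] dUj by auto
    thus "sub_le C j (ker C dU)" unfolding sub_le_def by auto
    obtain w where "w \<in> hom C P (dom (ker C dL))" "ker C dL \<cdot> w = j" using ker_lift[of dL j P] dLj by auto
    thus "sub_le C j (ker C dL)" unfolding sub_le_def by auto
    fix u assume u: "monic C u \<and> cod u = cod (ker C dU) \<and> sub_le C u (ker C dU) \<and> sub_le C u (ker C dL)"
    then obtain a b where a: "a \<in> hom C (dom u) (dom (ker C dU))" "ker C dU \<cdot> a = u" and b: "b \<in> hom C (dom u) (dom (ker C dL))" "ker C dL \<cdot> b = u"
      unfolding sub_le_def by blast
    have "dU \<cdot> (ker C dU \<cdot> a) = zero C (dom u) m.S" using a(1) by simp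
    moreover have "dL \<cdot> (ker C dL \<cdot> b) = zero C (dom u) n.S" using b(1) by simp
    moreover have "u \<in> hom C (dom u) A" using u monic_arr[of u] by simp
    ultimately have "\<exists>w. w \<in> hom C (dom u) P \<and> j \<cdot> w = u" using lift[of u "dom u"] unfolding a(2) b(2) by blast
    thus "sub_le C u j" unfolding sub_le_def by auto
  qed (use jm in simp_all)
  have "(m.k \<cdot> pM) \<cdot> h = (cU \<cdot> j) \<cdot> h" using h(2) n1(4) j(2) cU(2)[THEN reassoc, of \<gamma>] by simp
  hence kpM: "m.k \<cdot> pM = cU \<cdot> j" by (rule regular_epi_epi[OF hr, of _ _ m.S]) simp_all
  have "(n.k \<cdot> pN) \<cdot> h = (cL \<cdot> j) \<cdot> h" using h(3) n2(4) j(2) cL(2)[THEN reassoc, of \<gamma>] by simp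
  hence kpN: "n.k \<cdot> pN = cL \<cdot> j" by (rule regular_epi_epi[OF hr, of _ _ n.S]) simp_all
  have kxM: "m.k \<cdot> \<xi>M = conjugation C m.S \<cdot> flat_map C m.e m.k"
    using m.sd_conj conjugation_flat_map[of m.e L m.S m.k M] by simp
  have kxN: "n.k \<cdot> \<xi>N = conjugation C n.S \<cdot> flat_map C n.e n.k"
    using n.sd_conj conjugation_flat_map[of n.e L n.S n.k N] by simp
  have ta: "arr (tensor_act C x y)" "dom (tensor_act C x y) = flat C L MN" "cod (tensor_act C x y) = MN"
    "\<gamma> \<cdot> tensor_act C x y = copair C (teU \<cdot> m.e) \<gamma> \<cdot> kflat C L MN" using tensor_act by simp_all
  note [simp] = ta(1-3)
  let ?F = "flat_map C (ide L) h" and ?e = "(q \<cdot> teL) \<cdot> n.e"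
  have ee: "?e = q \<cdot> (teU \<cdot> m.e)" using t_laws(13) by simp
  have cj: "conjugation C A \<cdot> flat_map C ?e j = copair C ?e j \<cdot> kflat C L P" by (rule conjugation_flat_map) simp_all
  \<comment> \<open>The action on \<open>P\<close> is determined by that on the tensor product, as
    \<open>h\<close> is equivariant and \<open>?F\<close> is epic; on the tensor product it is
    conjugation, which \<open>q\<close> preserves.\<close>
  have "(j \<cdot> \<xi>P) \<cdot> ?F = q \<cdot> (\<gamma> \<cdot> tensor_act C x y)"
    using h(4) j(2)[THEN reassoc, of "tensor_act C x y"] by simp
  also have "\<dots> = copair C ?e (j \<cdot> h) \<cdot> kflat C L MN" unfolding ta(4) j(2) ee by simp
  also have "\<dots> = (copair C ?e j \<cdot> kflat C L P) \<cdot> ?F"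
    using copair_flat_map[of "ide L" L L h MN P ?e A j] by simp
  finally have "(j \<cdot> \<xi>P) \<cdot> ?F = (copair C ?e j \<cdot> kflat C L P) \<cdot> ?F" .
  hence jx: "j \<cdot> \<xi>P = copair C ?e j \<cdot> kflat C L P"
    by (rule regular_epi_epi[OF regular_epi_flat_map[OF hr h(1) m.bdry_simps(8)], of _ _ A]) simp_all
  have "\<exists>T FA FB FE FD. tensor_double_groupoid C x y T \<and> double_functor C T G FA FB FE FD \<and>
           FD = ide L \<and> FB \<cdot> m.k = m.k \<and> FE \<cdot> n.k = n.k \<and> FA \<cdot> \<gamma> = j \<cdot> h"
    by (rule exI[of _ T], rule exI[of _ q], rule exI[of _ "ide m.S"], rule exI[of _ "ide n.S"], rule exI[of _ "ide L"])
      (use tdg df j(2) in simp)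
  moreover have "is_meet C (ker C (gd (gU G))) (ker C (gd (gL G))) j" using meet G by simp
  ultimately have "induced_by_double_groupoid C G P M N L pM pN \<mu> \<nu> \<xi>M \<xi>N \<xi>P h"
    unfolding induced_by_double_groupoid_def
    by (intro exI[of _ A] exI[of _ m.S] exI[of _ n.S] exI[of _ m.k] exI[of _ n.k] exI[of _ j] conjI)
      (simp_all add: G m.sd_kernel n.sd_kernel kpM kpN kxM kxN jx cj[simplified])
  thus ?thesis by blast
qed

end

theorem theorem8p10:
  fixes C :: "('o, 'a) cat" (structure)
    and P M N L :: 'o
    and pM pN \<mu> \<nu> \<xi>M \<xi>N \<xi>P h :: 'a
  assumes "semi_abelian C"
    and "smith_is_huq C"
    and "weak_crossed_square C P M N L pM pN \<mu> \<nu> \<xi>M \<xi>N \<xi>P h"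
    and "regular_epi C h"
    and "normal_mono C (t_gamma C (\<mu>, \<xi>M) (\<nu>, \<xi>N) \<cdot> ker C h)"
  shows "\<exists>G. induced_by_double_groupoid C G P M N L pM pN \<mu> \<nu> \<xi>M \<xi>N \<xi>P h"
proof -
  note w = assms(3)[unfolded weak_crossed_square_def Let_def]
  interpret xmodule_pair C M N L \<mu> \<nu> \<xi>M \<xi>N
    using assms(1) w by unfold_locales blast+
  show ?thesis
    by (rule crossed_square[OF assms(2)]) (use w assms(4,5) in \<open>auto simp: is_action_def\<close>)
qed

end
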